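(* Let $\gamma>0$ and $\theta_m=m^{\gamma}$ for all $m\ge 1$. For $1\le b\le n$ let $$d_b(n):=d_{TV}\big(\mathcal{L}(C_1,C_2,\dots,C_b),\ \mathcal{L}(Z_1,Z_2,\dots,Z_b)\big),$$ where $C_1,\dots,C_b$ are the cycle counts of a random permutation in $\mathfrak{S}_n$ chosen according to $\mathbb{P}_\Theta^n$ and $Z_1,\dots,Z_b$ are independent Poisson random variables with means $\mathbb{E}[Z_m]=m^{\gamma-1}t^m$, with $$t=t_n=\exp(-\eta_\gamma),\qquad \eta_\gamma=\Big(\frac{n}{\Gamma(1+\gamma)}\Big)^{-\frac{1}{1+\gamma}}.$$ Let $b=b(n)$ be a sequence of integers with $1\le b(n)\le n$. Then, as $n\to\infty$, $$d_b(n)\to 0\quad\text{if and only if}\quad b=o\big(n^{\frac{1}{1+\gamma}}\big).$$ Furthermore, if $b=o(n^{\frac{1}{1+\gamma}})$, then $$d_b(n)=O\Big(b^{2+\gamma}n^{-\frac{2+\gamma}{1+\gamma}}+b^{-\frac{\gamma}{6}}+n^{-\frac{\gamma}{1+\gamma}}\Big).$$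
   Context: $\mathfrak{S}_n$ is the group of permutations of $n$ objects. For $\sigma\in\mathfrak{S}_n$, $C_m=C_m(\sigma)$ is the number of cycles of length $m$ in the decomposition of $\sigma$ into disjoint cycles. For a sequence $\Theta=(\theta_m)_{m\ge1}$ of non-negative weights, the weighted measure $\mathbb{P}_\Theta^n$ on $\mathfrak{S}_n$ is $\mathbb{P}_\Theta^n[\sigma]=\frac{1}{h_n\,n!}\prod_{m=1}^n\theta_m^{C_m}$, where $h_n$ is the normalization constant making this a probability measure. $\mathcal{L}(X)$ denotes the law of $X$, and $d_{TV}$ is the total variation distance between probability laws, i.e. $d_{TV}(\mu,\nu)=\sup_A|\mu(A)-\nu(A)|$. *)

theory Defs
  imports
    "HOL-Probability.Probability"
    "HOL-Combinatorics.Orbits"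
    "HOL-Library.Landau_Symbols"
begin

text \<open>Cycles are identified with orbits; fixed points are cycles of length one.\<close>

definition cycle_count :: "nat \<Rightarrow> (nat \<Rightarrow> nat) \<Rightarrow> nat \<Rightarrow> nat" where
  "cycle_count n \<sigma> m = card {c \<in> orbit \<sigma> ` {1..n}. card c = m}"

definition perm_weight :: "(nat \<Rightarrow> real) \<Rightarrow> nat \<Rightarrow> (nat \<Rightarrow> nat) \<Rightarrow> real" where
  "perm_weight \<theta> n \<sigma> = (\<Prod>m=1..n. \<theta> m ^ cycle_count n \<sigma> m)"

definition perm_norm :: "(nat \<Rightarrow> real) \<Rightarrow> nat \<Rightarrow> real" where
  "perm_norm \<theta> n = (\<Sum>\<sigma> | \<sigma> permutes {1..n}. perm_weight \<theta> n \<sigma>) / fact n"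

text \<open>
  The use of \<open>embed_pmf\<close> is meaningful for non-negative weights with
  \<open>perm_norm \<theta> n > 0\<close>; see \<open>pmf_weighted_perm\<close> below.
\<close>

definition weighted_perm_pmf :: "(nat \<Rightarrow> real) \<Rightarrow> nat \<Rightarrow> (nat \<Rightarrow> nat) pmf" where
  "weighted_perm_pmf \<theta> n = embed_pmf (\<lambda>\<sigma>.
     if \<sigma> permutes {1..n} then perm_weight \<theta> n \<sigma> / (perm_norm \<theta> n * fact n) else 0)"

lemma pmf_weighted_perm:
  assumes nonneg: "\<And>m. m \<ge> 1 \<Longrightarrow> \<theta> m \<ge> 0" and pos: "perm_norm \<theta> n > 0"
  shows "pmf (weighted_perm_pmf \<theta> n) \<sigma> =
    (if \<sigma> permutes {1..n} then perm_weight \<theta> n \<sigma> / (perm_norm \<theta> n * fact n) else 0)"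
  unfolding weighted_perm_pmf_def
proof (rule pmf_embed_pmf)
  let ?f = "\<lambda>\<sigma>. if \<sigma> permutes {1..n} then perm_weight \<theta> n \<sigma> / (perm_norm \<theta> n * fact n) else 0"
  let ?S = "{\<sigma>. \<sigma> permutes {1..n}}"
  have fin: "finite ?S" by (rule finite_permutations) simp
  show nn: "0 \<le> ?f x" for x
    using nonneg pos by (auto simp: perm_weight_def intro!: divide_nonneg_nonneg prod_nonneg)
  have "(\<integral>\<^sup>+x. ennreal (?f x) \<partial>count_space UNIV) = (\<Sum>x\<in>?S. ennreal (?f x))"
    by (rule nn_integral_count_space'[OF fin]) (auto split: if_splits)
  also have "\<dots> = ennreal (\<Sum>x\<in>?S. ?f x)"
    by (rule sum_ennreal) (rule nn)
  also have "(\<Sum>x\<in>?S. ?f x) = (\<Sum>x\<in>?S. perm_weight \<theta> n x) / (perm_norm \<theta> n * fact n)"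
    by (simp add: sum_divide_distrib)
  also have "\<dots> = 1"
    using pos unfolding perm_norm_def by (cases "sum (perm_weight \<theta> n) ?S = 0") simp_all
  finally show "(\<integral>\<^sup>+x. ennreal (?f x) \<partial>count_space UNIV) = 1" by simp
qed

lemma perm_norm_pos:
  assumes "\<And>m. m \<ge> 1 \<Longrightarrow> \<theta> m > 0"
  shows "perm_norm \<theta> n > 0"
  unfolding perm_norm_def perm_weight_def
  using assms
  by (intro divide_pos_pos sum_pos finite_permutations prod_pos ballI zero_less_power)
     (auto intro: permutes_id)

definition dTV :: "'a pmf \<Rightarrow> 'a pmf \<Rightarrow> real" where
  "dTV p q = (SUP A. \<bar>measure_pmf.prob p A - measure_pmf.prob q A\<bar>)"

text \<open>
  A tuple indexed by \<open>1, \<dots>, b\<close> is a function that is \<open>0\<close> outside \<open>{1..b}\<close>, the convention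
  used by \<open>Pi_pmf {1..b} 0\<close>.
\<close>

definition cycle_counts_law :: "real \<Rightarrow> nat \<Rightarrow> nat \<Rightarrow> (nat \<Rightarrow> nat) pmf" where
  "cycle_counts_law \<gamma> n b =
     map_pmf (\<lambda>\<sigma> m. if m \<in> {1..b} then cycle_count n \<sigma> m else 0)
       (weighted_perm_pmf (\<lambda>m. real m powr \<gamma>) n)"

definition eta :: "real \<Rightarrow> nat \<Rightarrow> real" where
  "eta \<gamma> n = (real n / Gamma (1 + \<gamma>)) powr (- 1 / (1 + \<gamma>))"

definition poisson_law :: "real \<Rightarrow> nat \<Rightarrow> nat \<Rightarrow> (nat \<Rightarrow> nat) pmf" where
  "poisson_law \<gamma> n b =
     Pi_pmf {1..b} 0 (\<lambda>m. poisson_pmf (real m powr (\<gamma> - 1) * exp (- eta \<gamma> n) ^ m))"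

definition d_b :: "real \<Rightarrow> nat \<Rightarrow> nat \<Rightarrow> real" where
  "d_b \<gamma> b n = dTV (cycle_counts_law \<gamma> n b) (poisson_law \<gamma> n b)"

end

theory Submission
  imports Defs "HOL-Complex_Analysis.Complex_Analysis" "HOL-Real_Asymp.Real_Asymp"
begin

text \<open>
  Let \<open>Z 1, Z 2, \<dots>\<close> be the independent Poisson variables of the statement, and for a set \<open>A\<close> of
  indices let \<open>T A\<close> be the sum of the \<open>m * Z m\<close> with \<open>m \<in> A\<close>. By Cauchy's formula for the number of
  permutations with a given cycle type, the vector of all cycle counts is \<open>Z\<close> conditioned on
  \<open>T {1..n} = n\<close>. Summing out the long cycles, the law of the counts up to \<open>b\<close> has the density
  \<open>R (T {1..b})\<close> with respect to the law of \<open>Z 1, \<dots>, Z b\<close>, where \<open>R k\<close> is the quotient of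
  \<open>P (T {b<..n} = n - k)\<close> and \<open>P (T {1..n} = n)\<close> (\<open>pmf_small_cycle_counts\<close>). Hence the total variation
  distance agrees with the expectation of \<open>\<bar>R (T {1..b}) - 1\<bar>\<close> up to a factor of two, and everything is
  reduced to local estimates for two integer-valued variables.

  Put \<open>x = 1 / eta\<close>, a constant multiple of \<open>n powr (1 / (1 + \<gamma>))\<close>. With this choice the mean of
  \<open>T {1..n}\<close> is \<open>n + O(x)\<close>, its standard deviation has the order \<open>lam = x powr (1 + \<gamma> / 2)\<close>, and its
  third cumulant has the order \<open>rho * lam ^ 3\<close> with \<open>rho = x powr (- \<gamma> / 2)\<close>. Fourier inversion over
  one period turns both probabilities in \<open>R\<close> into integrals of explicit exponentials. For \<open>b \<le> x\<close>
  the characteristic function of \<open>T {b<..n}\<close> is at most \<open>K / (1 + (lam * v)\<^sup>2) ^ 3\<close> in absolute value,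
  so these integrals can be compared with Gaussian ones; the locale \<open>saddle\<close> collects what this
  comparison uses.

  For the upper bound, the numerator and the denominator of \<open>R k\<close> are two Fourier integrals that
  differ in one factor: it is \<open>cis (v * (k - mu))\<close> in the first and the characteristic function of
  \<open>T {1..b} - mu\<close> in the second, with \<open>mu\<close> the mean of \<open>T {1..b}\<close>. Expanding these to first order
  leaves a quadratic error of size \<open>((k - mu)\<^sup>2 + s2) / lam ^ 3\<close>, where \<open>s2\<close> is the variance of
  \<open>T {1..b}\<close>, and a linear term, whose Gaussian part vanishes by symmetry. As the probabilities
  themselves have the order \<open>1 / lam\<close>, taking expectations shows that the distance is
  \<open>O(s2 / lam\<^sup>2 + rho\<^sup>2)\<close>, hence \<open>O((b / x) powr (2 + \<gamma>) + x powr (- \<gamma>))\<close>, for all \<open>b \<le> x\<close> (\<open>d_b_upper\<close>).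
  This contains both the rate and the convergence to zero for \<open>b = o(x)\<close>.

  For the converse, the distance increases with \<open>b\<close>, so it suffices to bound it from below for
  \<open>b = \<lfloor>e * x\<rfloor>\<close> with a fixed \<open>e > 0\<close>. Then \<open>s2\<close> and the variance \<open>\<sigma>\<^sup>2\<close> of \<open>T {1..n}\<close> have the same
  order, and conditioning on \<open>T {1..n} = n\<close> changes the variance of \<open>T {1..b}\<close> from \<open>s2\<close> to about
  \<open>s2 * (1 - s2 / \<sigma>\<^sup>2)\<close>. The characteristic functions of the two laws therefore differ by a positive
  constant at the frequency \<open>1 / lam\<close> (\<open>d_b_lower\<close>).

  Two facts about the weights \<open>m powr (\<gamma> - 1) * exp (- m / x)\<close> feed this argument. The decay of the
  characteristic function comes from an elementary estimate for the sum of \<open>1 - cos (m * v)\<close> over a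
  window of \<open>m\<close> between \<open>x\<close> and \<open>4 * x\<close>. The estimate of the mean rests on the expansion of the sum
  of \<open>m powr \<gamma> * exp (- h * m)\<close> as \<open>Gamma (1 + \<gamma>) * h powr (- (1 + \<gamma>)) + O(1)\<close>. It is first proved for
  integer exponents, where the error is up to sign a derivative of the function
  \<open>1 / (1 - exp (- z)) - 1 / z\<close>, which is holomorphic at zero, and then transferred to real exponents
  by a Mellin integral.
\<close>

section \<open>Permutations with a given cycle type\<close>

text \<open>
  This is \<open>cycle_count\<close> over an arbitrary set, so that the counting formula can be proved by
  inserting the points one at a time.
\<close>

definition cycle_type :: "'a set \<Rightarrow> ('a \<Rightarrow> 'a) \<Rightarrow> nat \<Rightarrow> nat" where
  "cycle_type S \<sigma> m = card {c \<in> orbit \<sigma> ` S. card c = m}"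

lemma orbit_eq_if_mem:
  assumes p: "permutation p" and y: "y \<in> orbit p b"
  shows "orbit p y = orbit p b"
proof
  show "orbit p y \<subseteq> orbit p b" using orbit_trans[OF _ y] by auto
  have "b \<in> orbit p y" by (rule orbit_swap[OF permutation_self_in_orbit[OF p] y])
  then show "orbit p b \<subseteq> orbit p y" using orbit_trans by fast
qed

text \<open>
  The map \<open>transpose a b \<circ> p\<close> sends the \<open>p\<close>-preimage of \<open>b\<close> to \<open>a\<close> and \<open>a\<close> to \<open>b\<close>, so it
  splices the new point into the cycle of \<open>b\<close> just before \<open>b\<close> and does not touch the other cycles.
\<close>

lemma orbits_transpose_comp:
  assumes fin: "finite S" and a: "a \<notin> S" and p: "p permutes S" and b: "b \<in> S"
  defines "q \<equiv> Transposition.transpose a b \<circ> p"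
  shows "orbit q ` insert a S = insert (insert a (orbit p b)) (orbit p ` S - {orbit p b})"
proof -
  have pa: "p a = a" using p a by (simp add: permutes_not_in)
  have perm_p: "permutation p" using p fin permutation_permutes by blast
  have "q permutes insert a S"
    unfolding q_def using p b
    by (intro permutes_compose permutes_subset[OF p] permutes_swap_id) auto
  then have perm_q: "permutation q" using fin permutation_permutes by blast
  have qa: "q a = b" by (simp add: q_def pa)
  have q_b: "q y = a" if "p y = b" for y using that by (simp add: q_def)
  have q_same: "q y = p y" if "p y \<noteq> a" "p y \<noteq> b" for y
    using that by (simp add: q_def)
  have pS: "p y \<noteq> a" if "y \<in> S" for y using that p a permutes_in_image by metis
  have sub: "orbit p y \<subseteq> S" if "y \<in> S" for y by (rule permutes_orbit_subset[OF p that])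
  have bself: "b \<in> orbit p b" by (rule permutation_self_in_orbit[OF perm_p])
  have main: "orbit q b = insert a (orbit p b)"
  proof
    show "orbit q b \<subseteq> insert a (orbit p b)"
    proof
      fix y assume "y \<in> orbit q b"
      then show "y \<in> insert a (orbit p b)"
      proof induction
        case base
        then show ?case
          by (cases "p b = b") (use q_b q_same pS b in \<open>auto intro: orbit.intros\<close>)
      next
        case (step y)
        show ?case
        proof (cases "y = a")
          case True then show ?thesis using qa bself by simp
        next
          case False
          then have y: "y \<in> orbit p b" "y \<in> S" using step sub[OF b] by auto
          then show ?thesis
            by (cases "p y = b") (use q_b q_same pS in \<open>auto intro: orbit.intros\<close>)
        qed
      qed
    qed
    have bq: "b \<in> orbit q b" by (rule permutation_self_in_orbit[OF perm_q])
    have pq: "y \<in> orbit q b" if "y \<in> orbit p b" for y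
      using that
    proof induction
      case base then show ?case
        by (cases "p b = b") (use bq q_same[of b] pS[OF b] orbit.base[of q b] in auto)
    next
      case (step y)
      then have "y \<in> S" using sub[OF b] by auto
      then show ?case
        by (cases "p y = b") (use bq q_same[of y] pS[of y] orbit.step[OF step.IH] in auto)
    qed
    from bself obtain y where y: "p y = b" "y \<in> orbit p b"
      by (metis orbit.simps)
    have "a \<in> orbit q b" using orbit.step[OF pq[OF y(2)]] q_b[OF y(1)] by simp
    then show "insert a (orbit p b) \<subseteq> orbit q b" using pq by auto
  qed
  have in_orb: "orbit q y = insert a (orbit p b)" if "y \<in> insert a (orbit p b)" for y
  proof -
    have "y \<in> orbit q b" using main that by auto
    then have "orbit q y = orbit q b"
      by (rule orbit_eq_if_mem[OF perm_q])
    then show ?thesis using main by simp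
  qed
  have out_orb: "orbit q y = orbit p y" if y: "y \<in> S" "y \<notin> orbit p b" for y
  proof -
    have nb: "b \<notin> orbit p y"
      using y perm_p by (meson orbit_swap permutation_self_in_orbit)
    have "orbit p y = orbit q y"
    proof (rule orbit_cong0)
      show "y \<in> orbit p y" by (rule permutation_self_in_orbit[OF perm_p])
      show "p \<in> orbit p y \<rightarrow> orbit p y" by (auto intro: orbit.intros)
      show "p z = q z" if "z \<in> orbit p y" for z
      proof (rule q_same[symmetric])
        have "p z \<in> orbit p y" using that by (rule orbit.step)
        then show "p z \<noteq> b" using nb by auto
        show "p z \<noteq> a" using \<open>p z \<in> orbit p y\<close> sub[OF y(1)] a by auto
      qed
    qed
    then show ?thesis by simp
  qed
  have eq_iff: "orbit p y = orbit p b \<longleftrightarrow> y \<in> orbit p b" for y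
    using orbit_eq_if_mem[OF perm_p, of y b] permutation_self_in_orbit[OF perm_p, of y] by auto
  have aS: "a \<notin> orbit p b" using sub[OF b] a by auto
  have "insert a S = insert a (orbit p b) \<union> (S - orbit p b)"
    using sub[OF b] by auto
  then have "orbit q ` insert a S = orbit q ` insert a (orbit p b) \<union> orbit q ` (S - orbit p b)"
    by (simp only: image_Un)
  also have "orbit q ` insert a (orbit p b) = (\<lambda>_. insert a (orbit p b)) ` insert a (orbit p b)"
    using in_orb by (rule image_cong[OF refl])
  also have "\<dots> = {insert a (orbit p b)}" by (rule image_constant_conv[THEN trans]) simp
  also have "orbit q ` (S - orbit p b) = orbit p ` (S - orbit p b)"
    using out_orb by (intro image_cong) auto
  also have "\<dots> = orbit p ` S - {orbit p b}"
    using eq_iff by blast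
  finally show ?thesis by simp
qed

lemma cycle_type_transpose_comp:
  assumes fin: "finite S" and a: "a \<notin> S" and p: "p permutes S" and b: "b \<in> S"
  shows "cycle_type (insert a S) (Transposition.transpose a b \<circ> p) m + of_bool (m = card (orbit p b))
       = cycle_type S p m + of_bool (m = Suc (card (orbit p b)))"
proof -
  let ?O = "orbit p ` S" and ?B = "orbit p b"
  have finB: "finite ?B" using permutes_orbit_subset[OF p b] fin by (rule finite_subset)
  have aB: "a \<notin> ?B" using permutes_orbit_subset[OF p b] a by auto
  have new: "insert a ?B \<notin> ?O" using permutes_orbit_subset[OF p] a by blast
  have 1: "{c \<in> orbit (Transposition.transpose a b \<circ> p) ` insert a S. card c = m}
        = {c \<in> ?O - {?B}. card c = m} \<union> (if m = Suc (card ?B) then {insert a ?B} else {})"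
    unfolding orbits_transpose_comp[OF fin a p b] using finB aB by auto
  have 2: "{c \<in> ?O. card c = m}
        = {c \<in> ?O - {?B}. card c = m} \<union> (if m = card ?B then {?B} else {})"
    using b by auto
  have "card {c \<in> orbit (Transposition.transpose a b \<circ> p) ` insert a S. card c = m}
        = card {c \<in> ?O - {?B}. card c = m} + of_bool (m = Suc (card ?B))"
    unfolding 1 by (subst card_Un_disjoint) (use fin new in auto)
  moreover have "card {c \<in> ?O. card c = m}
        = card {c \<in> ?O - {?B}. card c = m} + of_bool (m = card ?B)"
    by (subst 2, subst card_Un_disjoint) (use fin in auto)
  ultimately show ?thesis unfolding cycle_type_def by simp
qed

lemma cycle_type_insert_fixed:
  assumes fin: "finite S" and a: "a \<notin> S" and p: "p permutes S"
  shows "cycle_type (insert a S) p m = cycle_type S p m + of_bool (m = 1)"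
proof -
  have "p a = a" using p a by (simp add: permutes_not_in)
  then have oa: "orbit p a = {a}" by (simp add: orbit_eq_singleton_iff)
  have new: "{a} \<notin> orbit p ` S" using permutes_orbit_subset[OF p] a by blast
  have "{c \<in> orbit p ` insert a S. card c = m}
      = {c \<in> orbit p ` S. card c = m} \<union> (if m = 1 then {{a}} else {})"
    using oa by auto
  then have "card {c \<in> orbit p ` insert a S. card c = m}
      = card {c \<in> orbit p ` S. card c = m} + card (if m = 1 then {{a}} else {})"
    using new fin by (simp only:, subst card_Un_disjoint) auto
  then show ?thesis unfolding cycle_type_def by simp
qed

lemma card_in_cycles_of_length:
  assumes fin: "finite S" and p: "p permutes S"
  shows "card {b \<in> S. card (orbit p b) = l} = l * cycle_type S p l"
proof -
  have perm: "permutation p" using p fin permutation_permutes by blast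
  have self: "b \<in> orbit p b" for b by (rule permutation_self_in_orbit[OF perm])
  have eq: "orbit p y = orbit p b" if "y \<in> orbit p b" for y b
    using that by (rule orbit_eq_if_mem[OF perm])
  have "{b \<in> S. card (orbit p b) = l} = \<Union>{c \<in> orbit p ` S. card c = l}"
    using self eq permutes_orbit_subset[OF p] by fastforce
  also have "card \<dots> = (\<Sum>c\<in>{c \<in> orbit p ` S. card c = l}. card c)"
  proof (rule card_Union_disjoint)
    show "pairwise disjnt {c \<in> orbit p ` S. card c = l}"
      unfolding pairwise_def disjnt_def using eq by blast
    show "finite c" if "c \<in> {c \<in> orbit p ` S. card c = l}" for c
      using that permutes_orbit_subset[OF p] fin by (auto intro: finite_subset)
  qed
  also have "\<dots> = l * cycle_type S p l" by (simp add: cycle_type_def)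
  finally show ?thesis .
qed

lemma card_orbit_range:
  assumes fin: "finite S" and p: "p permutes S" and b: "b \<in> S"
  shows "card (orbit p b) \<in> {1..card S}"
proof -
  have sub: "orbit p b \<subseteq> S" by (rule permutes_orbit_subset[OF p b])
  then have "finite (orbit p b)" using fin by (rule finite_subset)
  then have "card (orbit p b) \<noteq> 0" using orbit_nonempty[of p b] by simp
  moreover have "card (orbit p b) \<le> card S" using fin sub by (rule card_mono)
  ultimately show ?thesis by simp
qed

text \<open>
  Cauchy's formula. A permutation of \<open>insert a S\<close> arises in exactly one way from a permutation \<open>p\<close>
  of \<open>S\<close>: either \<open>a\<close> becomes a fixed point, or \<open>a\<close> is spliced into the cycle of some \<open>b\<close>. In the
  second case a cycle of length \<open>l\<close> is replaced by one of length \<open>l + 1\<close>, and there are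
  \<open>l\<close> times as many choices of \<open>b\<close> as \<open>p\<close> has cycles of length \<open>l\<close>. By the induction hypothesis the
  permutations with a given \<open>l\<close> contribute \<open>(l + 1) * c (l + 1) * fact (card S)\<close>; the fixed-point case
  is the term \<open>l = 0\<close>, and the sum over \<open>l\<close> is \<open>fact (card S + 1)\<close>. The range \<open>{1..N}\<close> of the product
  stays the same throughout the induction.
\<close>

theorem card_permutes_cycle_type:
  assumes "finite S" and "card S \<le> N"
    and "\<And>m. m \<notin> {1..N} \<Longrightarrow> c m = 0" and "(\<Sum>m=1..N. m * c m) = card S"
  shows "card {p. p permutes S \<and> cycle_type S p = c} * (\<Prod>m=1..N. m ^ c m * fact (c m)) = fact (card S)"
  using assms
proof (induction S arbitrary: c rule: finite_induct)
  case empty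
  have "c m = 0" for m
    using empty.prems(2)[of m] empty.prems(3) by (cases "m \<in> {1..N}") auto
  then have c0: "c = (\<lambda>_. 0)" by auto
  have "{p. p permutes {} \<and> cycle_type {} p = c} = {id :: 'a \<Rightarrow> 'a}"
    unfolding c0 by (auto simp: cycle_type_def)
  then show ?case by (simp add: c0)
next
  case (insert a S)
  note fin = \<open>finite S\<close> and a = \<open>a \<notin> S\<close>
  let ?n = "card S"
  define z where "z c = (\<Prod>m=1..N. m ^ c m * fact (c m))" for c :: "nat \<Rightarrow> nat"
  \<comment> \<open>The type of \<open>p\<close> from which splicing into a cycle of length \<open>l\<close> leads to \<open>c\<close>. For \<open>l = 0\<close> only a fixed point is removed, hence the condition \<open>m \<ge> 1\<close>.\<close>
  define c' where "c' l = (\<lambda>m. c m + of_bool (m = l \<and> m \<ge> 1) - of_bool (m = Suc l))" for l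
  define P where "P = {p. p permutes S}"
  have finP: "finite P" unfolding P_def by (rule finite_permutations[OF fin])
  have card': "card (insert a S) = Suc ?n" using fin a by simp
  let ?T = "\<lambda>b p. Transposition.transpose a b \<circ> p"
  have inj: "inj_on (\<lambda>(b, p). ?T b p) (insert a S \<times> P)"
  proof (rule inj_onI, clarsimp)
    fix b p b' p' assume *: "b = a \<or> b \<in> S" "b' = a \<or> b' \<in> S" "p \<in> P" "p' \<in> P" "?T b p = ?T b' p'"
    have "p a = a" "p' a = a" using * a by (auto simp: P_def permutes_not_in)
    then have "b = b'" using fun_cong[OF *(5), of a] by simp
    moreover then have "?T b (?T b p) x = ?T b (?T b p') x" for x using *(5) by simp
    then have "p = p'" by (auto simp: fun_eq_iff)
    ultimately show "b = b' \<and> p = p'" by simp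
  qed
  define Q where "Q = {q. q permutes insert a S \<and> cycle_type (insert a S) q = c}"
  define V where "V b = {p \<in> P. cycle_type (insert a S) (?T b p) = c}" for b
  have "Q = (\<lambda>(b, p). ?T b p) ` (SIGMA b:insert a S. V b)"
  proof -
    have "Q = {q \<in> (\<lambda>(b, p). ?T b p) ` {(b, p). b \<in> insert a S \<and> p \<in> {p. p permutes S}}.
                cycle_type (insert a S) q = c}"
      unfolding Q_def permutes_insert[symmetric] by auto
    also have "\<dots> = (\<lambda>(b, p). ?T b p) ` (SIGMA b:insert a S. V b)"
      unfolding V_def P_def by force
    finally show ?thesis .
  qed
  then have "card Q = card (SIGMA b:insert a S. V b)"
    by (simp only:, intro card_image inj_on_subset[OF inj]) (auto simp: V_def)
  also have "\<dots> = (\<Sum>b\<in>insert a S. card (V b))"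
    using fin finP by (subst card_SigmaI) (auto simp: V_def)
  also have "\<dots> = card (V a) + (\<Sum>b\<in>S. card (V b))" using fin a by simp
  also have "(\<Sum>b\<in>S. card (V b)) = (\<Sum>b\<in>S. \<Sum>p\<in>P. of_bool (cycle_type (insert a S) (?T b p) = c))"
    using finP by (intro sum.cong refl) (simp add: V_def Int_def of_bool_def sum.If_cases)
  also have "\<dots> = (\<Sum>p\<in>P. \<Sum>b\<in>S. of_bool (cycle_type (insert a S) (?T b p) = c))"
    by (rule sum.swap)
  also have "\<dots> = (\<Sum>p\<in>P. \<Sum>l=1..?n. l * (c l + 1) * of_bool (c (Suc l) \<ge> 1 \<and> cycle_type S p = c' l))"
  proof (rule sum.cong[OF refl])
    fix p assume "p \<in> P"
    then have p: "p permutes S" by (simp add: P_def)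
    have eq: "cycle_type (insert a S) (?T b p) = c \<longleftrightarrow>
        c (Suc l) \<ge> 1 \<and> cycle_type S p = c' l" if "b \<in> S" "card (orbit p b) = l" for b l
    proof -
      have t: "cycle_type (insert a S) (?T b p) m + of_bool (m = l) = cycle_type S p m + of_bool (m = Suc l)" for m
        using cycle_type_transpose_comp[OF fin a p that(1), of m] that(2) by simp
      have *: "cycle_type (insert a S) (?T b p) m = c m \<longleftrightarrow>
          (m = Suc l \<longrightarrow> c m \<ge> 1) \<and> cycle_type S p m = c' l m"
          if "l \<ge> 1 \<Longrightarrow> m = l \<Longrightarrow> cycle_type S p m \<ge> 1" "l \<ge> 1" for m
        using t[of m] that unfolding c'_def by (auto split: if_splits)
      have l1: "l \<ge> 1" using card_orbit_range[OF fin p that(1)] that(2) by simp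
      have "b \<in> {b \<in> S. card (orbit p b) = l}" using that by simp
      then have "card {b \<in> S. card (orbit p b) = l} \<noteq> 0" using fin by auto
      then have "cycle_type S p l \<ge> 1" unfolding card_in_cycles_of_length[OF fin p] by simp
      then show ?thesis using * l1 by (auto simp: fun_eq_iff)
    qed
    have orb: "card (orbit p b) \<in> {1..?n}" if "b \<in> S" for b
      by (rule card_orbit_range[OF fin p that])
    have "(\<Sum>b\<in>S. of_bool (cycle_type (insert a S) (?T b p) = c))
        = (\<Sum>l=1..?n. \<Sum>b\<in>{b\<in>S. card (orbit p b) = l}. of_bool (cycle_type (insert a S) (?T b p) = c))"
      by (rule sum.group[symmetric]) (use fin orb in auto)
    also have "\<dots> = (\<Sum>l=1..?n. \<Sum>b\<in>{b\<in>S. card (orbit p b) = l}. of_bool (c (Suc l) \<ge> 1 \<and> cycle_type S p = c' l))"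
      using eq by (intro sum.cong refl) auto
    also have "\<dots> = (\<Sum>l=1..?n. l * (c l + 1) * of_bool (c (Suc l) \<ge> 1 \<and> cycle_type S p = c' l))"
      using card_in_cycles_of_length[OF fin p]
      by (intro sum.cong refl) (auto simp: of_bool_def c'_def)
    finally show "(\<Sum>b\<in>S. of_bool (cycle_type (insert a S) (?T b p) = c))
        = (\<Sum>l=1..?n. l * (c l + 1) * of_bool (c (Suc l) \<ge> 1 \<and> cycle_type S p = c' l))" .
  qed
  also have "\<dots> = (\<Sum>l=1..?n. \<Sum>p\<in>P. l * (c l + 1) * of_bool (c (Suc l) \<ge> 1 \<and> cycle_type S p = c' l))"
    by (rule sum.swap)
  also have "\<dots> = (\<Sum>l=1..?n. l * (c l + 1) * of_bool (c (Suc l) \<ge> 1) * card {p \<in> P. cycle_type S p = c' l})"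
    using finP by (intro sum.cong refl) (auto simp: sum_distrib_left[symmetric] Int_def of_bool_def sum.If_cases)
  finally have cardQ: "card Q = card (V a) +
      (\<Sum>l=1..?n. l * (c l + 1) * of_bool (c (Suc l) \<ge> 1) * card {p \<in> P. cycle_type S p = c' l})" .

  have N: "Suc ?n \<le> N" using insert.prems(1) card' by simp
  \<comment> \<open>The left-hand factor \<open>l * (c l + 1)\<close> counts the points in cycles of length \<open>l\<close> for the type \<open>c' l\<close>.\<close>
  have z_shift: "z c * (if l = 0 then 1 else l * (c l + 1)) = z (c' l) * (Suc l * c (Suc l))"
    if l: "Suc l \<le> N" "c (Suc l) \<ge> 1" for l
  proof -
    have "(m ^ c m * fact (c m)) * (if m = l then l * (c l + 1) else 1)
        = (m ^ c' l m * fact (c' l m)) * (if m = Suc l then Suc l * c (Suc l) else 1)"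
      if "m \<in> {1..N}" for m
    proof (cases "m = Suc l")
      case True
      obtain k where "c m = Suc k" using l(2) True by (cases "c m") auto
      then show ?thesis using True by (simp add: c'_def algebra_simps)
    next
      case False then show ?thesis using that by (auto simp: c'_def algebra_simps)
    qed
    then have "z c * (\<Prod>m=1..N. if m = l then l * (c l + 1) else 1)
        = z (c' l) * (\<Prod>m=1..N. if m = Suc l then Suc l * c (Suc l) else 1)"
      unfolding z_def prod.distrib[symmetric] by (rule prod.cong[OF refl])
    then show ?thesis using l by (cases "l = 0") (simp_all add: prod.delta)
  qed
  have IH: "card {p \<in> P. cycle_type S p = c' l} * z (c' l) = fact ?n"
    if l: "Suc l \<le> N" "c (Suc l) \<ge> 1" for l
    unfolding P_def z_def mem_Collect_eq
  proof (rule insert.IH)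
    show "?n \<le> N" using N by simp
    show "c' l m = 0" if "m \<notin> {1..N}" for m
      using that insert.prems(2)[of m] l by (auto simp: c'_def)
    have "m * c' l m + (if m = Suc l then Suc l else 0) = m * c m + (if m = l then l else 0)"
      if "m \<in> {1..N}" for m
    proof (cases "m = Suc l")
      case True
      obtain k where "c m = Suc k" using l(2) True by (cases "c m") auto
      then show ?thesis using True by (simp add: c'_def)
    next
      case False then show ?thesis using that by (auto simp: c'_def)
    qed
    then have "(\<Sum>m=1..N. m * c' l m) + (\<Sum>m=1..N. if m = Suc l then Suc l else 0)
        = (\<Sum>m=1..N. m * c m) + (\<Sum>m=1..N. if m = l then l else 0)"
      unfolding sum.distrib[symmetric] by (rule sum.cong[OF refl])
    then show "(\<Sum>m=1..N. m * c' l m) = ?n"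
      using l insert.prems(3) card' by (auto simp: sum.delta split: if_splits)
  qed
  have combine: "card {p \<in> P. cycle_type S p = c' l} * (z c * (if l = 0 then 1 else l * (c l + 1)))
      = Suc l * c (Suc l) * fact ?n" if l: "Suc l \<le> N" "c (Suc l) \<ge> 1" for l
    unfolding z_shift[OF l] mult.assoc[symmetric] IH[OF l] by (simp only: mult_ac)
  have V_a: "card (V a) * z c = 1 * c 1 * fact ?n"
  proof (cases "c 1 \<ge> 1")
    case True
    have "V a = {p \<in> P. cycle_type S p = c' 0}"
    proof -
      have "cycle_type (insert a S) p m = c m \<longleftrightarrow> cycle_type S p m = c' 0 m" if "p \<in> P" for p m
        using cycle_type_insert_fixed[OF fin a, of p m] that True
        by (cases "m = 1") (auto simp: P_def c'_def)
      then show ?thesis by (auto simp: V_def fun_eq_iff)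
    qed
    then show ?thesis using combine[of 0] True N by simp
  next
    case False
    have "V a = {}" unfolding V_def P_def using cycle_type_insert_fixed[OF fin a, of _ 1] False
      by auto
    then show ?thesis using False by simp
  qed
  have step: "l * (c l + 1) * of_bool (c (Suc l) \<ge> 1) * card {p \<in> P. cycle_type S p = c' l} * z c
      = Suc l * c (Suc l) * fact ?n" if "l \<in> {1..?n}" for l
  proof (cases "c (Suc l) \<ge> 1")
    case True
    then show ?thesis using combine[of l] that N by (simp add: mult_ac)
  next
    case False then show ?thesis by simp
  qed
  have "card Q * z c = 1 * c 1 * fact ?n + (\<Sum>l=1..?n. Suc l * c (Suc l) * fact ?n)"
    unfolding cardQ distrib_right V_a sum_distrib_right using step by simp
  also have "\<dots> = (\<Sum>m=1..Suc ?n. m * c m * fact ?n)"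
    using sum.atLeast_Suc_atMost[of 1 "Suc ?n" "\<lambda>m. m * c m * fact ?n"]
      sum.shift_bounds_cl_Suc_ivl[of "\<lambda>m. m * c m * fact ?n" 1 ?n] by (simp del: sum.cl_ivl_Suc)
  also have "\<dots> = fact ?n * (\<Sum>m=1..Suc ?n. m * c m)"
    unfolding sum_distrib_left by (intro sum.cong refl) simp
  also have "(\<Sum>m=1..Suc ?n. m * c m) = (\<Sum>m=1..N. m * c m)"
  proof (rule sum.mono_neutral_left)
    show "{1..Suc ?n} \<subseteq> {1..N}" using N by auto
    show "\<forall>m\<in>{1..N} - {1..Suc ?n}. m * c m = 0"
    proof
      fix m assume m: "m \<in> {1..N} - {1..Suc ?n}"
      have "m * c m \<le> (\<Sum>m=1..N. m * c m)" using m by (intro member_le_sum) auto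
      then have "m * c m \<le> Suc ?n" using insert.prems(3) card' by simp
      then have "m \<le> Suc ?n" if "c m \<noteq> 0"
        using that by (cases "c m") (auto intro: order.trans[OF le_add1])
      then show "m * c m = 0" using m by (cases "c m = 0") auto
    qed
  qed simp
  also have "fact ?n * (\<Sum>m=1..N. m * c m) = fact (Suc ?n)"
    using insert.prems(3) card' by simp
  finally show ?case unfolding Q_def z_def card' .
qed

section \<open>Cycle counts as conditioned Poisson variables\<close>

definition weighted_sum :: "nat set \<Rightarrow> (nat \<Rightarrow> nat) \<Rightarrow> nat" where
  "weighted_sum A c = (\<Sum>m\<in>A. m * c m)"

definition poisson_vec :: "(nat \<Rightarrow> real) \<Rightarrow> nat set \<Rightarrow> (nat \<Rightarrow> nat) pmf" where
  "poisson_vec w A = Pi_pmf A 0 (\<lambda>m. poisson_pmf (w m))"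

definition poisson_sum :: "(nat \<Rightarrow> real) \<Rightarrow> nat set \<Rightarrow> nat pmf" where
  "poisson_sum w A = map_pmf (weighted_sum A) (poisson_vec w A)"

lemma cycle_type_eq_0:
  assumes fin: "finite S" and p: "p permutes S" and m: "m \<notin> {1..card S}"
  shows "cycle_type S p m = 0"
proof -
  have "{c \<in> orbit p ` S. card c = m} = {}"
  proof (intro equals0I)
    fix c assume "c \<in> {c \<in> orbit p ` S. card c = m}"
    then obtain b where "b \<in> S" "card (orbit p b) = m" by blast
    then show False using card_orbit_range[OF fin p, of b] m by simp
  qed
  then show ?thesis unfolding cycle_type_def by (simp only: card.empty)
qed

lemma sum_cycle_type:
  assumes fin: "finite S" and p: "p permutes S"
  shows "(\<Sum>m=1..card S. m * cycle_type S p m) = card S"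
proof -
  have orb: "card (orbit p b) \<in> {1..card S}" if "b \<in> S" for b
    by (rule card_orbit_range[OF fin p that])
  have "card S = (\<Sum>b\<in>S. 1)" by simp
  also have "\<dots> = (\<Sum>l=1..card S. \<Sum>b\<in>{b\<in>S. card (orbit p b) = l}. 1)"
    by (rule sum.group[symmetric]) (use fin orb in auto)
  also have "\<dots> = (\<Sum>m=1..card S. m * cycle_type S p m)"
    using card_in_cycles_of_length[OF fin p] by simp
  finally show ?thesis by simp
qed

lemma cycle_count_conv_cycle_type: "cycle_count n \<sigma> = cycle_type {1..n} \<sigma>"
  by (simp add: fun_eq_iff cycle_count_def cycle_type_def)

lemma pmf_cycle_counts:
  assumes \<theta>: "\<And>m. m \<ge> 1 \<Longrightarrow> \<theta> m > 0"
  shows "pmf (map_pmf (cycle_count n) (weighted_perm_pmf \<theta> n)) c =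
    (if (\<forall>m. m \<notin> {1..n} \<longrightarrow> c m = 0) \<and> weighted_sum {1..n} c = n
     then (\<Prod>m=1..n. (\<theta> m / m) ^ c m / fact (c m)) / perm_norm \<theta> n else 0)"
proof -
  let ?M = "weighted_perm_pmf \<theta> n"
  have hpos: "perm_norm \<theta> n > 0" by (rule perm_norm_pos[OF \<theta>])
  have pmfM: "pmf ?M \<sigma> = (if \<sigma> permutes {1..n} then perm_weight \<theta> n \<sigma> / (perm_norm \<theta> n * fact n) else 0)" for \<sigma>
    by (rule pmf_weighted_perm[OF less_imp_le[OF \<theta>] hpos])
  define A where "A = {\<sigma>. \<sigma> permutes {1..n} \<and> cycle_type {1..n} \<sigma> = c}"
  have finA: "finite A" unfolding A_def
    by (rule finite_subset[OF _ finite_permutations[of "{1..n}"]]) auto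
  have "pmf (map_pmf (cycle_count n) ?M) c = measure ?M (cycle_count n -` {c})"
    by (rule pmf_map)
  also have "\<dots> = measure ?M A"
    by (rule measure_prob_cong_0)
       (auto simp: A_def pmfM cycle_count_conv_cycle_type split: if_splits)
  also have "\<dots> = (\<Sum>\<sigma>\<in>A. pmf ?M \<sigma>)" by (rule measure_measure_pmf_finite[OF finA])
  also have "\<dots> = (\<Sum>\<sigma>\<in>A. (\<Prod>m=1..n. \<theta> m ^ c m) / (perm_norm \<theta> n * fact n))"
    by (rule sum.cong)
       (auto simp: A_def pmfM perm_weight_def cycle_count_conv_cycle_type)
  also have "\<dots> = card A * (\<Prod>m=1..n. \<theta> m ^ c m) / (perm_norm \<theta> n * fact n)" by simp
  finally have *: "pmf (map_pmf (cycle_count n) ?M) c = card A * (\<Prod>m=1..n. \<theta> m ^ c m) / (perm_norm \<theta> n * fact n)" .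
  show ?thesis
  proof (cases "(\<forall>m. m \<notin> {1..n} \<longrightarrow> c m = 0) \<and> weighted_sum {1..n} c = n")
    case True
    have "card A * (\<Prod>m=1..n. m ^ c m * fact (c m)) = fact n"
      unfolding A_def using card_permutes_cycle_type[of "{1..n}" n c] True by (simp add: weighted_sum_def)
    then have "real (card A * (\<Prod>m=1..n. m ^ c m * fact (c m))) = real (fact n)" by (rule arg_cong)
    then have cA: "card A * (\<Prod>m=1..n. real m ^ c m * fact (c m)) = fact n" by simp
    have pos: "(\<Prod>m=1..n. real m ^ c m * fact (c m)) > 0" by (rule prod_pos) auto
    have "card A * (\<Prod>m=1..n. \<theta> m ^ c m) / fact n
        = (\<Prod>m=1..n. \<theta> m ^ c m) / (\<Prod>m=1..n. real m ^ c m * fact (c m))"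
      unfolding cA[symmetric] using pos cA by (auto simp: field_simps)
    also have "\<dots> = (\<Prod>m=1..n. (\<theta> m / m) ^ c m / fact (c m))"
      unfolding prod_dividef[symmetric] by (simp add: power_divide)
    finally show ?thesis unfolding * using True by (simp add: field_simps)
  next
    case False
    have "A = {}"
      using False cycle_type_eq_0[of "{1..n}"] sum_cycle_type[of "{1..n}"]
      unfolding A_def weighted_sum_def by auto
    then show ?thesis unfolding * using False by auto
  qed
qed

lemma pmf_poisson_vec:
  assumes "finite A" and w: "\<And>m. m \<in> A \<Longrightarrow> w m > 0" and "\<And>m. m \<notin> A \<Longrightarrow> c m = 0"
  shows "pmf (poisson_vec w A) c = (\<Prod>m\<in>A. w m ^ c m / fact (c m)) * exp (- sum w A)"
proof -
  have "pmf (poisson_vec w A) c = (\<Prod>m\<in>A. pmf (poisson_pmf (w m)) (c m))"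
    unfolding poisson_vec_def using assms by (intro pmf_Pi') auto
  also have "\<dots> = (\<Prod>m\<in>A. w m ^ c m / fact (c m) * exp (- w m))"
    using w less_imp_le by (intro prod.cong refl) (subst pmf_poisson, auto)
  also have "\<dots> = (\<Prod>m\<in>A. w m ^ c m / fact (c m)) * exp (- sum w A)"
    unfolding prod.distrib using assms(1) by (simp add: exp_sum sum_negf[symmetric])
  finally show ?thesis .
qed

lemma pmf_poisson_vec_outside:
  assumes "finite A" "m \<notin> A" "c m \<noteq> 0"
  shows "pmf (poisson_vec w A) c = 0"
  unfolding poisson_vec_def using assms by (intro pmf_Pi_outside) auto

text \<open>
  A law whose point masses are proportional to those of another law on a set \<open>T\<close>, and zero outside,
  is the other law conditioned on \<open>T\<close>, up to normalisation.
\<close>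

lemma measure_pmf_eq_mult:
  assumes "\<And>x. pmf p x = K * (indicator T x * pmf q x)" and "K \<ge> 0"
  shows "measure (measure_pmf p) A = K * measure (measure_pmf q) (A \<inter> T)"
proof -
  have "emeasure (measure_pmf p) A = (\<integral>\<^sup>+x. ennreal (pmf p x) * indicator A x \<partial>count_space UNIV)"
    by (simp add: nn_integral_measure_pmf[symmetric])
  also have "\<dots> = (\<integral>\<^sup>+x. ennreal K * (ennreal (pmf q x) * indicator (A \<inter> T) x) \<partial>count_space UNIV)"
    using assms by (intro nn_integral_cong) (auto simp: ennreal_mult[symmetric] split: split_indicator)
  also have "\<dots> = ennreal K * (\<integral>\<^sup>+x. (ennreal (pmf q x) * indicator (A \<inter> T) x) \<partial>count_space UNIV)"
    by (rule nn_integral_cmult) simp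
  also have "\<dots> = ennreal K * emeasure (measure_pmf q) (A \<inter> T)"
    by (simp add: nn_integral_measure_pmf[symmetric])
  finally show ?thesis using assms(2)
    by (simp add: measure_pmf.emeasure_eq_measure ennreal_mult[symmetric])
qed

text \<open>
  By Cauchy's formula the point masses of the cycle counts and of the Poisson vector differ by a
  factor that depends on \<open>c\<close> only through \<open>t ^ weighted_sum {1..n} c\<close>, and this is constant on
  the event \<open>weighted_sum {1..n} c = n\<close>, to which the cycle counts are confined. The value of \<open>t\<close> is
  therefore free and can be tuned later.
\<close>

lemma cycle_counts_conditioned_poisson:
  assumes \<theta>: "\<And>m. m \<ge> 1 \<Longrightarrow> \<theta> m > 0" and t: "t > 0"
  defines "w \<equiv> \<lambda>m. \<theta> m / real m * t ^ m"
  shows "pmf (poisson_sum w {1..n}) n > 0"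
    and "measure (map_pmf (cycle_count n) (weighted_perm_pmf \<theta> n)) A
      = measure (poisson_vec w {1..n}) (A \<inter> weighted_sum {1..n} -` {n}) / pmf (poisson_sum w {1..n}) n"
proof -
  let ?C = "map_pmf (cycle_count n) (weighted_perm_pmf \<theta> n)" and ?Z = "poisson_vec w {1..n}"
  let ?T = "weighted_sum {1..n} -` {n}"
  define K where "K = exp (sum w {1..n}) / t ^ n / perm_norm \<theta> n"
  have hpos: "perm_norm \<theta> n > 0" by (rule perm_norm_pos[OF \<theta>])
  have wpos: "w m > 0" if "m \<in> {1..n}" for m using \<theta>[of m] t that by (auto simp: w_def)
  have K: "K > 0" using hpos t by (simp add: K_def)
  have C: "pmf ?C c =
    (if (\<forall>m. m \<notin> {1..n} \<longrightarrow> c m = 0) \<and> weighted_sum {1..n} c = n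
     then (\<Prod>m=1..n. (\<theta> m / m) ^ c m / fact (c m)) / perm_norm \<theta> n else 0)" for c
    by (rule pmf_cycle_counts[OF \<theta>])
  have eq: "pmf ?C c = K * (indicator ?T c * pmf ?Z c)" for c
  proof (cases "\<forall>m. m \<notin> {1..n} \<longrightarrow> c m = 0")
    case False
    then obtain m where m: "m \<notin> {1..n}" "c m \<noteq> 0" by auto
    have "pmf ?Z c = 0" by (rule pmf_poisson_vec_outside[of "{1..n}" m c w, OF _ m]) simp
    moreover have "pmf ?C c = 0"
    proof -
      have nc: "\<not> ((\<forall>m. m \<notin> {1..n} \<longrightarrow> c m = 0) \<and> weighted_sum {1..n} c = n)" using m by (metis (no_types))
      show ?thesis using C[of c] unfolding if_not_P[OF nc] .
    qed
    ultimately show ?thesis by simp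
  next
    case True
    then have Z: "pmf ?Z c = (\<Prod>m=1..n. w m ^ c m / fact (c m)) * exp (- sum w {1..n})"
      using wpos by (intro pmf_poisson_vec) auto
    have "(\<Prod>m=1..n. w m ^ c m / fact (c m)) = (\<Prod>m=1..n. (\<theta> m / m) ^ c m / fact (c m) * t ^ (m * c m))"
      by (intro prod.cong refl) (simp add: w_def power_mult_distrib power_divide power_mult)
    also have "\<dots> = (\<Prod>m=1..n. (\<theta> m / m) ^ c m / fact (c m)) * t ^ weighted_sum {1..n} c"
      unfolding prod.distrib by (simp add: weighted_sum_def power_sum)
    finally have W: "(\<Prod>m=1..n. w m ^ c m / fact (c m)) = (\<Prod>m=1..n. (\<theta> m / m) ^ c m / fact (c m)) * t ^ weighted_sum {1..n} c" .
    show ?thesis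
    proof (cases "weighted_sum {1..n} c = n")
      case True
      then show ?thesis unfolding C Z W K_def
        using \<open>\<forall>m. m \<notin> {1..n} \<longrightarrow> c m = 0\<close> t by (simp add: exp_minus field_simps)
    next
      case False
      then show ?thesis unfolding C by simp
    qed
  qed
  have meas: "measure ?C A = K * measure ?Z (A \<inter> ?T)" for A
    by (rule measure_pmf_eq_mult[OF eq less_imp_le[OF K]])
  have P: "pmf (poisson_sum w {1..n}) n = measure ?Z ?T"
    by (simp add: poisson_sum_def pmf_map)
  have one: "K * pmf (poisson_sum w {1..n}) n = 1" using meas[of UNIV] P by simp
  then show "pmf (poisson_sum w {1..n}) n > 0" using K
    by (metis mult_eq_0_iff pmf_nonneg order_le_less zero_neq_one)
  then have "K = 1 / pmf (poisson_sum w {1..n}) n" using one by (simp add: field_simps)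
  then show "measure ?C A = measure ?Z (A \<inter> ?T) / pmf (poisson_sum w {1..n}) n"
    unfolding meas by simp
qed

lemma poisson_vec_restrict:
  assumes "finite A" "B \<subseteq> A"
  shows "map_pmf (\<lambda>c m. if m \<in> B then c m else 0) (poisson_vec w A) = poisson_vec w B"
  unfolding poisson_vec_def by (rule Pi_pmf_subset[symmetric, OF assms])

text \<open>
  The coordinates in \<open>A\<close> are independent of those in \<open>B\<close>, of which only the weighted sum enters the
  conditioning. The law of the long cycles is thus needed only through one integer variable.
\<close>

lemma poisson_vec_split:
  assumes "finite A" "finite B" "A \<inter> B = {}"
  shows "map_pmf (\<lambda>c. (\<lambda>m. if m \<in> A then c m else 0, weighted_sum (A \<union> B) c)) (poisson_vec w (A \<union> B))
       = map_pmf (\<lambda>(f, k). (f, weighted_sum A f + k)) (pair_pmf (poisson_vec w A) (poisson_sum w B))"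
proof -
  let ?h = "\<lambda>c. (\<lambda>m. if m \<in> A then c m else 0, weighted_sum (A \<union> B) c)"
  have "map_pmf ?h (poisson_vec w (A \<union> B))
      = map_pmf (\<lambda>(f, g). ?h (\<lambda>x. if x \<in> A then f x else g x)) (pair_pmf (poisson_vec w A) (poisson_vec w B))"
    unfolding poisson_vec_def Pi_pmf_union[OF assms] by (simp add: pmf.map_comp o_def case_prod_unfold)
  also have "\<dots> = map_pmf (\<lambda>(f, g). (f, weighted_sum A f + weighted_sum B g)) (pair_pmf (poisson_vec w A) (poisson_vec w B))"
  proof (rule map_pmf_cong[OF refl], clarsimp)
    fix f g assume f: "f \<in> set_pmf (poisson_vec w A)"
    have f0: "f m = 0" if "m \<notin> A" for m
      using subsetD[OF set_Pi_pmf_subset[OF assms(1)] f[unfolded poisson_vec_def]] that by simp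
    have "weighted_sum (A \<union> B) (\<lambda>x. if x \<in> A then f x else g x) = weighted_sum A f + weighted_sum B g"
      unfolding weighted_sum_def sum.union_disjoint[OF assms]
      using assms(3) by (intro arg_cong2[where f="(+)"] sum.cong refl) auto
    then show "(\<lambda>m. if m \<in> A then if m \<in> A then f m else g m else 0) = f \<and>
        weighted_sum (A \<union> B) (\<lambda>x. if x \<in> A then f x else g x) = weighted_sum A f + weighted_sum B g"
      using f0 by auto
  qed
  also have "\<dots> = map_pmf (\<lambda>(f, k). (f, weighted_sum A f + k)) (pair_pmf (poisson_vec w A) (poisson_sum w B))"
    unfolding poisson_sum_def pair_map_pmf2 by (simp add: pmf.map_comp o_def case_prod_unfold apsnd_def map_prod_def)
  finally show ?thesis .
qed

lemma pmf_poisson_vec_sum: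
  assumes "finite A" "finite B" "A \<inter> B = {}"
  shows "measure (poisson_vec w (A \<union> B)) {c. (\<lambda>m. if m \<in> A then c m else 0) = f \<and> weighted_sum (A \<union> B) c = n}
       = pmf (poisson_vec w A) f * (if weighted_sum A f \<le> n then pmf (poisson_sum w B) (n - weighted_sum A f) else 0)"
proof -
  let ?g = "\<lambda>(f, k). (f, weighted_sum A f + k)"
  have "measure (poisson_vec w (A \<union> B)) {c. (\<lambda>m. if m \<in> A then c m else 0) = f \<and> weighted_sum (A \<union> B) c = n}
      = pmf (map_pmf (\<lambda>c. (\<lambda>m. if m \<in> A then c m else 0, weighted_sum (A \<union> B) c)) (poisson_vec w (A \<union> B))) (f, n)"
    unfolding pmf_map by (rule arg_cong[where f = "measure _"]) auto
  also have "\<dots> = pmf (map_pmf ?g (pair_pmf (poisson_vec w A) (poisson_sum w B))) (f, n)"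
    unfolding poisson_vec_split[OF assms] ..
  also have "\<dots> = pmf (poisson_vec w A) f * (if weighted_sum A f \<le> n then pmf (poisson_sum w B) (n - weighted_sum A f) else 0)"
  proof (cases "weighted_sum A f \<le> n")
    case True
    then have "(f, n) = ?g (f, n - weighted_sum A f)" by simp
    then show ?thesis
      using True pmf_map_inj'[of ?g "pair_pmf (poisson_vec w A) (poisson_sum w B)" "(f, n - weighted_sum A f)"]
      by (auto simp: inj_def pmf_pair)
  next
    case False
    then have "(f, n) \<notin> range ?g" by auto
    then show ?thesis using False by (subst pmf_map_outside) auto
  qed
  finally show ?thesis .
qed

text \<open>
  The density of the first \<open>b\<close> cycle counts with respect to the Poisson vector, as a function of the
  number \<open>k\<close> of points that lie in cycles of length at most \<open>b\<close>.
\<close>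

definition count_density :: "(nat \<Rightarrow> real) \<Rightarrow> nat \<Rightarrow> nat \<Rightarrow> nat \<Rightarrow> real" where
  "count_density w b n k =
     (if k \<le> n then pmf (poisson_sum w {b<..n}) (n - k) else 0) / pmf (poisson_sum w {1..n}) n"

theorem pmf_small_cycle_counts:
  assumes \<theta>: "\<And>m. m \<ge> 1 \<Longrightarrow> \<theta> m > 0" and t: "t > 0" and b: "b \<le> n"
  defines "w \<equiv> \<lambda>m. \<theta> m / real m * t ^ m"
  shows "pmf (map_pmf (\<lambda>\<sigma> m. if m \<in> {1..b} then cycle_count n \<sigma> m else 0) (weighted_perm_pmf \<theta> n)) c
    = pmf (poisson_vec w {1..b}) c * count_density w b n (weighted_sum {1..b} c)"
proof -
  let ?r = "\<lambda>c m. if m \<in> {1..b} then c m else (0::nat)"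
  have split: "{1..b} \<union> {b<..n} = {1..n}" using b by auto
  have "pmf (map_pmf (\<lambda>\<sigma> m. if m \<in> {1..b} then cycle_count n \<sigma> m else 0) (weighted_perm_pmf \<theta> n)) c
      = pmf (map_pmf ?r (map_pmf (cycle_count n) (weighted_perm_pmf \<theta> n))) c"
    by (simp add: pmf.map_comp o_def)
  also have "\<dots> = measure (map_pmf (cycle_count n) (weighted_perm_pmf \<theta> n)) (?r -` {c})"
    by (rule pmf_map)
  also have "\<dots> = measure (poisson_vec w {1..n}) (?r -` {c} \<inter> weighted_sum {1..n} -` {n}) / pmf (poisson_sum w {1..n}) n"
    unfolding w_def by (rule cycle_counts_conditioned_poisson(2)[OF \<theta> t])
  also have "?r -` {c} \<inter> weighted_sum {1..n} -` {n} = {c'. ?r c' = c \<and> weighted_sum {1..n} c' = n}" by auto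
  also have "measure (poisson_vec w {1..n}) \<dots> = pmf (poisson_vec w {1..b}) c * (if weighted_sum {1..b} c \<le> n then pmf (poisson_sum w {b<..n}) (n - weighted_sum {1..b} c) else 0)"
    by (rule pmf_poisson_vec_sum[of "{1..b}" "{b<..n}" w c n, unfolded split]) auto
  finally show ?thesis by (simp add: count_density_def)
qed

section \<open>Total variation distance and densities\<close>

abbreviation "expect p f \<equiv> measure_pmf.expectation p f"

lemma dTV_upper: "\<bar>measure_pmf.prob p A - measure_pmf.prob q A\<bar> \<le> dTV p q"
  unfolding dTV_def
proof (rule cSUP_upper)
  have "\<bar>measure_pmf.prob p A - measure_pmf.prob q A\<bar> \<le> 1" for A
    using measure_pmf.prob_le_1[of p A] measure_pmf.prob_le_1[of q A]
      measure_nonneg[of "measure_pmf p" A] measure_nonneg[of "measure_pmf q" A] by linarith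
  then show "bdd_above (range (\<lambda>A. \<bar>measure_pmf.prob p A - measure_pmf.prob q A\<bar>))"
    by (intro bdd_aboveI2)
qed simp

lemma dTV_least:
  assumes "\<And>A. \<bar>measure_pmf.prob p A - measure_pmf.prob q A\<bar> \<le> B"
  shows "dTV p q \<le> B"
  unfolding dTV_def using assms by (intro cSUP_least) auto

lemma dTV_nonneg: "dTV p q \<ge> 0"
  using dTV_upper[of p "{}" q] by simp

lemma dTV_map_pmf_le: "dTV (map_pmf f p) (map_pmf f q) \<le> dTV p q"
  by (rule dTV_least) (simp add: dTV_upper)

text \<open>
  The two laws differ most on the event \<open>R \<ge> 1\<close>, and there the difference is half of
  \<open>E \<bar>R - 1\<bar>\<close>, because \<open>R - 1\<close> has expectation zero. A loss of a factor of two is harmless here.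
\<close>

lemma
  assumes dens: "\<And>x. pmf p' x = pmf p x * R x" and R: "\<And>x. R x \<ge> 0"
  shows dTV_le_density: "dTV p' p \<le> expect p (\<lambda>x. \<bar>R x - 1\<bar>)"
    and density_le_dTV: "expect p (\<lambda>x. \<bar>R x - 1\<bar>) \<le> 2 * dTV p' p"
proof -
  have *: "integrable (measure_pmf p) (\<lambda>x. R x * indicator A x) \<and>
      expect p (\<lambda>x. R x * indicator A x) = measure_pmf.prob p' A" for A
  proof -
    have "(\<integral>\<^sup>+x. ennreal (R x * indicator A x) \<partial>p) = (\<integral>\<^sup>+x. ennreal (pmf p x) * ennreal (R x * indicator A x) \<partial>count_space UNIV)"
      by (rule nn_integral_measure_pmf)
    also have "\<dots> = (\<integral>\<^sup>+x. ennreal (pmf p' x) * indicator A x \<partial>count_space UNIV)"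
      using R by (intro nn_integral_cong) (auto simp: dens ennreal_mult split: split_indicator)
    also have "\<dots> = ennreal (measure_pmf.prob p' A)"
      by (simp add: nn_integral_measure_pmf[symmetric] measure_pmf.emeasure_eq_measure)
    finally show ?thesis
      using R by (subst nn_integral_eq_integrable[symmetric]) (auto simp: measure_nonneg)
  qed
  have int: "integrable (measure_pmf p) R"
    using *[of UNIV] by simp
  have intA: "integrable (measure_pmf p) (\<lambda>x. (R x - 1) * indicator A x)"
   and diff: "measure_pmf.prob p' A - measure_pmf.prob p A
      = expect p (\<lambda>x. (R x - 1) * indicator A x)" for A
  proof -
    have i: "integrable (measure_pmf p) (\<lambda>x. indicator A x :: real)"
      by (intro measure_pmf.integrable_const_bound[where B=1]) auto
    have "expect p (\<lambda>x. R x * indicator A x - indicator A x)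
        = measure_pmf.prob p' A - measure_pmf.prob p A"
      using *[of A] i by (subst Bochner_Integration.integral_diff) auto
    then show "measure_pmf.prob p' A - measure_pmf.prob p A
      = expect p (\<lambda>x. (R x - 1) * indicator A x)" by (simp add: algebra_simps)
    have "integrable (measure_pmf p) (\<lambda>x. R x * indicator A x - indicator A x)"
      using *[of A] i by (intro Bochner_Integration.integrable_diff) auto
    then show "integrable (measure_pmf p) (\<lambda>x. (R x - 1) * indicator A x)" by (simp add: algebra_simps)
  qed
  have intabs: "integrable (measure_pmf p) (\<lambda>x. \<bar>R x - 1\<bar>)"
    using int by (intro integrable_abs Bochner_Integration.integrable_diff) auto
  show "dTV p' p \<le> expect p (\<lambda>x. \<bar>R x - 1\<bar>)"
  proof (rule dTV_least)
    fix A
    have "\<bar>expect p (\<lambda>x. (R x - 1) * indicator A x)\<bar>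
        \<le> expect p (\<lambda>x. \<bar>(R x - 1) * indicator A x\<bar>)"
      by (rule integral_abs_bound)
    also have "\<dots> \<le> expect p (\<lambda>x. \<bar>R x - 1\<bar>)"
      by (intro integral_mono integrable_abs intA intabs) (auto split: split_indicator)
    finally show "\<bar>measure_pmf.prob p' A - measure_pmf.prob p A\<bar> \<le> expect p (\<lambda>x. \<bar>R x - 1\<bar>)"
      unfolding diff .
  qed
  define A where "A = {x. R x \<ge> 1}"
  have "expect p (\<lambda>x. \<bar>R x - 1\<bar>)
      = expect p (\<lambda>x. (R x - 1) * indicator A x - (R x - 1) * indicator (- A) x)"
    by (intro Bochner_Integration.integral_cong) (auto simp: A_def split: split_indicator)
  also have "\<dots> = (measure_pmf.prob p' A - measure_pmf.prob p A) - (measure_pmf.prob p' (-A) - measure_pmf.prob p (-A))"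
    unfolding diff by (rule Bochner_Integration.integral_diff[OF intA intA])
  also have "\<dots> \<le> dTV p' p + dTV p' p"
    using dTV_upper[of p' A p] dTV_upper[of p' "-A" p] by linarith
  finally show "expect p (\<lambda>x. \<bar>R x - 1\<bar>) \<le> 2 * dTV p' p" by simp
qed

definition rate :: "real \<Rightarrow> nat \<Rightarrow> nat \<Rightarrow> real" where
  "rate \<gamma> n m = real m powr (\<gamma> - 1) * exp (- eta \<gamma> n) ^ m"

lemma poisson_law_conv: "poisson_law \<gamma> n b = poisson_vec (rate \<gamma> n) {1..b}"
  by (simp add: poisson_law_def poisson_vec_def rate_def[abs_def])

lemma poisson_vec_cong: "(\<And>m. m \<in> A \<Longrightarrow> w m = w' m) \<Longrightarrow> finite A \<Longrightarrow> poisson_vec w A = poisson_vec w' A"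
  unfolding poisson_vec_def by (intro Pi_pmf_cong) auto

lemma poisson_sum_cong: "(\<And>m. m \<in> A \<Longrightarrow> w m = w' m) \<Longrightarrow> finite A \<Longrightarrow> poisson_sum w A = poisson_sum w' A"
  unfolding poisson_sum_def using poisson_vec_cong[of A w w'] by simp

lemma pmf_cycle_counts_law:
  assumes b: "b \<le> n"
  shows "pmf (cycle_counts_law \<gamma> n b) c
    = pmf (poisson_law \<gamma> n b) c * count_density (rate \<gamma> n) b n (weighted_sum {1..b} c)"
proof -
  let ?\<theta> = "\<lambda>m. real m powr \<gamma>" and ?t = "exp (- eta \<gamma> n)"
  have eq: "?\<theta> m / real m * ?t ^ m = rate \<gamma> n m" if "m \<ge> 1" for m
    using that by (simp add: rate_def powr_diff)
  have "pmf (cycle_counts_law \<gamma> n b) c = pmf (poisson_vec (\<lambda>m. ?\<theta> m / real m * ?t ^ m) {1..b}) c *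
      count_density (\<lambda>m. ?\<theta> m / real m * ?t ^ m) b n (weighted_sum {1..b} c)"
    unfolding cycle_counts_law_def by (rule pmf_small_cycle_counts[OF _ _ b]) auto
  also have "poisson_vec (\<lambda>m. ?\<theta> m / real m * ?t ^ m) {1..b} = poisson_law \<gamma> n b"
    unfolding poisson_law_conv by (rule poisson_vec_cong, rule eq) auto
  also have "count_density (\<lambda>m. ?\<theta> m / real m * ?t ^ m) b n = count_density (rate \<gamma> n) b n"
  proof -
    have "poisson_sum (\<lambda>m. ?\<theta> m / real m * ?t ^ m) {b<..n} = poisson_sum (rate \<gamma> n) {b<..n}"
      by (rule poisson_sum_cong, rule eq) auto
    moreover have "poisson_sum (\<lambda>m. ?\<theta> m / real m * ?t ^ m) {1..n} = poisson_sum (rate \<gamma> n) {1..n}"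
      by (rule poisson_sum_cong, rule eq) auto
    ultimately show ?thesis unfolding count_density_def by (simp only:)
  qed
  finally show ?thesis .
qed

lemma pmf_total_pos: "pmf (poisson_sum (rate \<gamma> n) {1..n}) n > 0"
proof -
  let ?\<theta> = "\<lambda>m. real m powr \<gamma>" and ?t = "exp (- eta \<gamma> n)"
  have "pmf (poisson_sum (\<lambda>m. ?\<theta> m / real m * ?t ^ m) {1..n}) n > 0"
    by (rule cycle_counts_conditioned_poisson(1)) auto
  also have "poisson_sum (\<lambda>m. ?\<theta> m / real m * ?t ^ m) {1..n} = poisson_sum (rate \<gamma> n) {1..n}"
    by (rule poisson_sum_cong) (auto simp: rate_def powr_diff)
  finally show ?thesis .
qed

lemma
  fixes \<gamma> :: real
  assumes b: "b \<le> n"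
  defines "p \<equiv> poisson_sum (rate \<gamma> n) {1..b}" and "R \<equiv> count_density (rate \<gamma> n) b n"
  shows d_b_le: "d_b \<gamma> b n \<le> expect p (\<lambda>k. \<bar>R k - 1\<bar>)"
    and d_b_ge: "expect p (\<lambda>k. \<bar>R k - 1\<bar>) \<le> 2 * d_b \<gamma> b n"
proof -
  have R: "R k \<ge> 0" for k
    unfolding R_def count_density_def by auto
  note D = pmf_cycle_counts_law[OF b, of \<gamma>, folded R_def]
  have E: "expect p f = expect (poisson_law \<gamma> n b) (\<lambda>c. f (weighted_sum {1..b} c))"
    for f :: "nat \<Rightarrow> real"
    unfolding p_def poisson_sum_def poisson_law_conv by simp
  show "d_b \<gamma> b n \<le> expect p (\<lambda>k. \<bar>R k - 1\<bar>)"
    unfolding E d_b_def by (rule dTV_le_density[OF D R])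
  show "expect p (\<lambda>k. \<bar>R k - 1\<bar>) \<le> 2 * d_b \<gamma> b n"
    unfolding E d_b_def by (rule density_le_dTV[OF D R])
qed

lemma d_b_nonneg: "d_b \<gamma> b n \<ge> 0"
  unfolding d_b_def by (rule dTV_nonneg)

text \<open>
  Both laws for \<open>b\<close> are images of those for \<open>b'\<close> under forgetting coordinates, and total variation
  distance does not increase under maps.
\<close>

lemma d_b_mono:
  assumes "b \<le> b'"
  shows "d_b \<gamma> b n \<le> d_b \<gamma> b' n"
proof -
  let ?r = "\<lambda>c m. if m \<in> {1..b} then c m else (0::nat)"
  have "cycle_counts_law \<gamma> n b = map_pmf ?r (cycle_counts_law \<gamma> n b')"
    unfolding cycle_counts_law_def pmf.map_comp using assms
    by (intro arg_cong2[where f = map_pmf] refl) (auto simp: fun_eq_iff)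
  moreover have "poisson_law \<gamma> n b = map_pmf ?r (poisson_law \<gamma> n b')"
    unfolding poisson_law_conv using assms by (intro poisson_vec_restrict[symmetric]) auto
  ultimately show ?thesis unfolding d_b_def by (simp only: dTV_map_pmf_le)
qed

section \<open>Poisson sums and Fourier inversion\<close>

lemma nat_pmf_expectation:
  fixes f :: "nat \<Rightarrow> 'a :: {banach, second_countable_topology}"
  assumes "summable (\<lambda>k. norm (pmf p k *\<^sub>R f k))" and "(\<lambda>k. pmf p k *\<^sub>R f k) sums s"
  shows "integrable (measure_pmf p) f" and "expect p f = s"
proof -
  have i: "integrable (count_space UNIV) (\<lambda>k. pmf p k *\<^sub>R f k)"
    using assms(1) by (simp add: integrable_count_space_nat_iff)
  then show "integrable (measure_pmf p) f"
    unfolding measure_pmf_eq_density by (intro integrable_density[THEN iffD2]) auto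
  have "expect p f = integral\<^sup>L (count_space UNIV) (\<lambda>k. pmf p k *\<^sub>R f k)"
    unfolding measure_pmf_eq_density by (subst integral_density) auto
  also have "\<dots> = s" using sums_integral_count_space_nat[OF i] assms(2) sums_unique2 by blast
  finally show "expect p f = s" .
qed

lemma expectation_poisson_cis:
  assumes "r > 0"
  shows "expect (poisson_pmf r) (\<lambda>k. cis (\<alpha> * real k)) = exp (complex_of_real r * (cis \<alpha> - 1))"
proof -
  have "(\<lambda>k. (r * cis \<alpha>) ^ k /\<^sub>R fact k) sums exp (complex_of_real r * cis \<alpha>)"
    by (rule exp_converges)
  then have "(\<lambda>k. (r * cis \<alpha>) ^ k /\<^sub>R fact k * of_real (exp (-r))) sums (exp (complex_of_real r * cis \<alpha>) * of_real (exp (-r)))"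
    by (rule sums_mult2)
  also have "(\<lambda>k. (r * cis \<alpha>) ^ k /\<^sub>R fact k * of_real (exp (-r))) = (\<lambda>k. pmf (poisson_pmf r) k *\<^sub>R cis (\<alpha> * real k))"
  proof
    fix k
    have "cis (\<alpha> * real k) = cis \<alpha> ^ k" by (simp add: Complex.DeMoivre mult.commute)
    then show "(r * cis \<alpha>) ^ k /\<^sub>R fact k * of_real (exp (-r)) = pmf (poisson_pmf r) k *\<^sub>R cis (\<alpha> * real k)"
      unfolding pmf_poisson[OF assms] by (simp add: scaleR_conv_of_real power_mult_distrib divide_inverse)
  qed
  also have "exp (complex_of_real r * cis \<alpha>) * of_real (exp (-r)) = exp (complex_of_real r * (cis \<alpha> - 1))"
    by (simp add: exp_of_real[symmetric] exp_add[symmetric] algebra_simps)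
  finally have s: "(\<lambda>k. pmf (poisson_pmf r) k *\<^sub>R cis (\<alpha> * real k)) sums exp (complex_of_real r * (cis \<alpha> - 1))" .
  have "(\<lambda>k. r ^ k /\<^sub>R fact k * exp (-r)) sums (exp r * exp (-r))"
    by (intro sums_mult2 exp_converges)
  then have "summable (\<lambda>k. r ^ k /\<^sub>R fact k * exp (-r))" by (rule sums_summable)
  then have "summable (\<lambda>k. norm (pmf (poisson_pmf r) k *\<^sub>R cis (\<alpha> * real k)))"
    using assms by (simp add: divide_inverse mult_ac)
  from nat_pmf_expectation(2)[OF this s] show ?thesis .
qed

lemma
  assumes r: "r > 0"
  shows integrable_poisson_centered: "integrable (measure_pmf (poisson_pmf r)) (\<lambda>k. real k - r)"
    and expectation_poisson_centered: "expect (poisson_pmf r) (\<lambda>k. real k - r) = 0"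
    and integrable_poisson_centered_sq: "integrable (measure_pmf (poisson_pmf r)) (\<lambda>k. (real k - r)\<^sup>2)"
    and expectation_poisson_centered_sq: "expect (poisson_pmf r) (\<lambda>k. (real k - r)\<^sup>2) = r"
proof -
  let ?p = "pmf (poisson_pmf r)"
  have p: "?p k = r ^ k / fact k * exp (-r)" for k by (rule pmf_poisson[OF r])
  have s0: "?p sums 1"
  proof -
    have "(\<lambda>k. r ^ k /\<^sub>R fact k * exp (-r)) sums (exp r * exp (-r))"
      by (intro sums_mult2 exp_converges)
    then show ?thesis unfolding p[abs_def] by (simp add: exp_minus divide_inverse mult_ac)
  qed
  have p_Suc: "?p (Suc k) * Suc k = r * ?p k" for k
    unfolding p by (auto simp: field_simps simp del: of_nat_Suc)
  have s1: "(\<lambda>k. ?p k * k) sums r"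
  proof -
    have "(\<lambda>k. ?p (Suc k) * Suc k) sums (r * 1)" using sums_mult[OF s0, of r] by (simp only: p_Suc)
    then show ?thesis by (subst (asm) sums_Suc_iff) simp
  qed
  have s2: "(\<lambda>k. ?p k * (real k)\<^sup>2) sums (r * (r + 1))"
  proof -
    have "(\<lambda>k. ?p (Suc k) * (real (Suc k))\<^sup>2) = (\<lambda>k. r * (?p k * k + ?p k))"
      unfolding power2_eq_square mult.assoc[symmetric] p_Suc by (simp add: fun_eq_iff algebra_simps)
    then have "(\<lambda>k. ?p (Suc k) * (real (Suc k))\<^sup>2) sums (r * (r + 1))"
      using sums_mult[OF sums_add[OF s1 s0], of r] by simp
    then show ?thesis by (subst (asm) sums_Suc_iff) simp
  qed
  have i1: "integrable (measure_pmf (poisson_pmf r)) (\<lambda>k. real k)"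
   and e1: "expect (poisson_pmf r) (\<lambda>k. real k) = r"
  proof -
    have "summable (\<lambda>k. norm (?p k *\<^sub>R real k))" using sums_summable[OF s1] r by simp
    from nat_pmf_expectation[OF this] s1
    show "integrable (measure_pmf (poisson_pmf r)) (\<lambda>k. real k)"
      "expect (poisson_pmf r) (\<lambda>k. real k) = r" by auto
  qed
  have i2: "integrable (measure_pmf (poisson_pmf r)) (\<lambda>k. (real k)\<^sup>2)"
   and e2: "expect (poisson_pmf r) (\<lambda>k. (real k)\<^sup>2) = r * (r + 1)"
  proof -
    have "summable (\<lambda>k. norm (?p k *\<^sub>R (real k)\<^sup>2))" using sums_summable[OF s2] r by simp
    from nat_pmf_expectation[OF this] s2
    show "integrable (measure_pmf (poisson_pmf r)) (\<lambda>k. (real k)\<^sup>2)"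
      "expect (poisson_pmf r) (\<lambda>k. (real k)\<^sup>2) = r * (r + 1)" by auto
  qed
  show "integrable (measure_pmf (poisson_pmf r)) (\<lambda>k. real k - r)" using i1 by simp
  show "expect (poisson_pmf r) (\<lambda>k. real k - r) = 0" using i1 e1 by simp
  have eq: "(\<lambda>k. (real k - r)\<^sup>2) = (\<lambda>k. (real k)\<^sup>2 - 2 * r * real k + r\<^sup>2)"
    by (auto simp: power2_eq_square algebra_simps)
  show "integrable (measure_pmf (poisson_pmf r)) (\<lambda>k. (real k - r)\<^sup>2)"
    unfolding eq using i1 i2 by simp
  show "expect (poisson_pmf r) (\<lambda>k. (real k - r)\<^sup>2) = r"
    unfolding eq using i1 i2 e1 e2 by (simp add: power2_eq_square algebra_simps)
qed

context
  fixes w :: "nat \<Rightarrow> real" and A :: "nat set"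
  assumes fin: "finite A" and w: "\<And>m. m \<in> A \<Longrightarrow> w m > 0"
begin

lemma map_poisson_vec_component:
  "m \<in> A \<Longrightarrow> map_pmf (\<lambda>c. c m) (poisson_vec w A) = poisson_pmf (w m)"
  unfolding poisson_vec_def by (simp add: Pi_pmf_component[OF fin])

lemma indep_vars_poisson_vec:
  "prob_space.indep_vars (measure_pmf (poisson_vec w A)) (\<lambda>_. borel) (\<lambda>m c. f m (c m)) A"
  for f :: "nat \<Rightarrow> nat \<Rightarrow> 'b :: topological_space"
  using prob_space.indep_vars_compose2[OF measure_pmf.prob_space_axioms indep_vars_Pi_pmf[OF fin],
      where Y = f and N = "\<lambda>_. borel"]
  unfolding poisson_vec_def by simp

lemma expectation_poisson_vec_component:
  fixes f :: "nat \<Rightarrow> 'b :: {banach, second_countable_topology}"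
  assumes "m \<in> A"
  shows "expect (poisson_vec w A) (\<lambda>c. f (c m)) = expect (poisson_pmf (w m)) f"
    and "integrable (measure_pmf (poisson_vec w A)) (\<lambda>c. f (c m)) \<longleftrightarrow> integrable (measure_pmf (poisson_pmf (w m))) f"
  unfolding map_poisson_vec_component[OF assms, symmetric] by (simp_all add: o_def)

lemma expectation_poisson_sum_cis:
  "expect (poisson_sum w A) (\<lambda>k. cis (v * real k)) = exp (\<Sum>m\<in>A. complex_of_real (w m) * (cis (v * real m) - 1))"
proof -
  have "expect (poisson_sum w A) (\<lambda>k. cis (v * real k))
      = expect (poisson_vec w A) (\<lambda>c. \<Prod>m\<in>A. cis (v * real m * real (c m)))"
    unfolding poisson_sum_def weighted_sum_def
    by (simp add: cis_conv_exp exp_sum[OF fin, symmetric] sum_distrib_left mult_ac)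
  also have "\<dots> = (\<Prod>m\<in>A. expect (poisson_vec w A) (\<lambda>c. cis (v * real m * real (c m))))"
  proof (rule prob_space.indep_vars_lebesgue_integral[OF measure_pmf.prob_space_axioms fin])
    show "prob_space.indep_vars (measure_pmf (poisson_vec w A)) (\<lambda>_. borel) (\<lambda>m c. cis (v * real m * real (c m))) A"
      by (rule indep_vars_poisson_vec)
    show "integrable (measure_pmf (poisson_vec w A)) (\<lambda>c. cis (v * real m * real (c m)))" for m
      by (intro measure_pmf.integrable_const_bound[where B=1]) auto
  qed
  also have "\<dots> = (\<Prod>m\<in>A. exp (complex_of_real (w m) * (cis (v * real m) - 1)))"
    using w by (intro prod.cong refl)
      (simp add: expectation_poisson_vec_component(1)[where f = "\<lambda>x. cis (_ * real x)"] expectation_poisson_cis)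
  also have "\<dots> = exp (\<Sum>m\<in>A. complex_of_real (w m) * (cis (v * real m) - 1))"
    by (rule exp_sum[OF fin, symmetric])
  finally show ?thesis .
qed

text \<open>
  Written in the centred coordinates, the square of the sum is a double sum whose off-diagonal terms
  have expectation zero by independence.
\<close>

lemma poisson_sum_variance:
  defines "\<mu> \<equiv> \<Sum>m\<in>A. real m * w m"
  shows "integrable (measure_pmf (poisson_sum w A)) (\<lambda>k. (real k - \<mu>)\<^sup>2)"
    and "expect (poisson_sum w A) (\<lambda>k. (real k - \<mu>)\<^sup>2) = (\<Sum>m\<in>A. (real m)\<^sup>2 * w m)"
proof -
  let ?M = "measure_pmf (poisson_vec w A)"
  define Y where "Y m x = real m * (real x - w m)" for m x :: nat
  have sq: "(real (weighted_sum A c) - \<mu>)\<^sup>2 = (\<Sum>m\<in>A. \<Sum>l\<in>A. Y m (c m) * Y l (c l))" for c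
    unfolding weighted_sum_def \<mu>_def power2_eq_square Y_def
    by (simp add: sum_subtractf[symmetric] right_diff_distrib[symmetric] sum_product)
  have intY: "integrable ?M (\<lambda>c. Y m (c m))" and expY: "integral\<^sup>L ?M (\<lambda>c. Y m (c m)) = 0" if "m \<in> A" for m
    using expectation_poisson_vec_component[OF that, of "Y m"] integrable_poisson_centered[OF w[OF that]]
      expectation_poisson_centered[OF w[OF that]] unfolding Y_def by auto
  have YY: "integrable ?M (\<lambda>c. Y m (c m) * Y l (c l)) \<and>
      integral\<^sup>L ?M (\<lambda>c. Y m (c m) * Y l (c l)) = (if m = l then (real m)\<^sup>2 * w m else 0)"
    if ml: "m \<in> A" "l \<in> A" for m l
  proof (cases "m = l")
    case True
    have eq: "(\<lambda>x. Y m x * Y m x) = (\<lambda>x. (real m)\<^sup>2 * (real x - w m)\<^sup>2)"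
      by (auto simp: Y_def power2_eq_square)
    have "integrable (measure_pmf (poisson_pmf (w m))) (\<lambda>x. Y m x * Y m x)"
      "expect (poisson_pmf (w m)) (\<lambda>x. Y m x * Y m x) = (real m)\<^sup>2 * w m"
      unfolding eq using integrable_poisson_centered_sq[OF w[OF ml(1)]] expectation_poisson_centered_sq[OF w[OF ml(1)]]
      by auto
    then show ?thesis
      using expectation_poisson_vec_component[OF ml(1), of "\<lambda>x. Y m x * Y m x"] True by simp
  next
    case False
    have ind: "prob_space.indep_vars ?M (\<lambda>_. borel) (\<lambda>m c. Y m (c m)) {m, l}"
      by (rule prob_space.indep_vars_subset[OF measure_pmf.prob_space_axioms indep_vars_poisson_vec]) (use ml in auto)
    have "integrable ?M (\<lambda>c. \<Prod>i\<in>{m, l}. Y i (c i))"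
      by (rule prob_space.indep_vars_integrable[OF measure_pmf.prob_space_axioms _ ind]) (use intY ml in auto)
    moreover have "integral\<^sup>L ?M (\<lambda>c. \<Prod>i\<in>{m, l}. Y i (c i)) = (\<Prod>i\<in>{m, l}. integral\<^sup>L ?M (\<lambda>c. Y i (c i)))"
      by (rule prob_space.indep_vars_lebesgue_integral[OF measure_pmf.prob_space_axioms _ ind]) (use intY ml in auto)
    ultimately show ?thesis using False expY[OF ml(1)] by simp
  qed
  have "integrable ?M (\<lambda>c. (real (weighted_sum A c) - \<mu>)\<^sup>2)"
    unfolding sq using YY by (intro Bochner_Integration.integrable_sum) auto
  then show "integrable (measure_pmf (poisson_sum w A)) (\<lambda>k. (real k - \<mu>)\<^sup>2)"
    unfolding poisson_sum_def by (simp add: o_def)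
  have "expect (poisson_sum w A) (\<lambda>k. (real k - \<mu>)\<^sup>2) = integral\<^sup>L ?M (\<lambda>c. \<Sum>m\<in>A. \<Sum>l\<in>A. Y m (c m) * Y l (c l))"
    unfolding poisson_sum_def by (simp add: sq)
  also have "\<dots> = (\<Sum>m\<in>A. \<Sum>l\<in>A. integral\<^sup>L ?M (\<lambda>c. Y m (c m) * Y l (c l)))"
    using YY by (subst Bochner_Integration.integral_sum, force intro!: Bochner_Integration.integrable_sum)
      (intro sum.cong refl Bochner_Integration.integral_sum, auto)
  also have "\<dots> = (\<Sum>m\<in>A. \<Sum>l\<in>A. if m = l then (real m)\<^sup>2 * w m else 0)"
    using YY by (intro sum.cong refl) blast
  also have "\<dots> = (\<Sum>m\<in>A. (real m)\<^sup>2 * w m)"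
    using fin by (intro sum.cong refl) (simp add: sum.delta)
  finally show "expect (poisson_sum w A) (\<lambda>k. (real k - \<mu>)\<^sup>2) = (\<Sum>m\<in>A. (real m)\<^sup>2 * w m)" .
qed

end

text \<open>
  Characters with integer frequencies are orthogonal on this interval, which makes it the domain of
  all Fourier integrals below.
\<close>

definition period :: "real measure" where
  "period = restrict_space lborel {-pi..pi}"

abbreviation "period_int f \<equiv> integral\<^sup>L period f"

lemma space_period [simp]: "space period = {-pi..pi}"
  by (simp add: period_def space_restrict_space)

lemma measurable_period [measurable (raw)]: "f \<in> borel_measurable borel \<Longrightarrow> f \<in> borel_measurable period"
  unfolding period_def by (intro measurable_restrict_space1) simp

lemma finite_measure_period: "finite_measure period"
  unfolding period_def by (rule finite_measureI) (simp add: space_restrict_space emeasure_restrict_space)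

lemma measure_period: "measure period {-pi..pi} = 2 * pi"
  unfolding period_def by (subst measure_restrict_space) auto

lemma integrable_period:
  fixes f :: "real \<Rightarrow> 'a :: {banach, second_countable_topology}"
  assumes "continuous_on UNIV f"
  shows "integrable period f"
proof -
  have "set_integrable lborel {-pi..pi} f"
    by (rule borel_integrable_atLeastAtMost') (rule continuous_on_subset[OF assms], simp)
  then show ?thesis
    unfolding period_def by (subst integrable_restrict_space) (auto simp: set_integrable_def)
qed

lemma integral_period:
  fixes f :: "real \<Rightarrow> 'a :: {banach, second_countable_topology}"
  shows "period_int f = (LBINT v:{-pi..pi}. f v)"
  unfolding period_def by (subst integral_restrict_space) (auto simp: set_lebesgue_integral_def)

lemma integral_period_cis:
  "period_int (\<lambda>v. cis (v * real_of_int j)) = (if j = 0 then 2 * pi else 0)"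
proof (cases "j = 0")
  case True
  then show ?thesis by (simp add: measure_period scaleR_conv_of_real)
next
  case False
  let ?F = "\<lambda>v. cis (v * real_of_int j) / (\<i> * of_int j)"
  have der: "(?F has_vector_derivative cis (v * real_of_int j)) (at v within X)" for v X
  proof -
    have "((\<lambda>z. exp (\<i> * of_int j * z) / (\<i> * of_int j)) has_field_derivative exp (\<i> * of_int j * of_real v)) (at (of_real v))"
      using False by (auto intro!: derivative_eq_intros)
    from has_vector_derivative_real_field[OF this] show ?thesis
      by (auto simp: cis_conv_exp mult_ac intro: has_vector_derivative_at_within)
  qed
  have cont: "continuous_on {-pi..pi} (\<lambda>v. cis (v * real_of_int j))"
    by (intro continuous_intros)
  have "(LBINT v:{-pi..pi}. cis (v * real_of_int j)) = ?F pi - ?F (-pi)"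
    unfolding set_lebesgue_integral_def
    by (rule has_bochner_integral_integral_eq[OF has_bochner_integral_FTC_Icc[OF _ der cont]]) simp
  also have "\<dots> = 0"
  proof -
    have "sin (pi * real_of_int j) = 0"
    by (subst sin_zero_iff_int2) (auto simp: mult.commute)
  then have "cis (pi * real_of_int j) = cis (- pi * real_of_int j)"
    by (simp add: complex_eq_iff)
  then show "?F pi - ?F (-pi) = 0" by simp
  qed
  finally show ?thesis using False by (simp add: integral_period)
qed

text \<open>
  Fubini for a law on \<open>nat\<close>. The bounded factor \<open>g\<close> makes room for a character of another frequency,
  as it is needed for characteristic functions of the conditioned law.
\<close>

lemma expectation_integral_swap:
  fixes F :: "real \<Rightarrow> complex" and p :: "nat pmf" and g :: "nat \<Rightarrow> complex"
  assumes F: "continuous_on UNIV F" and g: "\<And>k. norm (g k) \<le> 1"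
  shows "expect p (\<lambda>k. period_int (\<lambda>v. F v * (g k * cis (v * real k))))
       = period_int (\<lambda>v. F v * expect p (\<lambda>k. g k * cis (v * real k)))"
proof -
  interpret N: finite_measure period by (rule finite_measure_period)
  interpret P: pair_sigma_finite "measure_pmf p" period
    by (intro pair_sigma_finite.intro measure_pmf.sigma_finite_measure_axioms N.sigma_finite_measure_axioms)
  interpret Q: finite_measure "measure_pmf p \<Otimes>\<^sub>M period"
    by (intro finite_measure_pair_measure measure_pmf.finite_measure finite_measure_period)
  have "compact (F ` {-pi..pi})"
    by (intro compact_continuous_image continuous_on_subset[OF F]) auto
  then have "bounded (F ` {-pi..pi})" by (rule compact_imp_bounded)
  then obtain B where "\<forall>z\<in>F ` {-pi..pi}. norm z \<le> B" unfolding bounded_iff by (elim exE)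
  then have B: "norm (F v) \<le> B" if "v \<in> {-pi..pi}" for v using that by simp
  have Fm: "F \<in> borel_measurable borel" by (rule borel_measurable_continuous_onI[OF F])
  have meas: "(\<lambda>(k, v). F v * (g k * cis (v * real k))) \<in> borel_measurable (measure_pmf p \<Otimes>\<^sub>M period)"
  proof -
    have "(\<lambda>(k, v). F v * (g k * cis (v * real k))) \<in> borel_measurable (count_space UNIV \<Otimes>\<^sub>M period)"
    proof (rule measurable_pair_measure_countable1)
      show "(\<lambda>v. case (k, v) of (k, v) \<Rightarrow> F v * (g k * cis (v * real k))) \<in> borel_measurable period" for k :: nat
        unfolding prod.case
        by (intro measurable_period borel_measurable_times Fm borel_measurable_const borel_measurable_continuous_onI continuous_intros)
    qed simp
    then show ?thesis
      by (subst measurable_cong_sets[OF sets_pair_measure_cong[OF sets_measure_pmf_count_space refl] refl])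
  qed
  have bound: "norm (F v * (g k * cis (v * real k))) \<le> B" if "-pi \<le> v" "v \<le> pi" for k v
    using mult_mono[OF B[of v] g[of k]] that order.trans[OF norm_ge_zero B[of v]] by (simp add: norm_mult)
  have "integrable (measure_pmf p \<Otimes>\<^sub>M period) (\<lambda>(k, v). F v * (g k * cis (v * real k)))"
    by (rule Q.integrable_const_bound[where B=B, OF _ meas])
       (auto intro!: AE_I2 bound simp: space_pair_measure)
  then have "period_int (\<lambda>v. expect p (\<lambda>k. F v * (g k * cis (v * real k))))
      = expect p (\<lambda>k. period_int (\<lambda>v. F v * (g k * cis (v * real k))))"
    by (rule P.Fubini_integral)
  then show ?thesis by simp
qed

section \<open>Expansions of characteristic functions\<close>

text \<open>
  The logarithm of the characteristic function of \<open>poisson_sum w A\<close>.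
\<close>

definition log_char :: "(nat \<Rightarrow> real) \<Rightarrow> nat set \<Rightarrow> real \<Rightarrow> complex" where
  "log_char w A v = (\<Sum>m\<in>A. complex_of_real (w m) * (cis (v * real m) - 1))"

lemma continuous_on_log_char [continuous_intros]:
  "continuous_on S f \<Longrightarrow> continuous_on S (\<lambda>v. log_char w A (f v))"
  unfolding log_char_def by (intro continuous_intros)

lemma log_char_union:
  "finite A \<Longrightarrow> finite B \<Longrightarrow> A \<inter> B = {} \<Longrightarrow> log_char w (A \<union> B) v = log_char w A v + log_char w B v"
  unfolding log_char_def by (rule sum.union_disjoint)

lemma Re_log_char: "Re (log_char w A v) = - (\<Sum>m\<in>A. w m * (1 - cos (v * real m)))"
  unfolding log_char_def by (simp add: sum_negf[symmetric] algebra_simps)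

lemma Re_log_char_nonpos:
  assumes "\<And>m. m \<in> A \<Longrightarrow> w m > 0"
  shows "Re (log_char w A v) \<le> 0"
proof -
  have "(\<Sum>m\<in>A. w m * (1 - cos (v * real m))) \<ge> 0"
    using assms less_imp_le by (intro sum_nonneg mult_nonneg_nonneg) auto
  then show ?thesis unfolding Re_log_char by simp
qed

lemma cis_taylor1: "norm (cis x - 1 - \<i> * x) \<le> x\<^sup>2 / 2"
  using iexp_approx1[of x 1] by (simp add: cis_conv_exp power2_eq_square algebra_simps)

lemma cis_taylor2: "norm (cis x - 1 - \<i> * x + of_real (x\<^sup>2 / 2)) \<le> \<bar>x\<bar> ^ 3 / 6"
proof -
  have "(\<Sum>k\<le>2. (\<i> * complex_of_real x) ^ k / fact k) = 1 + \<i> * x - of_real (x\<^sup>2 / 2)"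
    by (simp add: numeral_2_eq_2 power2_eq_square) (simp add: complex_eq_iff)
  then have "norm (iexp x - (1 + \<i> * x - of_real (x\<^sup>2 / 2))) \<le> \<bar>x\<bar> ^ Suc 2 / fact (Suc 2)"
    using iexp_approx1[of x 2] by simp
  also have "iexp x - (1 + \<i> * x - of_real (x\<^sup>2 / 2)) = cis x - 1 - \<i> * x + of_real (x\<^sup>2 / 2)"
    by (simp add: cis_conv_exp)
  also have "\<bar>x\<bar> ^ Suc 2 / fact (Suc 2) = \<bar>x\<bar> ^ 3 / 6"
    by (simp add: numeral_3_eq_3 numeral_2_eq_2)
  finally show ?thesis .
qed

lemma log_char_approx1:
  assumes w: "\<And>m. m \<in> A \<Longrightarrow> w m > 0"
  shows "norm (log_char w A v - \<i> * (v * (\<Sum>m\<in>A. real m * w m))) \<le> v\<^sup>2 * (\<Sum>m\<in>A. (real m)\<^sup>2 * w m) / 2"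
proof -
  have "log_char w A v - \<i> * (v * (\<Sum>m\<in>A. real m * w m))
      = (\<Sum>m\<in>A. w m * (cis (v * real m) - 1 - \<i> * of_real (v * real m)))"
    unfolding log_char_def of_real_mult of_real_sum sum_distrib_left sum_subtractf[symmetric]
    by (intro sum.cong refl) (simp add: algebra_simps)
  also have "norm \<dots> \<le> (\<Sum>m\<in>A. w m * ((v * real m)\<^sup>2 / 2))"
  proof (rule sum_norm_le)
    fix m assume "m \<in> A"
    then have "w m * norm (cis (v * real m) - 1 - \<i> * of_real (v * real m)) \<le> w m * ((v * real m)\<^sup>2 / 2)"
      using w[of m] by (intro mult_left_mono cis_taylor1) auto
    then show "norm (w m * (cis (v * real m) - 1 - \<i> * of_real (v * real m))) \<le> w m * ((v * real m)\<^sup>2 / 2)"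
      using w[OF \<open>m \<in> A\<close>] by (simp add: norm_mult)
  qed
  also have "\<dots> = v\<^sup>2 * (\<Sum>m\<in>A. (real m)\<^sup>2 * w m) / 2"
    unfolding sum_distrib_left sum_divide_distrib by (intro sum.cong refl) (simp add: power_mult_distrib)
  finally show ?thesis .
qed

lemma log_char_approx2:
  assumes w: "\<And>m. m \<in> A \<Longrightarrow> w m > 0"
  shows "norm (log_char w A v - \<i> * (v * (\<Sum>m\<in>A. real m * w m)) + of_real (v\<^sup>2 * (\<Sum>m\<in>A. (real m)\<^sup>2 * w m) / 2))
     \<le> \<bar>v\<bar> ^ 3 * (\<Sum>m\<in>A. (real m) ^ 3 * w m) / 6"
proof -
  have "log_char w A v - \<i> * (v * (\<Sum>m\<in>A. real m * w m)) + of_real (v\<^sup>2 * (\<Sum>m\<in>A. (real m)\<^sup>2 * w m) / 2)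
      = (\<Sum>m\<in>A. w m * (cis (v * real m) - 1 - \<i> * of_real (v * real m) + of_real ((v * real m)\<^sup>2 / 2)))"
    unfolding log_char_def of_real_mult of_real_sum of_real_divide sum_distrib_left sum_divide_distrib sum_subtractf[symmetric] sum.distrib[symmetric]
    by (intro sum.cong refl) (simp add: algebra_simps power_mult_distrib)
  also have "norm \<dots> \<le> (\<Sum>m\<in>A. w m * (\<bar>v * real m\<bar> ^ 3 / 6))"
  proof (rule sum_norm_le)
    fix m assume "m \<in> A"
    let ?z = "cis (v * real m) - 1 - \<i> * of_real (v * real m) + of_real ((v * real m)\<^sup>2 / 2)"
    have "w m * norm ?z \<le> w m * (\<bar>v * real m\<bar> ^ 3 / 6)"
      using w[OF \<open>m \<in> A\<close>] by (intro mult_left_mono cis_taylor2) auto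
    then show "norm (w m * ?z) \<le> w m * (\<bar>v * real m\<bar> ^ 3 / 6)"
      using w[OF \<open>m \<in> A\<close>] unfolding norm_mult by simp
  qed
  also have "\<dots> = \<bar>v\<bar> ^ 3 * (\<Sum>m\<in>A. (real m) ^ 3 * w m) / 6"
    unfolding sum_distrib_left sum_divide_distrib by (intro sum.cong refl) (simp add: power_mult_distrib abs_mult)
  finally show ?thesis .
qed

text \<open>
  The mean value inequality along the segment from \<open>z'\<close> to \<open>z\<close>, where the real part does not exceed
  the larger of its two values at the ends.
\<close>

lemma norm_exp_diff_le:
  fixes z z' :: complex
  assumes "exp (Re z) \<le> B" "exp (Re z') \<le> B"
  shows "norm (exp z - exp z') \<le> B * norm (z - z')"
proof (rule field_differentiable_bound[where S = "closed_segment z' z" and f' = exp])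
  show "(exp has_field_derivative exp x) (at x within closed_segment z' z)" for x :: complex
    by (auto intro!: derivative_eq_intros)
  show "norm (exp x) \<le> B" if "x \<in> closed_segment z' z" for x
  proof -
    from that obtain u where u: "0 \<le> u" "u \<le> 1" "x = (1 - u) *\<^sub>R z' + u *\<^sub>R z"
      by (auto simp: closed_segment_def)
    have "Re x \<le> (1 - u) * max (Re z) (Re z') + u * max (Re z) (Re z')"
      unfolding u(3) using u(1,2) by (auto intro!: add_mono mult_left_mono)
    also have "\<dots> = max (Re z) (Re z')" by (simp add: algebra_simps)
    finally have "exp (Re x) \<le> exp (max (Re z) (Re z'))" by simp
    also have "\<dots> \<le> B" using assms by (simp add: max_def)
    finally show ?thesis by simp
  qed
qed auto

lemma integral_period_reflect:
  fixes f :: "real \<Rightarrow> 'a :: {banach, second_countable_topology}"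
  shows "period_int (\<lambda>v. f (- v)) = period_int f"
proof -
  have "period_int f = (\<integral>v. indicator {-pi..pi} v *\<^sub>R f v \<partial>lborel)"
    unfolding integral_period set_lebesgue_integral_def ..
  also have "\<dots> = (\<integral>v. indicator {-pi..pi} (- v) *\<^sub>R f (- v) \<partial>lborel)"
    using lborel_integral_real_affine[of "-1" "\<lambda>v. indicator {-pi..pi} v *\<^sub>R f v" 0] by simp
  also have "\<dots> = (\<integral>v. indicator {-pi..pi} v *\<^sub>R f (- v) \<partial>lborel)"
    by (intro Bochner_Integration.integral_cong) (auto split: split_indicator)
  also have "\<dots> = period_int (\<lambda>v. f (- v))"
    unfolding integral_period set_lebesgue_integral_def ..
  finally show ?thesis by simp
qed

lemma integral_period_mono:
  fixes f g :: "real \<Rightarrow> real"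
  assumes "continuous_on UNIV f" "continuous_on UNIV g" "\<And>v. \<bar>v\<bar> \<le> pi \<Longrightarrow> f v \<le> g v"
  shows "period_int f \<le> period_int g"
  using assms by (intro integral_mono integrable_period) auto

lemma integral_period_norm_le:
  fixes f :: "real \<Rightarrow> complex" and g :: "real \<Rightarrow> real"
  assumes "continuous_on UNIV f" "continuous_on UNIV g" "\<And>v. \<bar>v\<bar> \<le> pi \<Longrightarrow> norm (f v) \<le> g v"
  shows "norm (period_int f) \<le> period_int g"
proof -
  have "norm (period_int f) \<le> period_int (\<lambda>v. norm (f v))" by (rule integral_norm_bound)
  also have "\<dots> \<le> period_int g"
    using assms by (intro integral_period_mono continuous_intros) auto
  finally show ?thesis .
qed

lemma integral_period_FTC:
  fixes F f :: "real \<Rightarrow> real"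
  assumes "continuous_on UNIV f" "\<And>v. (F has_vector_derivative f v) (at v)"
  shows "period_int f = F pi - F (- pi)"
  unfolding integral_period set_lebesgue_integral_def
  by (rule has_bochner_integral_integral_eq[OF has_bochner_integral_FTC_Icc])
     (auto intro: has_vector_derivative_at_within[OF assms(2)] continuous_on_subset[OF assms(1)])

lemma integral_period_cauchy_le:
  assumes "lam > 0"
  shows "period_int (\<lambda>v. 1 / (1 + (lam * v)\<^sup>2)) \<le> pi / lam"
proof -
  have nz: "1 + (lam * v)\<^sup>2 \<noteq> 0" for v by (metis add_pos_nonneg less_irrefl zero_le_power2 zero_less_one)
  have "period_int (\<lambda>v. 1 / (1 + (lam * v)\<^sup>2)) = arctan (lam * pi) / lam - arctan (lam * (- pi)) / lam"
  proof (rule integral_period_FTC)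
    show "((\<lambda>v. arctan (lam * v) / lam) has_vector_derivative 1 / (1 + (lam * v)\<^sup>2)) (at v)" for v
      using DERIV_cdivide[OF DERIV_chain2[OF DERIV_arctan DERIV_cmult_Id], of lam lam v] assms
      unfolding has_real_derivative_iff_has_vector_derivative[symmetric]
      by (simp add: divide_inverse mult.assoc)
    show "continuous_on UNIV (\<lambda>v. 1 / (1 + (lam * v)\<^sup>2))"
      using nz by (intro continuous_intros) auto
  qed
  also have "\<dots> = 2 * arctan (lam * pi) / lam" by (simp add: arctan_minus)
  also have "\<dots> \<le> pi / lam" using arctan_ubound[of "lam * pi"] assms by (intro divide_right_mono) auto
  finally show ?thesis .
qed

text \<open>
  Lower bounds for Gaussian integrals over the period come from a neighbourhood of zero alone.
\<close>

lemma integral_period_ge_near_0: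
  fixes f :: "real \<Rightarrow> real"
  assumes cont: "continuous_on UNIV f" and nn: "\<And>v. f v \<ge> 0"
    and r: "0 \<le> r" "r \<le> pi" and low: "\<And>v. \<bar>v\<bar> \<le> r \<Longrightarrow> a * v ^ (2 * j) \<le> f v"
  shows "2 * a * r ^ (2 * j + 1) / (2 * j + 1) \<le> period_int f"
proof -
  have i: "set_integrable lborel {-r..r} (\<lambda>v. a * v ^ (2 * j))"
    by (rule borel_integrable_atLeastAtMost') (intro continuous_intros)
  have i2: "set_integrable lborel {-pi..pi} f"
    by (rule borel_integrable_atLeastAtMost') (rule continuous_on_subset[OF cont], simp)
  have "(LBINT v:{-r..r}. a * v ^ (2 * j)) = a * r ^ (2 * j + 1) / (2 * j + 1) - a * (-r) ^ (2 * j + 1) / (2 * j + 1)"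
    unfolding set_lebesgue_integral_def
  proof (rule has_bochner_integral_integral_eq[OF has_bochner_integral_FTC_Icc])
    show "((\<lambda>v. a * v ^ (2 * j + 1) / (2 * j + 1)) has_vector_derivative a * v ^ (2 * j)) (at v within {-r..r})" for v
      unfolding has_real_derivative_iff_has_vector_derivative[symmetric]
      by (rule derivative_eq_intros refl | simp)+
    show "continuous_on {-r..r} (\<lambda>v. a * v ^ (2 * j))" by (intro continuous_intros)
  qed (use r in auto)
  also have "\<dots> = 2 * a * r ^ (2 * j + 1) / (2 * j + 1)" by simp
  finally have "2 * a * r ^ (2 * j + 1) / (2 * j + 1) = (LBINT v:{-r..r}. a * v ^ (2 * j))" by simp
  also have "\<dots> \<le> (LBINT v:{-pi..pi}. f v)"
    unfolding set_lebesgue_integral_def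
    using i i2 r low nn unfolding set_integrable_def
    by (intro integral_mono) (auto split: split_indicator simp: abs_le_iff)
  finally show ?thesis by (simp add: integral_period)
qed

section \<open>Fourier integrals at the saddle point\<close>

text \<open>
  The numerator of \<open>count_density\<close>: the probability that the Poisson variables with index above \<open>b\<close> account for the remaining \<open>n - k\<close>
  points.
\<close>

definition tail_prob :: "(nat \<Rightarrow> real) \<Rightarrow> nat \<Rightarrow> nat \<Rightarrow> nat \<Rightarrow> real" where
  "tail_prob w b n k = (if k \<le> n then pmf (poisson_sum w {b<..n}) (n - k) else 0)"

lemma pmf_fourier_inversion:
  fixes q :: "nat pmf"
  shows "complex_of_real (2 * pi * measure_pmf.prob q {j. j + k = n})
    = period_int (\<lambda>v. cis (v * (real k - real n)) * expect q (\<lambda>j. cis (v * real j)))"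
proof -
  let ?F = "\<lambda>v. cis (v * (real k - real n))"
  have "period_int (\<lambda>v. ?F v * expect q (\<lambda>j. cis (v * real j)))
      = expect q (\<lambda>j. period_int (\<lambda>v. ?F v * cis (v * real j)))"
    using expectation_integral_swap[of ?F "\<lambda>_. 1" q, symmetric] by (simp add: continuous_intros)
  also have "\<dots> = expect q (\<lambda>j. if j + k = n then complex_of_real (2 * pi) else 0)"
  proof (intro Bochner_Integration.integral_cong refl)
    fix j
    have "(\<lambda>v. ?F v * cis (v * real j)) = (\<lambda>v. cis (v * real_of_int (int j + int k - int n)))"
      by (simp add: cis_mult algebra_simps)
    moreover have "int j + int k - int n = 0 \<longleftrightarrow> j + k = n" by linarith
    ultimately show "period_int (\<lambda>v. ?F v * cis (v * real j)) = (if j + k = n then complex_of_real (2 * pi) else 0)"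
      by (simp only: integral_period_cis) simp
  qed
  also have "\<dots> = expect q (\<lambda>j. of_real (2 * pi * indicator {j. j + k = n} j))"
    by (intro Bochner_Integration.integral_cong) (auto split: split_indicator)
  also have "\<dots> = complex_of_real (2 * pi * measure_pmf.prob q {j. j + k = n})"
    by (subst integral_complex_of_real) simp
  finally show ?thesis ..
qed

text \<open>
  The conditions under which the Fourier integrals are governed by a Gaussian. The scale \<open>lam\<close> is the
  order of the standard deviation of the sum over \<open>{1..n}\<close>, and \<open>rho\<close> is the order of its third
  cumulant in units of \<open>lam\<close>, which measures the distance from normality. The mean may miss \<open>n\<close> by as
  much as \<open>rho\<close> standard deviations. The conditions \<open>decay\<close> and \<open>gauss\<close> let the variables above \<open>b\<close>
  alone provide the decay of all integrands; the power three leaves room for a factor of degree four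
  in \<open>lam * v\<close> and an integrable remainder.
\<close>

locale saddle =
  fixes w :: "nat \<Rightarrow> real" and n b :: nat and lam rho K C :: real
  assumes w: "\<And>m. m \<in> {1..n} \<Longrightarrow> w m > 0" and b: "b \<le> n"
    and lam: "lam > 0" "1 / lam \<le> pi" and rho: "rho \<ge> 0" and K: "K \<ge> 0" and C: "C \<ge> 0"
    and decay: "\<And>v. \<bar>v\<bar> \<le> pi \<Longrightarrow> exp (Re (log_char w {b<..n} v)) \<le> K / (1 + (lam * v)\<^sup>2) ^ 3"
    and gauss: "\<And>v. \<bar>v\<bar> \<le> pi \<Longrightarrow> exp (- ((\<Sum>m\<in>{b<..n}. (real m)\<^sup>2 * w m) * v\<^sup>2 / 2)) \<le> K / (1 + (lam * v)\<^sup>2) ^ 3"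
    and mean: "\<bar>(\<Sum>m=1..n. real m * w m) - n\<bar> \<le> C * rho * lam"
    and third: "(\<Sum>m=1..n. real m ^ 3 * w m) \<le> C * rho * lam ^ 3"
    and variance: "(\<Sum>m=1..n. (real m)\<^sup>2 * w m) \<le> C * lam\<^sup>2"
begin

text \<open>
  Mean and variance of the sum up to \<open>b\<close>, and the variance of the sum above \<open>b\<close>.
\<close>

definition mu where "mu = (\<Sum>m=1..b. real m * w m)"
definition s2 where "s2 = (\<Sum>m=1..b. (real m)\<^sup>2 * w m)"
definition tau2 where "tau2 = (\<Sum>m\<in>{b<..n}. (real m)\<^sup>2 * w m)"

text \<open>
  The logarithms of the characteristic functions of the two partial sums, centred so that their mean
  drift nearly cancels: the sum up to \<open>b\<close> is centred at its mean \<open>mu\<close>, and the sum above \<open>b\<close> at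
  \<open>n - mu\<close>, which is its target value rather than its mean.
\<close>

definition log_tail where "log_tail v = log_char w {b<..n} v - \<i> * of_real (v * (n - mu))"
definition log_head where "log_head v = log_char w {1..b} v - \<i> * of_real (v * mu)"
definition total_prob where "total_prob = pmf (poisson_sum w {1..n}) n"

abbreviation "law \<equiv> poisson_sum w {1..b}"

abbreviation "mean_dev \<equiv> expect law (\<lambda>k. \<bar>tail_prob w b n k - total_prob\<bar>)"

lemma index_split: "{1..b} \<union> {b<..n} = {1..n}" "{1..b} \<inter> {b<..n} = {}"
  using b by auto

lemma w_head: "m \<in> {1..b} \<Longrightarrow> w m > 0" and w_tail: "m \<in> {b<..n} \<Longrightarrow> w m > 0"
  using w b by auto

lemma sum_split: "(\<Sum>m=1..n. f m) = (\<Sum>m=1..b. f m) + (\<Sum>m\<in>{b<..n}. f m :: real)"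
  unfolding index_split(1)[symmetric] by (rule sum.union_disjoint) (use index_split(2) in auto)

lemma moments_nonneg:
  "(\<Sum>m=1..b. real m ^ j * w m) \<ge> 0" "(\<Sum>m\<in>{b<..n}. real m ^ j * w m) \<ge> 0"
  by (intro sum_nonneg mult_nonneg_nonneg less_imp_le[OF w_head] less_imp_le[OF w_tail]; simp)+

lemma s2_nonneg: "s2 \<ge> 0" unfolding s2_def by (rule moments_nonneg)
lemma tau2_nonneg: "tau2 \<ge> 0" unfolding tau2_def by (rule moments_nonneg)

lemma s2_tau2: "s2 + tau2 \<le> C * lam\<^sup>2"
  using variance unfolding s2_def tau2_def sum_split .

lemma Re_head: "Re (log_head v) \<le> 0"
  unfolding log_head_def using Re_log_char_nonpos[of "{1..b}" w v] w_head by simp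

lemma Re_tail: "Re (log_tail v) = Re (log_char w {b<..n} v)"
  unfolding log_tail_def by simp

lemma continuous_log_parts: "continuous_on UNIV log_tail" "continuous_on UNIV log_head"
  unfolding log_tail_def[abs_def] log_head_def[abs_def] by (intro continuous_intros)+

lemma head_approx1: "norm (log_head v) \<le> v\<^sup>2 * s2 / 2"
  unfolding log_head_def s2_def mu_def using log_char_approx1[of "{1..b}" w v] w_head by simp

lemma third_part:
  "(\<Sum>m=1..b. real m ^ 3 * w m) \<le> C * rho * lam ^ 3" "(\<Sum>m\<in>{b<..n}. real m ^ 3 * w m) \<le> C * rho * lam ^ 3"
  using moments_nonneg[of 3] third unfolding sum_split[of "\<lambda>m. real m ^ 3 * w m"] by linarith+

lemma head_approx2: "norm (log_head v + of_real (s2 * v\<^sup>2 / 2)) \<le> C * rho * \<bar>lam * v\<bar> ^ 3"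
proof -
  have "norm (log_head v + of_real (s2 * v\<^sup>2 / 2)) \<le> \<bar>v\<bar> ^ 3 * (\<Sum>m=1..b. real m ^ 3 * w m) / 6"
    using log_char_approx2[of "{1..b}" w v] w_head unfolding log_head_def s2_def mu_def by (simp add: mult.commute)
  also have "\<dots> \<le> \<bar>v\<bar> ^ 3 * (\<Sum>m=1..b. real m ^ 3 * w m)"
    using mult_nonneg_nonneg[of "\<bar>v\<bar> ^ 3", OF _ moments_nonneg(1)[of 3]] by simp
  also have "\<dots> \<le> \<bar>v\<bar> ^ 3 * (C * rho * lam ^ 3)"
    using third_part(1) by (intro mult_left_mono) auto
  also have "\<dots> = C * rho * \<bar>lam * v\<bar> ^ 3" using lam by (simp add: abs_mult power_mult_distrib)
  finally show ?thesis .
qed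

lemma tail_approx: "norm (log_tail v + of_real (tau2 * v\<^sup>2 / 2)) \<le> C * rho * (\<bar>lam * v\<bar> + \<bar>lam * v\<bar> ^ 3)"
proof -
  let ?nu = "\<Sum>m\<in>{b<..n}. real m * w m"
  have mn: "\<bar>mu + ?nu - n\<bar> \<le> C * rho * lam"
    using mean unfolding sum_split[of "\<lambda>m. real m * w m"] mu_def .
  have "log_tail v + of_real (tau2 * v\<^sup>2 / 2)
     = (log_char w {b<..n} v - \<i> * (v * ?nu) + of_real (v\<^sup>2 * (\<Sum>m\<in>{b<..n}. (real m)\<^sup>2 * w m) / 2))
       + \<i> * of_real (v * (mu + ?nu - n))"
    unfolding log_tail_def tau2_def by (simp add: algebra_simps)
  also have "norm \<dots> \<le> \<bar>v\<bar> ^ 3 * (\<Sum>m\<in>{b<..n}. (real m) ^ 3 * w m) / 6 + \<bar>v\<bar> * (C * rho * lam)"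
  proof (rule norm_triangle_mono[OF log_char_approx2])
    show "norm (\<i> * complex_of_real (v * (mu + ?nu - n))) \<le> \<bar>v\<bar> * (C * rho * lam)"
      unfolding norm_mult norm_of_real abs_mult using mn by (simp add: mult_left_mono)
  qed (rule w_tail)
  also have "\<bar>v\<bar> ^ 3 * (\<Sum>m\<in>{b<..n}. (real m) ^ 3 * w m) / 6 \<le> \<bar>v\<bar> ^ 3 * (\<Sum>m\<in>{b<..n}. (real m) ^ 3 * w m)"
    using mult_nonneg_nonneg[of "\<bar>v\<bar> ^ 3", OF _ moments_nonneg(2)[of 3]] by simp
  also have "\<bar>v\<bar> ^ 3 * (\<Sum>m\<in>{b<..n}. (real m) ^ 3 * w m) \<le> \<bar>v\<bar> ^ 3 * (C * rho * lam ^ 3)"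
    using third_part(2) by (intro mult_left_mono) auto
  also have "\<bar>v\<bar> ^ 3 * (C * rho * lam ^ 3) + \<bar>v\<bar> * (C * rho * lam) = C * rho * (\<bar>lam * v\<bar> + \<bar>lam * v\<bar> ^ 3)"
    using lam by (simp add: abs_mult power_mult_distrib algebra_simps)
  finally show ?thesis by simp
qed

text \<open>
  The basic comparison. The number \<open>z\<close> stands for the part of the exponent that stems from the sum up
  to \<open>b\<close> and \<open>h\<close> for the quadratic form replacing it; several choices of the two occur below.
\<close>

lemma exp_approx:
  assumes v: "\<bar>v\<bar> \<le> pi" and z: "Re z \<le> 0" and h: "h \<ge> 0"
    and e: "norm (z + of_real h) \<le> C * rho * e"
  shows "norm (exp (log_tail v + z) - of_real (exp (- (tau2 * v\<^sup>2 / 2) - h)))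
     \<le> C * rho * (\<bar>lam * v\<bar> + \<bar>lam * v\<bar> ^ 3 + e) * (K / (1 + (lam * v)\<^sup>2) ^ 3)"
proof -
  let ?B = "K / (1 + (lam * v)\<^sup>2) ^ 3"
  have B: "?B \<ge> 0" using K by simp
  have "exp (Re (log_tail v + z)) \<le> exp (Re (log_char w {b<..n} v))" using z by (simp add: Re_tail)
  also have "\<dots> \<le> ?B" by (rule decay[OF v])
  finally have 1: "exp (Re (log_tail v + z)) \<le> ?B" .
  have "exp (- (tau2 * v\<^sup>2 / 2) - h) \<le> exp (- (tau2 * v\<^sup>2 / 2))" using h by simp
  also have "\<dots> \<le> ?B" using gauss[OF v] unfolding tau2_def .
  finally have 2: "exp (Re (of_real (- (tau2 * v\<^sup>2 / 2) - h))) \<le> ?B" by simp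
  have n1: "norm (exp (log_tail v + z) - of_real (exp (- (tau2 * v\<^sup>2 / 2) - h)))
      \<le> ?B * norm (log_tail v + z - of_real (- (tau2 * v\<^sup>2 / 2) - h))"
    unfolding exp_of_real[symmetric] by (rule norm_exp_diff_le[OF 1 2])
  have "log_tail v + z - of_real (- (tau2 * v\<^sup>2 / 2) - h) = (log_tail v + of_real (tau2 * v\<^sup>2 / 2)) + (z + of_real h)"
    by (simp add: algebra_simps)
  also have "norm \<dots> \<le> C * rho * (\<bar>lam * v\<bar> + \<bar>lam * v\<bar> ^ 3) + C * rho * e"
    by (rule norm_triangle_mono[OF tail_approx e])
  also have "\<dots> = C * rho * (\<bar>lam * v\<bar> + \<bar>lam * v\<bar> ^ 3 + e)" by (simp add: algebra_simps)
  finally have n2: "norm (log_tail v + z - of_real (- (tau2 * v\<^sup>2 / 2) - h)) \<le> C * rho * (\<bar>lam * v\<bar> + \<bar>lam * v\<bar> ^ 3 + e)" .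
  show ?thesis using order.trans[OF n1 mult_left_mono[OF n2 B]] by (simp only: mult.commute)
qed

lemma exp_bound:
  assumes v: "\<bar>v\<bar> \<le> pi" and z: "Re z \<le> 0"
  shows "norm (exp (log_tail v + z)) \<le> K / (1 + (lam * v)\<^sup>2) ^ 3"
proof -
  have "exp (Re (log_tail v + z)) \<le> exp (Re (log_char w {b<..n} v))" using z by (simp add: Re_tail)
  also have "\<dots> \<le> K / (1 + (lam * v)\<^sup>2) ^ 3" by (rule decay[OF v])
  finally show ?thesis by simp
qed

lemma char_head: "expect law (\<lambda>k. cis (v * real k)) = exp (log_char w {1..b} v)"
  unfolding log_char_def by (rule expectation_poisson_sum_cis) (auto simp: w_head)

lemma tail_prob_eq_prob: "measure_pmf.prob (poisson_sum w {b<..n}) {j. j + k = n} = tail_prob w b n k"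
proof (cases "k \<le> n")
  case True
  then have "{j. j + k = n} = {n - k}" by auto
  then show ?thesis using True by (simp add: tail_prob_def measure_pmf_single)
next
  case False
  then have "{j. j + k = n} = {}" by auto
  then show ?thesis using False by (simp add: tail_prob_def)
qed

lemma tail_prob_fourier:
  "complex_of_real (2 * pi * tail_prob w b n k) = period_int (\<lambda>v. exp (log_tail v) * cis (v * (real k - mu)))"
  unfolding tail_prob_eq_prob[symmetric] pmf_fourier_inversion
proof (intro Bochner_Integration.integral_cong refl)
  fix v
  have e: "expect (poisson_sum w {b<..n}) (\<lambda>j. cis (v * real j)) = exp (log_char w {b<..n} v)"
    unfolding log_char_def by (rule expectation_poisson_sum_cis) (auto simp: w_tail)
  show "cis (v * (real k - real n)) * expect (poisson_sum w {b<..n}) (\<lambda>j. cis (v * real j))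
      = exp (log_tail v) * cis (v * (real k - mu))"
    unfolding e unfolding log_tail_def cis_conv_exp exp_add[symmetric] by (simp add: algebra_simps)
qed

lemma total_fourier:
  "complex_of_real (2 * pi * total_prob) = period_int (\<lambda>v. exp (log_tail v + log_head v))"
proof -
  have "{j. j + 0 = n} = {n}" by auto
  then have "total_prob = measure_pmf.prob (poisson_sum w {1..n}) {j. j + 0 = n}"
    unfolding total_prob_def by (simp add: measure_pmf_single)
  then have "complex_of_real (2 * pi * total_prob) = period_int
      (\<lambda>v. cis (v * (real 0 - real n)) * expect (poisson_sum w {1..n}) (\<lambda>j. cis (v * real j)))"
    by (simp only: pmf_fourier_inversion)
  also have "\<dots> = period_int (\<lambda>v. exp (log_tail v + log_head v))"
  proof (intro Bochner_Integration.integral_cong refl)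
    fix v
    have "expect (poisson_sum w {1..n}) (\<lambda>j. cis (v * real j)) = exp (log_char w {1..n} v)"
      unfolding log_char_def by (rule expectation_poisson_sum_cis) (auto simp: w)
    also have "log_char w {1..n} v = log_char w {1..b} v + log_char w {b<..n} v"
      unfolding index_split(1)[symmetric] by (rule log_char_union) (use index_split(2) in auto)
    finally have e: "expect (poisson_sum w {1..n}) (\<lambda>j. cis (v * real j))
      = exp (log_char w {1..b} v + log_char w {b<..n} v)" .
    show "cis (v * (real 0 - real n)) * expect (poisson_sum w {1..n}) (\<lambda>j. cis (v * real j)) = exp (log_tail v + log_head v)"
      unfolding e unfolding log_tail_def log_head_def cis_conv_exp exp_add[symmetric] by (simp add: algebra_simps)
  qed
  finally show ?thesis .
qed

text \<open>
  With \<open>tail_prob\<close> divided by its mean this is the characteristic function of the conditioned law: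
  twisting by the frequency \<open>u\<close> shifts the argument of the factor for the sum up to \<open>b\<close> and of no other.
\<close>

lemma tail_prob_char:
  "complex_of_real (2 * pi) * expect law (\<lambda>k. cis (u * (real k - mu)) * of_real (tail_prob w b n k))
   = period_int (\<lambda>v. exp (log_tail v + log_head (v + u)))"
proof -
  let ?F = "\<lambda>v. exp (log_tail v) * cis (- (v + u) * mu)"
  have "complex_of_real (2 * pi) * expect law (\<lambda>k. cis (u * (real k - mu)) * of_real (tail_prob w b n k))
      = expect law (\<lambda>k. cis (u * (real k - mu)) * of_real (2 * pi * tail_prob w b n k))"
    by (subst integral_mult_right_zero[symmetric]) (simp add: mult_ac)
  also have "\<dots> = expect law (\<lambda>k. period_int (\<lambda>v. ?F v * (cis (u * real k) * cis (v * real k))))"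
  proof -
    have "cis (u * (real k - mu)) * (exp (log_tail v) * cis (v * (real k - mu))) = ?F v * (cis (u * real k) * cis (v * real k))" for k v
    proof -
      have "cis (u * (real k - mu)) * cis (v * (real k - mu)) = cis (- (v + u) * mu) * (cis (u * real k) * cis (v * real k))"
        by (simp add: cis_mult algebra_simps)
      then show ?thesis by (metis (no_types, lifting) mult.assoc mult.left_commute)
    qed
    then show ?thesis unfolding tail_prob_fourier integral_mult_right_zero[symmetric] by (simp only:)
  qed
  also have "\<dots> = period_int (\<lambda>v. ?F v * expect law (\<lambda>k. cis (u * real k) * cis (v * real k)))"
    by (rule expectation_integral_swap) (auto intro!: continuous_intros continuous_log_parts)
  also have "\<dots> = period_int (\<lambda>v. exp (log_tail v + log_head (v + u)))"
  proof (intro Bochner_Integration.integral_cong refl)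
    fix v
    have "expect law (\<lambda>k. cis (u * real k) * cis (v * real k)) = exp (log_char w {1..b} (v + u))"
      unfolding char_head[symmetric] by (simp add: cis_mult algebra_simps)
    moreover have "exp (log_tail v + log_head (v + u)) = exp (log_tail v) * (exp (log_char w {1..b} (v + u)) * cis (- (v + u) * mu))"
      unfolding log_head_def cis_conv_exp exp_add[symmetric] by (simp add: algebra_simps)
    ultimately show "?F v * expect law (\<lambda>k. cis (u * real k) * cis (v * real k)) = exp (log_tail v + log_head (v + u))"
      by (simp only: mult_ac)
  qed
  finally show ?thesis .
qed

end

section \<open>Comparison with Gaussian integrals\<close>

text \<open>
  With \<open>y = \<bar>lam * v\<bar>\<close>, these bound the polynomial factors that accompany the decay
  \<open>K / (1 + y\<^sup>2) ^ 3\<close>, so that a constant multiple of \<open>1 / (1 + y\<^sup>2)\<close> remains.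
\<close>

lemma power_le_quadratic:
  fixes y :: real
  assumes "y \<ge> 0"
  shows "y ^ 2 \<le> (1 + y\<^sup>2)\<^sup>2" "y + y ^ 3 \<le> (1 + y\<^sup>2)\<^sup>2" "y * (y + y ^ 3) \<le> (1 + y\<^sup>2)\<^sup>2"
    "y ^ 3 + 1 \<le> 2 * (1 + y\<^sup>2)\<^sup>2" "y ^ 3 \<le> (1 + y\<^sup>2)\<^sup>2" "(y + 1) ^ 3 \<le> 4 * (1 + y\<^sup>2)\<^sup>2"
proof -
  let ?q = "1 + y\<^sup>2"
  have q: "(1 + y\<^sup>2)\<^sup>2 = 1 + 2 * y\<^sup>2 + y ^ 4" by (simp add: power2_eq_square power4_eq_xxxx algebra_simps)
  have q1: "?q \<ge> 1" by simp
  have yq: "2 * y \<le> ?q" using zero_le_power2[of "y - 1"] by (simp add: power2_eq_square algebra_simps)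
  have y4: "y ^ 4 \<ge> 0" by simp
  show "y ^ 2 \<le> ?q\<^sup>2" unfolding q using y4 zero_le_power2[of y] by linarith
  have "y * ?q \<le> ?q * ?q" using yq assms q1 by (intro mult_right_mono) auto
  then show 1: "y + y ^ 3 \<le> ?q\<^sup>2" by (simp add: power2_eq_square power3_eq_cube algebra_simps)
  show "y * (y + y ^ 3) \<le> ?q\<^sup>2" unfolding q using zero_le_power2[of y]
    by (simp add: power2_eq_square power3_eq_cube power4_eq_xxxx algebra_simps)
  show 2: "y ^ 3 \<le> ?q\<^sup>2" using 1 assms by linarith
  have "1 \<le> ?q\<^sup>2" using q1 by (simp add: one_le_power)
  then show "y ^ 3 + 1 \<le> 2 * ?q\<^sup>2" using 2 by linarith
  have "(y + 1)\<^sup>2 \<le> 2 * ?q" using yq by (simp add: power2_eq_square algebra_simps)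
  moreover have "y + 1 \<le> 2 * ?q"
  proof -
    have "2 * (y + 1) \<le> 2 * (2 * ?q)" using yq by (simp add: algebra_simps) (smt (verit) zero_le_power2)
    then show ?thesis by simp
  qed
  ultimately have "(y + 1)\<^sup>2 * (y + 1) \<le> (2 * ?q) * (2 * ?q)" using assms by (intro mult_mono) auto
  then show "(y + 1) ^ 3 \<le> 4 * ?q\<^sup>2" by (simp add: power2_eq_square power3_eq_cube algebra_simps)
qed

lemma cube_quotient_le:
  fixes y K p a :: real
  assumes "p \<le> a * (1 + y\<^sup>2)\<^sup>2" "K \<ge> 0"
  shows "p * (K / (1 + y\<^sup>2) ^ 3) \<le> a * K * (1 / (1 + y\<^sup>2))"
proof -
  have pos: "1 + y\<^sup>2 > 0" by (simp add: add_pos_nonneg)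
  have "p * (K / (1 + y\<^sup>2) ^ 3) \<le> (a * (1 + y\<^sup>2)\<^sup>2) * (K / (1 + y\<^sup>2) ^ 3)"
    using assms pos by (intro mult_right_mono divide_nonneg_nonneg) auto
  also have "\<dots> = a * K * (1 / (1 + y\<^sup>2))"
    using pos by (simp add: power2_eq_square power3_eq_cube divide_simps)
  finally show ?thesis .
qed

context saddle
begin

text \<open>
  The integral of \<open>1 / (1 + (lam * v)\<^sup>2)\<close> over the whole line is \<open>pi / lam\<close>.
\<close>

lemma integral_cauchy_bound:
  fixes f :: "real \<Rightarrow> complex"
  assumes f: "continuous_on UNIV f" and a: "a \<ge> 0"
    and le: "\<And>v. \<bar>v\<bar> \<le> pi \<Longrightarrow> norm (f v) \<le> a * (1 / (1 + (lam * v)\<^sup>2))"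
  shows "norm (period_int f) \<le> a * (pi / lam)"
proof -
  have nz: "1 + (lam * v)\<^sup>2 \<noteq> 0" for v by (metis add_pos_nonneg less_irrefl zero_le_power2 zero_less_one)
  have c: "continuous_on UNIV (\<lambda>v. 1 / (1 + (lam * v)\<^sup>2))"
    using nz by (intro continuous_intros) auto
  have "norm (period_int f) \<le> period_int (\<lambda>v. a * (1 / (1 + (lam * v)\<^sup>2)))"
    by (rule integral_period_norm_le[OF f continuous_on_mult_left[OF c] le])
  also have "\<dots> = a * period_int (\<lambda>v. 1 / (1 + (lam * v)\<^sup>2))" by (rule integral_mult_right_zero)
  also have "\<dots> \<le> a * (pi / lam)" using a integral_period_cauchy_le[OF lam(1)] by (rule mult_left_mono[rotated])
  finally show ?thesis .
qed

lemma C_rho_K_nonneg: "C * rho * K \<ge> 0" using C rho K by simp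

lemma exp_approx_integral:
  assumes z: "continuous_on UNIV z" and h: "continuous_on UNIV h"
    and zh: "\<And>v. \<bar>v\<bar> \<le> pi \<Longrightarrow> Re (z v) \<le> 0" "\<And>v. \<bar>v\<bar> \<le> pi \<Longrightarrow> h v \<ge> 0"
    and e: "\<And>v. \<bar>v\<bar> \<le> pi \<Longrightarrow> norm (z v + of_real (h v)) \<le> C * rho * e v"
    and ea: "\<And>v. \<bar>lam * v\<bar> + \<bar>lam * v\<bar> ^ 3 + e v \<le> a * (1 + (lam * v)\<^sup>2)\<^sup>2" and a: "a \<ge> 0"
  shows "norm (period_int (\<lambda>v. exp (log_tail v + z v)) - of_real (period_int (\<lambda>v. exp (- (tau2 * v\<^sup>2 / 2) - h v))))
    \<le> a * (C * rho * K) * (pi / lam)"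
proof -
  have c1: "continuous_on UNIV (\<lambda>v. exp (log_tail v + z v))" by (intro continuous_intros continuous_log_parts z)
  have c2: "continuous_on UNIV (\<lambda>v. exp (- (tau2 * v\<^sup>2 / 2) - h v))" by (intro continuous_intros h) auto
  have c3: "continuous_on UNIV (\<lambda>v. complex_of_real (exp (- (tau2 * v\<^sup>2 / 2) - h v)))"
    by (intro continuous_on_of_real c2)
  have "period_int (\<lambda>v. exp (log_tail v + z v)) - of_real (period_int (\<lambda>v. exp (- (tau2 * v\<^sup>2 / 2) - h v)))
     = period_int (\<lambda>v. exp (log_tail v + z v) - of_real (exp (- (tau2 * v\<^sup>2 / 2) - h v)))"
    unfolding integral_complex_of_real[symmetric]
    by (rule Bochner_Integration.integral_diff[symmetric]) (intro integrable_period c1 c3)+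
  also have "norm \<dots> \<le> a * (C * rho * K) * (pi / lam)"
  proof (rule integral_cauchy_bound)
    show "a * (C * rho * K) \<ge> 0" using a C_rho_K_nonneg by simp
    fix v :: real assume v: "\<bar>v\<bar> \<le> pi"
    have "norm (exp (log_tail v + z v) - of_real (exp (- (tau2 * v\<^sup>2 / 2) - h v)))
      \<le> C * rho * (\<bar>lam * v\<bar> + \<bar>lam * v\<bar> ^ 3 + e v) * (K / (1 + (lam * v)\<^sup>2) ^ 3)"
      by (rule exp_approx[OF v zh(1)[OF v] zh(2)[OF v] e[OF v]])
    also have "\<dots> = C * rho * ((\<bar>lam * v\<bar> + \<bar>lam * v\<bar> ^ 3 + e v) * (K / (1 + (lam * v)\<^sup>2) ^ 3))"
      by simp
    also have "\<dots> \<le> C * rho * (a * K * (1 / (1 + (lam * v)\<^sup>2)))"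
      using C rho by (intro mult_left_mono cube_quotient_le ea K) auto
    also have "\<dots> = a * (C * rho * K) * (1 / (1 + (lam * v)\<^sup>2))" by simp
    finally show "norm (exp (log_tail v + z v) - of_real (exp (- (tau2 * v\<^sup>2 / 2) - h v))) \<le> a * (C * rho * K) * (1 / (1 + (lam * v)\<^sup>2))" .
  qed (intro continuous_on_diff c1 c3)
  finally show ?thesis .
qed

lemma abs_lam: "\<bar>lam * v\<bar>\<^sup>2 = (lam * v)\<^sup>2" by simp

lemma gauss_near_0:
  assumes "\<bar>v\<bar> \<le> 1 / lam"
  shows "exp (- (C / 2)) \<le> exp (- ((s2 + tau2) * v\<^sup>2 / 2))"
proof -
  have "\<bar>lam * v\<bar> \<le> 1" using assms lam by (simp add: abs_mult field_simps)
  then have "(lam * v)\<^sup>2 \<le> 1" by (simp add: abs_square_le_1)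
  then have "(s2 + tau2) * v\<^sup>2 \<le> C * lam\<^sup>2 * v\<^sup>2" using s2_tau2 by (intro mult_right_mono) auto
  also have "\<dots> = C * (lam * v)\<^sup>2" by (simp add: power_mult_distrib)
  also have "\<dots> \<le> C * 1" using C \<open>(lam * v)\<^sup>2 \<le> 1\<close> by (intro mult_left_mono)
  finally show ?thesis by simp
qed

lemma total_approx:
  "\<bar>2 * pi * total_prob - period_int (\<lambda>v. exp (- ((s2 + tau2) * v\<^sup>2 / 2)))\<bar> \<le> 2 * (C * rho * K) * (pi / lam)"
proof -
  have "norm (period_int (\<lambda>v. exp (log_tail v + log_head v)) - of_real (period_int (\<lambda>v. exp (- (tau2 * v\<^sup>2 / 2) - s2 * v\<^sup>2 / 2))))
    \<le> 2 * (C * rho * K) * (pi / lam)"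
  proof (rule exp_approx_integral[where e = "\<lambda>v. \<bar>lam * v\<bar> ^ 3"])
    show "\<bar>lam * v\<bar> + \<bar>lam * v\<bar> ^ 3 + \<bar>lam * v\<bar> ^ 3 \<le> 2 * (1 + (lam * v)\<^sup>2)\<^sup>2" for v
      using power_le_quadratic(2,5)[of "\<bar>lam * v\<bar>"] unfolding abs_lam by simp
    show "norm (log_head v + complex_of_real (s2 * v\<^sup>2 / 2)) \<le> C * rho * \<bar>lam * v\<bar> ^ 3" for v
      by (rule head_approx2)
  qed (auto intro!: continuous_intros continuous_log_parts Re_head simp: s2_nonneg)
  also have "(\<lambda>v. exp (- (tau2 * v\<^sup>2 / 2) - s2 * v\<^sup>2 / 2)) = (\<lambda>v. exp (- ((s2 + tau2) * v\<^sup>2 / 2)))"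
    by (auto simp: algebra_simps add_divide_distrib)
  finally show ?thesis unfolding total_fourier[symmetric] of_real_diff[symmetric] norm_of_real .
qed

lemma total_ge: "total_prob \<ge> (exp (- (C / 2)) / pi - C * rho * K) / lam"
proof -
  have cg: "continuous_on UNIV (\<lambda>v. exp (- ((s2 + tau2) * v\<^sup>2 / 2)))" by (intro continuous_intros) auto
  have "2 * exp (- (C / 2)) * (1 / lam) \<le> period_int (\<lambda>v. exp (- ((s2 + tau2) * v\<^sup>2 / 2)))"
    using integral_period_ge_near_0[OF cg, of "1 / lam" "exp (- (C / 2))" 0] lam gauss_near_0 by simp
  then have "2 * exp (- (C / 2)) / lam - 2 * (C * rho * K) * (pi / lam) \<le> 2 * pi * total_prob"
    using total_approx by (simp add: abs_le_iff)
  then show ?thesis using lam by (simp add: field_simps)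
qed

lemma total_le: "total_prob \<le> K / (2 * lam)"
proof -
  have "norm (complex_of_real (2 * pi * total_prob)) \<le> K * (pi / lam)"
    unfolding total_fourier
  proof (rule integral_cauchy_bound)
    fix v :: real assume v: "\<bar>v\<bar> \<le> pi"
    have "norm (exp (log_tail v + log_head v)) \<le> 1 * (K / (1 + (lam * v)\<^sup>2) ^ 3)" using exp_bound[OF v Re_head] by simp
    also have "\<dots> \<le> 1 * K * (1 / (1 + (lam * v)\<^sup>2))"
      by (rule cube_quotient_le) (use K in \<open>auto simp: one_le_power\<close>)
    finally show "norm (exp (log_tail v + log_head v)) \<le> K * (1 / (1 + (lam * v)\<^sup>2))" by simp
  qed (auto intro!: continuous_intros continuous_log_parts K)
  moreover have "total_prob \<ge> 0" by (simp add: total_prob_def)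
  ultimately show ?thesis using lam by (simp add: norm_mult field_simps)
qed

text \<open>
  The Gaussian approximation of the integrand is odd and integrates to zero, so only the error of the
  approximation contributes. This gains a factor \<open>rho\<close> over the trivial bound.
\<close>

lemma tail_first_moment: "norm (period_int (\<lambda>v. of_real v * exp (log_tail v))) \<le> C * rho * K / lam * (pi / lam)"
proof -
  let ?G = "\<lambda>v. v * exp (- (tau2 * v\<^sup>2 / 2))"
  have cG: "continuous_on UNIV ?G" by (intro continuous_intros) auto
  have "period_int ?G = period_int (\<lambda>v. ?G (- v))" by (rule integral_period_reflect[symmetric])
  also have "\<dots> = - period_int ?G" by simp
  finally have "period_int ?G = 0" by simp
  then have "period_int (\<lambda>v. of_real v * exp (log_tail v))
      = period_int (\<lambda>v. of_real v * exp (log_tail v)) - period_int (\<lambda>v. complex_of_real (?G v))"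
    unfolding integral_complex_of_real by simp
  also have "\<dots> = period_int (\<lambda>v. of_real v * exp (log_tail v) - complex_of_real (?G v))"
    by (rule Bochner_Integration.integral_diff[symmetric]; intro integrable_period continuous_intros continuous_log_parts cG)
  also have "norm \<dots> \<le> C * rho * K / lam * (pi / lam)"
  proof (rule integral_cauchy_bound)
    fix v :: real assume v: "\<bar>v\<bar> \<le> pi"
    let ?y = "\<bar>lam * v\<bar>"
    have "of_real v * exp (log_tail v) - complex_of_real (?G v) = of_real v * (exp (log_tail v + 0) - of_real (exp (- (tau2 * v\<^sup>2 / 2) - 0)))"
      by (simp add: algebra_simps)
    also have "norm \<dots> \<le> \<bar>v\<bar> * (C * rho * (?y + ?y ^ 3 + 0) * (K / (1 + (lam * v)\<^sup>2) ^ 3))"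
      unfolding norm_mult norm_of_real by (rule mult_left_mono[OF exp_approx[OF v]]) auto
    also have "\<dots> = C * rho / lam * (?y * (?y + ?y ^ 3) * (K / (1 + (lam * v)\<^sup>2) ^ 3))"
      using lam by (simp add: abs_mult)
    also have "\<dots> \<le> C * rho / lam * (1 * K * (1 / (1 + (lam * v)\<^sup>2)))"
      using C rho lam power_le_quadratic(3)[of ?y] unfolding abs_lam
      by (intro mult_left_mono cube_quotient_le K) auto
    also have "\<dots> = C * rho * K / lam * (1 / (1 + (lam * v)\<^sup>2))" by simp
    finally show "norm (of_real v * exp (log_tail v) - complex_of_real (?G v)) \<le> C * rho * K / lam * (1 / (1 + (lam * v)\<^sup>2))" .
  qed (use C_rho_K_nonneg lam in \<open>auto intro!: continuous_intros continuous_log_parts\<close>)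
  finally show ?thesis .
qed

lemma tail_second_moment:
  assumes f: "continuous_on UNIV f" and fle: "\<And>v. norm (f v) \<le> v\<^sup>2 * a" and a: "a \<ge> 0"
  shows "norm (period_int (\<lambda>v. exp (log_tail v) * f v)) \<le> a * K / lam\<^sup>2 * (pi / lam)"
proof (rule integral_cauchy_bound)
  fix v :: real assume v: "\<bar>v\<bar> \<le> pi"
  let ?y = "\<bar>lam * v\<bar>"
  have "norm (exp (log_tail v) * f v) \<le> (K / (1 + (lam * v)\<^sup>2) ^ 3) * (v\<^sup>2 * a)"
    unfolding norm_mult using exp_bound[OF v, of 0] by (intro mult_mono fle) (use K in auto)
  also have "\<dots> = a / lam\<^sup>2 * (?y ^ 2 * (K / (1 + (lam * v)\<^sup>2) ^ 3))"
    using lam by (simp add: power_mult_distrib)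
  also have "\<dots> \<le> a / lam\<^sup>2 * (1 * K * (1 / (1 + (lam * v)\<^sup>2)))"
    using a lam power_le_quadratic(1)[of ?y] unfolding abs_lam
    by (intro mult_left_mono cube_quotient_le K) auto
  also have "\<dots> = a * K / lam\<^sup>2 * (1 / (1 + (lam * v)\<^sup>2))" by simp
  finally show "norm (exp (log_tail v) * f v) \<le> a * K / lam\<^sup>2 * (1 / (1 + (lam * v)\<^sup>2))" .
qed (use K a lam f in \<open>auto intro!: continuous_intros continuous_log_parts\<close>)

text \<open>
  The Fourier integrals of the two probabilities differ by the factor \<open>cis (v * d)\<close> in one and the
  characteristic function of the centred sum up to \<open>b\<close> in the other. Both are one plus a quadratic error, apart from
  the linear term \<open>\<i> * v * d\<close> of the first, which is paired with \<open>tail_first_moment\<close>.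
\<close>

lemma tail_diff:
  fixes k :: nat
  defines "d \<equiv> real k - mu"
  shows "\<bar>tail_prob w b n k - total_prob\<bar> \<le> K * (d\<^sup>2 + s2) / (4 * lam ^ 3) + C * rho * K * \<bar>d\<bar> / (2 * lam\<^sup>2)"
proof -
  let ?A = "\<lambda>v. exp (log_tail v) * (cis (v * d) - 1 - \<i> * of_real (v * d))"
  let ?B = "\<lambda>v. exp (log_tail v) * (1 - exp (log_head v))"
  let ?D = "\<lambda>v. of_real v * exp (log_tail v)"
  have cA: "continuous_on UNIV ?A" and cB: "continuous_on UNIV ?B" and cD: "continuous_on UNIV ?D"
    by (intro continuous_intros continuous_log_parts)+
  have c1: "continuous_on UNIV (\<lambda>v. exp (log_tail v) * cis (v * d))" and c2: "continuous_on UNIV (\<lambda>v. exp (log_tail v + log_head v))"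
    by (intro continuous_intros continuous_log_parts)+
  have "complex_of_real (2 * pi * tail_prob w b n k - 2 * pi * total_prob)
      = period_int (\<lambda>v. exp (log_tail v) * cis (v * d)) - period_int (\<lambda>v. exp (log_tail v + log_head v))"
    unfolding of_real_diff tail_prob_fourier total_fourier d_def ..
  also have "\<dots> = period_int (\<lambda>v. exp (log_tail v) * cis (v * d) - exp (log_tail v + log_head v))"
    by (rule Bochner_Integration.integral_diff[symmetric]; intro integrable_period c1 c2)
  also have "\<dots> = period_int (\<lambda>v. (?A v + ?B v) + \<i> * of_real d * ?D v)"
    by (intro Bochner_Integration.integral_cong) (auto simp: exp_add algebra_simps)
  also have "\<dots> = period_int (\<lambda>v. ?A v + ?B v) + period_int (\<lambda>v. \<i> * of_real d * ?D v)"
    by (rule Bochner_Integration.integral_add; intro integrable_period continuous_on_add continuous_on_mult_left cA cB cD)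
  also have "period_int (\<lambda>v. ?A v + ?B v) = period_int ?A + period_int ?B"
    by (rule Bochner_Integration.integral_add; intro integrable_period cA cB)
  also have "period_int (\<lambda>v. \<i> * of_real d * ?D v) = \<i> * of_real d * period_int ?D"
    by (rule integral_mult_right_zero)
  finally have eq: "complex_of_real (2 * pi * tail_prob w b n k - 2 * pi * total_prob)
      = period_int ?A + period_int ?B + \<i> * of_real d * period_int ?D" .
  have A: "norm (period_int ?A) \<le> (d\<^sup>2 / 2) * K / lam\<^sup>2 * (pi / lam)"
  proof (rule tail_second_moment)
    show "norm (cis (v * d) - 1 - \<i> * complex_of_real (v * d)) \<le> v\<^sup>2 * (d\<^sup>2 / 2)" for v
      using cis_taylor1[of "v * d"] by (simp add: power_mult_distrib)
  qed (auto intro!: continuous_intros)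
  have B: "norm (period_int ?B) \<le> (s2 / 2) * K / lam\<^sup>2 * (pi / lam)"
  proof (rule tail_second_moment)
    show "norm (1 - exp (log_head v)) \<le> v\<^sup>2 * (s2 / 2)" for v
      using norm_exp_diff_le[of 0 1 "log_head v"] Re_head[of v] head_approx1[of v] by simp
  qed (use s2_nonneg in \<open>auto intro!: continuous_intros continuous_log_parts\<close>)
  have D: "norm (\<i> * of_real d * period_int ?D) \<le> \<bar>d\<bar> * (C * rho * K / lam * (pi / lam))"
  proof -
    have "norm (\<i> * of_real d * period_int ?D) = \<bar>d\<bar> * norm (period_int ?D)"
      by (simp add: norm_mult)
    then show ?thesis using mult_left_mono[OF tail_first_moment abs_ge_zero] by (simp only:)
  qed
  have "norm (complex_of_real (2 * pi * tail_prob w b n k - 2 * pi * total_prob))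
      \<le> (d\<^sup>2 / 2) * K / lam\<^sup>2 * (pi / lam) + (s2 / 2) * K / lam\<^sup>2 * (pi / lam) + \<bar>d\<bar> * (C * rho * K / lam * (pi / lam))"
    unfolding eq by (intro norm_triangle_mono A B D)
  also have "\<dots> = 2 * pi * (K * (d\<^sup>2 + s2) / (4 * lam ^ 3) + C * rho * K * \<bar>d\<bar> / (2 * lam\<^sup>2))"
    using lam by (simp add: field_simps power2_eq_square power3_eq_cube)
  also have "complex_of_real (2 * pi * tail_prob w b n k - 2 * pi * total_prob) = of_real (2 * pi * (tail_prob w b n k - total_prob))"
    by (simp add: algebra_simps)
  finally show ?thesis unfolding norm_of_real by (simp add: abs_mult)
qed

lemma
  shows law_integrable: "integrable (measure_pmf law) (\<lambda>k. (real k - mu)\<^sup>2)"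
    and law_variance: "expect law (\<lambda>k. (real k - mu)\<^sup>2) = s2"
  using poisson_sum_variance[of "{1..b}" w] w_head unfolding mu_def s2_def by auto

lemma tail_prob_bounds: "0 \<le> tail_prob w b n k" "tail_prob w b n k \<le> 1"
  by (auto simp: tail_prob_def pmf_le_1)

lemma integrable_tail_diff: "integrable (measure_pmf law) (\<lambda>k. \<bar>tail_prob w b n k - total_prob\<bar>)"
proof (rule measure_pmf.integrable_const_bound[where B = "1 + \<bar>total_prob\<bar>"])
  show "AE k in measure_pmf law. norm \<bar>tail_prob w b n k - total_prob\<bar> \<le> 1 + \<bar>total_prob\<bar>"
    using tail_prob_bounds by (intro AE_I2) (smt (verit) real_norm_def)
qed auto

text \<open>
  The linear term of \<open>tail_diff\<close> is split by the inequality between arithmetic and geometric mean so that only the second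
  moment of the law is used, and the resulting \<open>rho\<^sup>2 / lam\<close> does not depend on \<open>b\<close>.
\<close>

lemma expectation_tail_diff_le:
  "mean_dev \<le> K * (1 + C) * (s2 / lam ^ 3 + rho\<^sup>2 / lam)"
proof -
  let ?a = "K / (4 * lam ^ 3) + C * K / (4 * lam ^ 3)"
  let ?c = "K * s2 / (4 * lam ^ 3) + C * K * rho\<^sup>2 / (4 * lam)"
  have le: "\<bar>tail_prob w b n k - total_prob\<bar> \<le> ?a * (real k - mu)\<^sup>2 + ?c" for k
  proof -
    let ?d = "real k - mu"
    have "2 * (\<bar>?d\<bar> * rho * lam) \<le> ?d\<^sup>2 + (rho * lam)\<^sup>2"
      using zero_le_power2[of "\<bar>?d\<bar> - rho * lam"] by (simp add: power2_diff mult_ac)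
    then have "2 * (\<bar>?d\<bar> * rho * lam) / (4 * lam ^ 3) \<le> (?d\<^sup>2 + (rho * lam)\<^sup>2) / (4 * lam ^ 3)"
      using lam by (intro divide_right_mono) auto
    then have "C * K * (2 * (\<bar>?d\<bar> * rho * lam) / (4 * lam ^ 3)) \<le> C * K * ((?d\<^sup>2 + (rho * lam)\<^sup>2) / (4 * lam ^ 3))"
      using C K by (intro mult_left_mono) auto
    also have "C * K * (2 * (\<bar>?d\<bar> * rho * lam) / (4 * lam ^ 3)) = C * rho * K * \<bar>?d\<bar> / (2 * lam\<^sup>2)"
      using lam by (simp add: field_simps power2_eq_square power3_eq_cube)
    also have "C * K * ((?d\<^sup>2 + (rho * lam)\<^sup>2) / (4 * lam ^ 3)) = C * K / (4 * lam ^ 3) * ?d\<^sup>2 + C * K * rho\<^sup>2 / (4 * lam)"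
      using lam by (simp add: field_simps power2_eq_square power3_eq_cube)
    finally show ?thesis using tail_diff[of k] by (simp add: algebra_simps add_divide_distrib)
  qed
  have "mean_dev
      \<le> expect law (\<lambda>k. ?a * (real k - mu)\<^sup>2 + ?c)"
    by (rule integral_mono[OF integrable_tail_diff _ le]) (use law_integrable in auto)
  also have "\<dots> = ?a * s2 + ?c"
    using law_integrable law_variance by (subst Bochner_Integration.integral_add) auto
  also have "\<dots> \<le> K * (1 + C) * (s2 / lam ^ 3 + rho\<^sup>2 / lam)"
  proof -
    have "?a * s2 + ?c = K * (2 + C) / 4 * (s2 / lam ^ 3) + C * K / 4 * (rho\<^sup>2 / lam)"
      by (simp add: algebra_simps add_divide_distrib)
    also have "\<dots> \<le> K * (1 + C) * (s2 / lam ^ 3) + K * (1 + C) * (rho\<^sup>2 / lam)"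
      using K C lam s2_nonneg
      by (intro add_mono mult_right_mono divide_nonneg_nonneg) (auto simp: algebra_simps)
    finally show ?thesis by (simp add: algebra_simps)
  qed
  finally show ?thesis .
qed

lemma expectation_cis_centered: "expect law (\<lambda>k. cis (u * (real k - mu))) = exp (log_head u)"
proof -
  have "(\<lambda>k. cis (u * (real k - mu))) = (\<lambda>k. cis (- u * mu) * cis (u * real k))"
    by (simp add: cis_mult algebra_simps)
  then have "expect law (\<lambda>k. cis (u * (real k - mu))) = cis (- u * mu) * exp (log_char w {1..b} u)"
    by (simp only: integral_mult_right_zero char_head)
  then show ?thesis unfolding log_head_def cis_conv_exp exp_add[symmetric] by (simp add: algebra_simps)
qed

text \<open>
  If the sum up to \<open>b\<close> and the total sum were jointly Gaussian, the two integrals would, up to a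
  common normalising factor, be the characteristic function at \<open>u\<close> of the former, once conditioned
  on the latter and once not. The integrands differ by the factor \<open>exp (- s2 * u * v)\<close>. Symmetrising
  in \<open>v\<close> removes its linear part, and the quadratic part is positive.
\<close>

lemma gaussian_covariance_gap:
  defines "u \<equiv> 1 / lam"
  shows "period_int (\<lambda>v. exp (- (tau2 * v\<^sup>2 / 2) - s2 * (v + u)\<^sup>2 / 2))
     - period_int (\<lambda>v. exp (- (tau2 * v\<^sup>2 / 2) - (s2 * v\<^sup>2 / 2 + s2 * u\<^sup>2 / 2)))
     \<ge> exp (- C) * (s2 / lam\<^sup>2)\<^sup>2 / (6 * lam)"
proof -
  let ?E = "\<lambda>v. exp (- (tau2 * v\<^sup>2 / 2) - (s2 * v\<^sup>2 / 2 + s2 * u\<^sup>2 / 2))"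
  let ?A = "\<lambda>v. exp (- (tau2 * v\<^sup>2 / 2) - s2 * (v + u)\<^sup>2 / 2)"
  define x where "x v = s2 * u * v" for v
  have cA: "continuous_on UNIV ?A" and cE: "continuous_on UNIV ?E" and cA': "continuous_on UNIV (\<lambda>v. ?A (- v))"
    by (intro continuous_intros; simp)+
  have A: "?A v = ?E v * exp (- x v)" for v
    unfolding x_def exp_add[symmetric] by (simp add: power2_eq_square algebra_simps add_divide_distrib diff_divide_distrib)
  have A': "?A (- v) = ?E v * exp (x v)" for v
    unfolding x_def exp_add[symmetric] by (simp add: power2_eq_square algebra_simps add_divide_distrib diff_divide_distrib)
  \<comment> \<open>Weaker than the sharp bound \<open>x\<^sup>2\<close>, but it follows at once from the Taylor bound for \<open>exp\<close>.\<close>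
  have ch: "x\<^sup>2 / 2 \<le> exp x + exp (- x) - 2" for x :: real
  proof -
    have *: "y\<^sup>2 / 2 \<le> exp y + exp (- y) - 2" if "y \<ge> 0" for y :: real
      using exp_lower_Taylor_quadratic[OF that] exp_ge_add_one_self[of "- y"] by simp
    show ?thesis using *[of x] *[of "- x"] by (cases "x \<ge> 0") (auto simp: add.commute)
  qed
  have "2 * (exp (- C) * (s2 * u)\<^sup>2 / 2) * (1 / lam) ^ (2 * 1 + 1) / real (2 * 1 + 1)
      \<le> period_int (\<lambda>v. (?A v + ?A (- v)) - 2 * ?E v)"
  proof (rule integral_period_ge_near_0)
    show "continuous_on UNIV (\<lambda>v. (?A v + ?A (- v)) - 2 * ?E v)"
      by (intro continuous_on_diff continuous_on_add continuous_on_mult_left cA cA' cE)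
    have eq: "(?A v + ?A (- v)) - 2 * ?E v = ?E v * (exp (x v) + exp (- x v) - 2)" for v
      unfolding A[of v] A'[of v] by (simp add: algebra_simps)
    have ch0: "exp (x v) + exp (- x v) - 2 \<ge> 0" for v
      using ch[of "x v"] zero_le_power2[of "x v"] by linarith
    show "0 \<le> (?A v + ?A (- v)) - 2 * ?E v" for v
      unfolding eq using ch0 by (intro mult_nonneg_nonneg) auto
    show "exp (- C) * (s2 * u)\<^sup>2 / 2 * v ^ (2 * 1) \<le> (?A v + ?A (- v)) - 2 * ?E v" if v: "\<bar>v\<bar> \<le> 1 / lam" for v
    proof -
      have "s2 * u\<^sup>2 \<le> C"
        using s2_tau2 tau2_nonneg lam by (simp add: u_def field_simps power2_eq_square)
      then have "exp (- C) \<le> exp (- (C / 2)) * exp (- (s2 * u\<^sup>2 / 2))" by (simp add: exp_add[symmetric])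
      also have "\<dots> \<le> exp (- ((s2 + tau2) * v\<^sup>2 / 2)) * exp (- (s2 * u\<^sup>2 / 2))"
        using gauss_near_0[OF v] by (intro mult_right_mono) auto
      also have "\<dots> = ?E v" unfolding exp_add[symmetric] by (simp add: algebra_simps add_divide_distrib)
      finally have "exp (- C) * ((x v)\<^sup>2 / 2) \<le> ?E v * (exp (x v) + exp (- x v) - 2)"
        using ch by (intro mult_mono) auto
      then show ?thesis unfolding eq by (simp add: x_def power_mult_distrib mult_ac)
    qed
    show "1 / lam \<le> pi" "0 \<le> 1 / lam" using lam by auto
  qed
  also have "period_int (\<lambda>v. (?A v + ?A (- v)) - 2 * ?E v)
      = period_int (\<lambda>v. ?A v + ?A (- v)) - period_int (\<lambda>v. 2 * ?E v)"
    by (intro Bochner_Integration.integral_diff integrable_period continuous_on_add continuous_on_mult_left cA cA' cE)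
  also have "period_int (\<lambda>v. ?A v + ?A (- v)) = period_int ?A + period_int (\<lambda>v. ?A (- v))"
    by (intro Bochner_Integration.integral_add integrable_period cA cA')
  also have "period_int (\<lambda>v. ?A (- v)) = period_int ?A" by (rule integral_period_reflect)
  also have "period_int (\<lambda>v. 2 * ?E v) = 2 * period_int ?E" by (rule integral_mult_right_zero)
  finally have a: "2 * (exp (- C) * (s2 * u)\<^sup>2 / 2) * (1 / lam) ^ (2 * 1 + 1) / real (2 * 1 + 1) \<le> 2 * (period_int ?A - period_int ?E)"
    by simp
  have e: "2 * (exp (- C) * (s2 * u)\<^sup>2 / 2) * (1 / lam) ^ (2 * 1 + 1) / real (2 * 1 + 1) = 2 * (exp (- C) * (s2 / lam\<^sup>2)\<^sup>2 / (6 * lam))"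
    using lam by (simp add: u_def power2_eq_square power3_eq_cube mult_ac)
  show ?thesis by (rule mult_left_le_imp_le[OF a[unfolded e]]) simp
qed

text \<open>
  Testing the difference against the character of frequency \<open>1 / lam\<close> gives a lower bound for its
  absolute expectation. The Gaussian value of the test is \<open>gaussian_covariance_gap\<close>; the two
  approximation errors are each of relative order \<open>rho\<close>.
\<close>

lemma expectation_tail_diff_ge:
  "mean_dev
    \<ge> (exp (- C) * (s2 / lam\<^sup>2)\<^sup>2 / (12 * pi) - 4 * (C * rho * K)) / lam"
proof -
  define u where "u = 1 / lam"
  define A0 where "A0 = period_int (\<lambda>v. exp (- (tau2 * v\<^sup>2 / 2) - s2 * (v + u)\<^sup>2 / 2))"
  define B0 where "B0 = period_int (\<lambda>v. exp (- (tau2 * v\<^sup>2 / 2) - (s2 * v\<^sup>2 / 2 + s2 * u\<^sup>2 / 2)))"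
  let ?c = "\<lambda>k::nat. cis (u * (real k - mu))"
  let ?E = "expect law (\<lambda>k. ?c k * of_real (tail_prob w b n k))"
  have lu: "\<bar>lam * u\<bar> = 1" using lam by (simp add: u_def)
  have "norm (period_int (\<lambda>v. exp (log_tail v + log_head (v + u))) - of_real A0) \<le> 5 * (C * rho * K) * (pi / lam)"
    unfolding A0_def
  proof (rule exp_approx_integral[where e = "\<lambda>v. \<bar>lam * (v + u)\<bar> ^ 3"])
    show "\<bar>lam * v\<bar> + \<bar>lam * v\<bar> ^ 3 + \<bar>lam * (v + u)\<bar> ^ 3 \<le> 5 * (1 + (lam * v)\<^sup>2)\<^sup>2" for v
    proof -
      have "\<bar>lam * (v + u)\<bar> \<le> \<bar>lam * v\<bar> + 1" using lu abs_triangle_ineq[of "lam * v" "lam * u"] by (simp add: distrib_left)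
      then have "\<bar>lam * (v + u)\<bar> ^ 3 \<le> (\<bar>lam * v\<bar> + 1) ^ 3" by (rule power_mono) simp
      also have "\<dots> \<le> 4 * (1 + (lam * v)\<^sup>2)\<^sup>2"
        using power_le_quadratic(6)[of "\<bar>lam * v\<bar>"] unfolding abs_lam by simp
      finally show ?thesis
        using power_le_quadratic(2)[of "\<bar>lam * v\<bar>"] unfolding abs_lam by simp
    qed
    show "norm (log_head (v + u) + complex_of_real (s2 * (v + u)\<^sup>2 / 2)) \<le> C * rho * \<bar>lam * (v + u)\<bar> ^ 3" for v
      by (rule head_approx2)
    show "continuous_on UNIV (\<lambda>v. log_head (v + u))"
      by (rule continuous_on_compose2[OF continuous_log_parts(2)]) (auto intro!: continuous_intros)
  qed (auto intro!: continuous_intros Re_head simp: s2_nonneg)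
  then have A: "norm (complex_of_real (2 * pi) * ?E - of_real A0) \<le> 5 * (C * rho * K) * (pi / lam)"
    unfolding tail_prob_char .
  have "norm (period_int (\<lambda>v. exp (log_tail v + (log_head v + log_head u))) - of_real B0) \<le> 3 * (C * rho * K) * (pi / lam)"
    unfolding B0_def
  proof (rule exp_approx_integral[where e = "\<lambda>v. \<bar>lam * v\<bar> ^ 3 + 1"])
    show "\<bar>lam * v\<bar> + \<bar>lam * v\<bar> ^ 3 + (\<bar>lam * v\<bar> ^ 3 + 1) \<le> 3 * (1 + (lam * v)\<^sup>2)\<^sup>2" for v
      using power_le_quadratic(2,4)[of "\<bar>lam * v\<bar>"] unfolding abs_lam by simp
    show "norm (log_head v + log_head u + complex_of_real (s2 * v\<^sup>2 / 2 + s2 * u\<^sup>2 / 2)) \<le> C * rho * (\<bar>lam * v\<bar> ^ 3 + 1)" for v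
    proof -
      have "log_head v + log_head u + complex_of_real (s2 * v\<^sup>2 / 2 + s2 * u\<^sup>2 / 2)
        = (log_head v + complex_of_real (s2 * v\<^sup>2 / 2)) + (log_head u + complex_of_real (s2 * u\<^sup>2 / 2))"
        by simp
      also have "norm \<dots> \<le> C * rho * \<bar>lam * v\<bar> ^ 3 + C * rho * \<bar>lam * u\<bar> ^ 3"
        by (intro norm_triangle_mono head_approx2)
      finally show ?thesis unfolding lu by (simp add: algebra_simps)
    qed
    show "Re (log_head v + log_head u) \<le> 0" for v using Re_head[of v] Re_head[of u] by simp
  qed (auto intro!: continuous_intros continuous_log_parts simp: s2_nonneg)
  also have "period_int (\<lambda>v. exp (log_tail v + (log_head v + log_head u))) = period_int (\<lambda>v. exp (log_head u) * exp (log_tail v + log_head v))"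
    by (simp add: exp_add mult_ac)
  also have "\<dots> = exp (log_head u) * of_real (2 * pi * total_prob)"
    unfolding total_fourier by (rule integral_mult_right_zero)
  finally have B: "norm (exp (log_head u) * of_real (2 * pi * total_prob) - of_real B0) \<le> 3 * (C * rho * K) * (pi / lam)" .
  have gap: "A0 - B0 \<ge> exp (- C) * (s2 / lam\<^sup>2)\<^sup>2 / (6 * lam)"
    unfolding A0_def B0_def u_def by (rule gaussian_covariance_gap)
  have int1: "integrable (measure_pmf law) (\<lambda>k. ?c k * of_real (tail_prob w b n k))"
    by (rule measure_pmf.integrable_const_bound[where B = 1])
       (auto intro!: AE_I2 simp: norm_mult tail_prob_bounds)
  have int2: "integrable (measure_pmf law) (\<lambda>k. ?c k * of_real total_prob)"
    by (rule measure_pmf.integrable_const_bound[where B = "\<bar>total_prob\<bar>"]) (auto intro!: AE_I2 simp: norm_mult)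
  have "expect law (\<lambda>k. ?c k * of_real (tail_prob w b n k - total_prob))
      = expect law (\<lambda>k. ?c k * of_real (tail_prob w b n k) - ?c k * of_real total_prob)"
    by (simp add: algebra_simps)
  also have "\<dots> = ?E - expect law (\<lambda>k. ?c k * of_real total_prob)"
    by (rule Bochner_Integration.integral_diff[OF int1 int2])
  also have "expect law (\<lambda>k. ?c k * of_real total_prob) = exp (log_head u) * of_real total_prob"
    unfolding integral_mult_left_zero expectation_cis_centered ..
  finally have eq: "expect law (\<lambda>k. ?c k * of_real (tail_prob w b n k - total_prob)) = ?E - exp (log_head u) * of_real total_prob" .
  have "norm (?E - exp (log_head u) * of_real total_prob) \<le> expect law (\<lambda>k. norm (?c k * of_real (tail_prob w b n k - total_prob)))"
    unfolding eq[symmetric] by (rule integral_norm_bound)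
  also have "\<dots> = mean_dev"
    by (simp only: norm_mult norm_cis norm_of_real mult_1)
  finally have le: "norm (?E - exp (log_head u) * of_real total_prob) \<le> mean_dev" .
  have "A0 - B0 \<le> norm (complex_of_real (A0 - B0))" unfolding norm_of_real by simp
  \<comment> \<open>The characteristic functions, up to the factor \<open>2 * pi\<close>, compared through their Gaussian values.\<close>
  also have "complex_of_real (A0 - B0) = - (complex_of_real (2 * pi) * ?E - of_real A0)
      + ((exp (log_head u) * of_real (2 * pi * total_prob) - of_real B0) + complex_of_real (2 * pi) * (?E - exp (log_head u) * of_real total_prob))"
    by (simp add: algebra_simps)
  also have "norm \<dots> \<le> 5 * (C * rho * K) * (pi / lam) + (3 * (C * rho * K) * (pi / lam)
      + 2 * pi * mean_dev)"
  proof (intro norm_triangle_mono B)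
    show "norm (- (complex_of_real (2 * pi) * ?E - of_real A0)) \<le> 5 * (C * rho * K) * (pi / lam)"
      unfolding norm_minus_cancel by (rule A)
    have "norm (complex_of_real (2 * pi) * (?E - exp (log_head u) * of_real total_prob)) = 2 * pi * norm (?E - exp (log_head u) * of_real total_prob)"
      by (simp add: norm_mult)
    then show "norm (complex_of_real (2 * pi) * (?E - exp (log_head u) * of_real total_prob))
       \<le> 2 * pi * mean_dev"
      using mult_left_mono[OF le, of "2 * pi"] by simp
  qed
  also have "\<dots> = 8 * (C * rho * K) * (pi / lam)
      + 2 * pi * mean_dev"
    by (simp add: mult.assoc)
  finally have "exp (- C) * (s2 / lam\<^sup>2)\<^sup>2 / (6 * lam) \<le> 8 * (C * rho * K) * (pi / lam)
      + 2 * pi * mean_dev"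
    by (rule order.trans[OF gap])
  then show ?thesis using lam by (simp add: field_simps)
qed

end

section \<open>Power sums with exponential cutoff\<close>

lemma summable_power_exp:
  fixes z :: complex
  assumes "norm z < 1"
  shows "summable (\<lambda>m. of_nat m ^ k * z ^ m)"
  using assms
proof (induction k arbitrary: z)
  case 0
  then show ?case by (simp add: summable_geometric)
next
  case (Suc k)
  have "summable (\<lambda>m. diffs (\<lambda>m. of_nat m ^ k :: complex) m * z ^ m)"
    by (rule termdiff_converges[OF Suc.prems Suc.IH])
  then have "summable (\<lambda>m. diffs (\<lambda>m. of_nat m ^ k :: complex) m * z ^ m * z)" by (rule summable_mult2)
  also have "(\<lambda>m. diffs (\<lambda>m. of_nat m ^ k :: complex) m * z ^ m * z) = (\<lambda>m. of_nat (Suc m) ^ Suc k * z ^ Suc m)"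
    by (auto simp: diffs_def simp del: of_nat_Suc)
  finally show ?case by (subst (asm) summable_Suc_iff)
qed

definition power_series :: "nat \<Rightarrow> complex \<Rightarrow> complex" where
  "power_series k z = (\<Sum>m. of_nat m ^ k * exp (- z) ^ m)"

lemma norm_exp_lt_1: "Re z > 0 \<Longrightarrow> norm (exp (- z) :: complex) < 1" by simp

lemma has_field_derivative_power_series:
  assumes "Re z > 0"
  shows "(power_series k has_field_derivative - power_series (Suc k) z) (at z)"
proof -
  let ?t = "exp (- z)"
  have t: "norm ?t < 1" by (rule norm_exp_lt_1[OF assms])
  have "((\<lambda>t. \<Sum>m. of_nat m ^ k * t ^ m) has_field_derivative (\<Sum>m. diffs (\<lambda>m. of_nat m ^ k) m * ?t ^ m)) (at ?t)"
    by (rule termdiffs_strong'[OF summable_power_exp t])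
  moreover have "((\<lambda>z. exp (- z)) has_field_derivative - ?t) (at z)" by (auto intro!: derivative_eq_intros)
  ultimately have "((\<lambda>z. \<Sum>m. of_nat m ^ k * exp (- z) ^ m) has_field_derivative (\<Sum>m. diffs (\<lambda>m. of_nat m ^ k) m * ?t ^ m) * - ?t) (at z)"
    by (rule DERIV_chain2)
  moreover have "(\<Sum>m. diffs (\<lambda>m. of_nat m ^ k) m * ?t ^ m) * ?t = power_series (Suc k) z"
  proof -
    have s: "summable (\<lambda>m. diffs (\<lambda>m. of_nat m ^ k :: complex) m * ?t ^ m)"
      by (rule termdiff_converges[OF t summable_power_exp])
    have "(\<lambda>m. of_nat m ^ Suc k * ?t ^ m) sums ((\<Sum>m. diffs (\<lambda>m. of_nat m ^ k) m * ?t ^ m) * ?t)"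
    proof -
      have "(\<lambda>m. of_nat (Suc m) ^ Suc k * ?t ^ Suc m) = (\<lambda>m. diffs (\<lambda>m. of_nat m ^ k) m * ?t ^ m * ?t)"
        by (auto simp: diffs_def simp del: of_nat_Suc)
      then have "(\<lambda>m. of_nat (Suc m) ^ Suc k * ?t ^ Suc m) sums ((\<Sum>m. diffs (\<lambda>m. of_nat m ^ k) m * ?t ^ m) * ?t)"
        using sums_mult2[OF summable_sums[OF s]] by (simp only:)
      then show ?thesis by (subst (asm) sums_Suc_iff) simp
    qed
    then show ?thesis unfolding power_series_def by (rule sums_unique)
  qed
  ultimately show ?thesis unfolding power_series_def[abs_def] by simp
qed

lemma power_series_0:
  assumes "Re z > 0"
  shows "power_series 0 z = 1 / (1 - exp (- z))"
  unfolding power_series_def using suminf_geometric[OF norm_exp_lt_1[OF assms]] by simp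

lemma exp_minus_eq_1_ball:
  assumes "z \<in> ball (0::complex) 6" "exp (- z) = 1"
  shows "z = 0"
proof -
  have "exp (-z) = exp 0" using assms(2) by simp
  then have "\<exists>n::int. - z = 0 + complex_of_real (of_int (2 * n) * pi) * \<i>" unfolding exp_eq by simp
  then obtain n :: int where n: "- z = \<i> * complex_of_real (of_int (2 * n) * pi)"
    by (auto simp: mult.commute)
  then have "norm (- z) = \<bar>of_int (2 * n) * pi\<bar>" by (simp only: norm_mult norm_ii norm_of_real mult_1)
  then have "\<bar>real_of_int n\<bar> * (2 * pi) < 6" using assms(1) by (simp add: abs_mult)
  moreover have "2 * pi > 6" using pi_gt3 by simp
  ultimately have "\<bar>real_of_int n\<bar> < 1"
    by (smt (verit) mult_le_cancel_right2 mult_less_cancel_right2)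
  then have "n = 0" by linarith
  then show ?thesis using n by simp
qed

text \<open>
  The only zeros of \<open>1 - exp (- z)\<close> are the multiples of \<open>2 * pi * \<i>\<close>, so the origin is the only pole of
  \<open>1 / (1 - exp (- z))\<close> in the disc of radius \<open>6\<close>. It is simple with residue one, and subtracting
  \<open>1 / z\<close> removes it.
\<close>

lemma geometric_regular_part:
  "\<exists>H. H holomorphic_on ball 0 6 \<and>
    (\<forall>z\<in>ball 0 6. z \<noteq> 0 \<longrightarrow> H z = 1 / (1 - exp (- z)) - 1 / (z::complex))"
proof -
  let ?S = "ball (0::complex) 6"
  define D where "D z = (if z = 0 then 1 else (1 - exp (- z)) / z)" for z :: complex
  have der1: "deriv (\<lambda>z::complex. 1 - exp (- z)) 0 = 1"
    by (rule DERIV_imp_deriv) (auto intro!: derivative_eq_intros)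
  have "D holomorphic_on ?S"
  proof (rule pole_theorem_open_0[where g = "\<lambda>z. 1 - exp (- z)" and a = 0])
    show "(\<lambda>z. 1 - exp (- z)) holomorphic_on ?S" by (intro holomorphic_intros)
  qed (auto simp: D_def der1)
  moreover have D0: "D z \<noteq> 0" if "z \<in> ?S" for z
    using exp_minus_eq_1_ball[OF that] by (auto simp: D_def)
  ultimately have hol: "(\<lambda>z. 1 / D z) holomorphic_on ?S" by (intro holomorphic_intros) auto
  define H where "H = (\<lambda>z. if z = 0 then deriv (\<lambda>z. 1 / D z) 0 else 1 / (1 - exp (- z)) - (1 / D 0) / (z - 0))"
  have "H holomorphic_on ?S"
    unfolding H_def
  proof (rule pole_theorem_open[OF hol])
    show "1 / D z = (z - 0) * (1 / (1 - exp (- z)))" if "z \<in> ?S - {0}" for z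
      using that by (simp add: D_def)
  qed simp
  then show ?thesis by (intro exI[of _ H]) (auto simp: D_def H_def)
qed

text \<open>
  Differentiating \<open>k\<close> times brings down the powers \<open>m ^ k\<close> in the series and turns \<open>1 / z\<close> into
  the main term.
\<close>

lemma power_series_regular_part:
  assumes "H holomorphic_on ball 0 6"
    and "\<And>z. z \<in> ball 0 6 \<Longrightarrow> z \<noteq> 0 \<Longrightarrow> H z = 1 / (1 - exp (- z)) - 1 / (z::complex)"
    and "z \<in> ball 0 6" "Re z > 0"
  shows "(deriv ^^ k) H z = (-1) ^ k * (power_series k z - fact k / z ^ Suc k)"
  using assms(3,4)
proof (induction k arbitrary: z)
  case 0
  then have "z \<noteq> 0" by auto
  then show ?case using assms(2)[OF 0(1)] power_series_0[OF 0(2)] by simp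
next
  case (Suc k)
  let ?U = "ball (0::complex) 6 \<inter> {z. Re z > 0}"
  have nz: "z \<noteq> 0" using Suc.prems by auto
  have op: "open ?U" by (intro open_Int open_ball open_halfspace_Re_gt)
  have "((\<lambda>z. (-1) ^ k * (power_series k z - fact k / z ^ Suc k)) has_field_derivative
      (-1) ^ k * (- power_series (Suc k) z - (- (fact k * of_nat (Suc k)) / z ^ Suc (Suc k)))) (at z)"
  proof (intro DERIV_cmult DERIV_diff has_field_derivative_power_series Suc.prems)
    have "((\<lambda>z. fact k / z ^ Suc k) has_field_derivative (- (fact k * (of_nat (Suc k) * z ^ k))) / (z ^ Suc k * z ^ Suc k)) (at z)"
      using nz by (auto intro!: derivative_eq_intros simp del: power_Suc)
    also have "(- (fact k * (of_nat (Suc k) * z ^ k))) / (z ^ Suc k * z ^ Suc k) = - (fact k * of_nat (Suc k)) / z ^ Suc (Suc k)"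
      using nz by (simp add: divide_simps)
    finally show "((\<lambda>z. fact k / z ^ Suc k) has_field_derivative - (fact k * of_nat (Suc k)) / z ^ Suc (Suc k)) (at z)" .
  qed
  then have "((deriv ^^ k) H has_field_derivative
      (-1) ^ k * (- power_series (Suc k) z - (- (fact k * of_nat (Suc k)) / z ^ Suc (Suc k)))) (at z)"
    by (rule has_field_derivative_transform_within_open[OF _ op]) (use Suc in auto)
  then have "(deriv ^^ Suc k) H z = (-1) ^ k * (- power_series (Suc k) z - (- (fact k * of_nat (Suc k)) / z ^ Suc (Suc k)))"
    by (simp add: DERIV_imp_deriv)
  also have "\<dots> = (-1) ^ Suc k * (power_series (Suc k) z - fact (Suc k) / z ^ Suc (Suc k))"
    by (simp add: algebra_simps)
  finally show ?case .
qed

definition real_series :: "nat \<Rightarrow> real \<Rightarrow> real" where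
  "real_series k z = (\<Sum>m. real m ^ k * exp (- z * real m))"

lemma
  assumes "z > 0"
  shows summable_real_series: "summable (\<lambda>m. real m ^ k * exp (- z * real m))"
    and power_series_of_real: "power_series k (of_real z) = of_real (real_series k z)"
proof -
  have t: "norm (exp (- complex_of_real z)) < 1" using assms by simp
  have eq: "complex_of_nat m ^ k * exp (- complex_of_real z) ^ m = of_real (real m ^ k * exp (- z * real m))" for m
    by (simp add: exp_of_real[symmetric] exp_of_nat_mult[symmetric] mult.commute)
  have "summable (\<lambda>m. complex_of_real (real m ^ k * exp (- z * real m)))"
    using summable_power_exp[OF t, of k] unfolding eq .
  then show s: "summable (\<lambda>m. real m ^ k * exp (- z * real m))" by (simp only: summable_complex_of_real)
  show "power_series k (of_real z) = of_real (real_series k z)"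
    unfolding power_series_def real_series_def eq by (rule suminf_of_real[OF s, symmetric])
qed

lemma real_series_nonneg: "z > 0 \<Longrightarrow> real_series k z \<ge> 0"
  unfolding real_series_def by (rule suminf_nonneg[OF summable_real_series]) auto

text \<open>
  Near zero the difference is a derivative of a function that is holomorphic at zero, and hence
  bounded. For \<open>z \<ge> 1\<close> both terms are separately of order \<open>1 / z\<^sup>2\<close>; this decay makes the Mellin integral
  of the error converge at infinity.
\<close>

lemma real_series_approx:
  assumes k: "k \<ge> 1"
  obtains B where "B > 0" and "\<And>z. z > 0 \<Longrightarrow> \<bar>real_series k z - fact k / z ^ Suc k\<bar> \<le> B"
    and "\<And>z. z \<ge> 1 \<Longrightarrow> \<bar>real_series k z - fact k / z ^ Suc k\<bar> \<le> B / z\<^sup>2"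
proof -
  from geometric_regular_part obtain H where H1: "H holomorphic_on ball 0 6 \<and>
    (\<forall>z\<in>ball 0 6. z \<noteq> 0 \<longrightarrow> H z = 1 / (1 - exp (- z)) - 1 / (z::complex))" by (elim exE)
  have H: "H holomorphic_on ball 0 6"
    "\<And>z. z \<in> ball 0 6 \<Longrightarrow> z \<noteq> 0 \<Longrightarrow> H z = 1 / (1 - exp (- z)) - 1 / (z::complex)"
    using H1 by auto
  have "(deriv ^^ k) H holomorphic_on ball 0 6" by (rule holomorphic_higher_deriv[OF H(1)]) simp
  then have "continuous_on (cball 0 1) ((deriv ^^ k) H)"
    by (rule continuous_on_subset[OF holomorphic_on_imp_continuous_on]) auto
  then have "compact ((deriv ^^ k) H ` cball 0 1)" by (rule compact_continuous_image) simp
  then have "bounded ((deriv ^^ k) H ` cball 0 1)" by (rule compact_imp_bounded)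
  then obtain B1 where B1: "\<forall>x\<in>(deriv ^^ k) H ` cball 0 1. norm x \<le> B1"
    unfolding bounded_iff by (elim exE)
  have small: "\<bar>real_series k z - fact k / z ^ Suc k\<bar> \<le> B1" if z: "z > 0" "z \<le> 1" for z
  proof -
    have "(deriv ^^ k) H (of_real z) = (-1) ^ k * (power_series k (of_real z) - fact k / of_real z ^ Suc k)"
      by (rule power_series_regular_part[OF H]) (use z in auto)
    also have "power_series k (of_real z) - fact k / of_real z ^ Suc k = of_real (real_series k z - fact k / z ^ Suc k)"
      using power_series_of_real[OF z(1)] by simp
    finally have "norm ((deriv ^^ k) H (of_real z)) = \<bar>real_series k z - fact k / z ^ Suc k\<bar>"
      by (simp only: norm_mult norm_power norm_minus_cancel norm_one power_one mult_1 norm_of_real)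
    moreover have "norm ((deriv ^^ k) H (of_real z)) \<le> B1" using B1 z by auto
    ultimately show ?thesis by simp
  qed
  define B2 where "B2 = 2 * exp 1 * real_series k 1 + fact k"
  have nn1: "real_series k z \<ge> 0" if "z > 0" for z
    using that by (rule real_series_nonneg)
  have B2: "B2 \<ge> 0" unfolding B2_def using nn1[of 1] by simp
  have large: "\<bar>real_series k z - fact k / z ^ Suc k\<bar> \<le> B2 / z\<^sup>2" if z: "z \<ge> 1" for z
  proof -
    have "real_series k z \<le> (\<Sum>m. exp (1 - z) * (real m ^ k * exp (- 1 * real m)))"
      unfolding real_series_def
    proof (rule suminf_le)
      show "real m ^ k * exp (- z * real m) \<le> exp (1 - z) * (real m ^ k * exp (- 1 * real m))" for m
      proof (cases "m = 0")
        case True then show ?thesis using k by (cases k) auto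
      next
        case False
        then have "(z - 1) * 1 \<le> (z - 1) * real m" using z by (intro mult_left_mono) auto
        then have "- z * real m \<le> (1 - z) + - 1 * real m" by (simp add: algebra_simps)
        then have "exp (- z * real m) \<le> exp (1 - z) * exp (- 1 * real m)" unfolding exp_add[symmetric] by simp
        then have "real m ^ k * exp (- z * real m) \<le> real m ^ k * (exp (1 - z) * exp (- 1 * real m))"
          by (intro mult_left_mono) auto
        then show ?thesis by (simp only: mult_ac)
      qed
      show "summable (\<lambda>m. real m ^ k * exp (- z * real m))" by (rule summable_real_series) (use z in simp)
      show "summable (\<lambda>m. exp (1 - z) * (real m ^ k * exp (- 1 * real m)))"
        by (rule summable_mult[OF summable_real_series]) simp
    qed
    also have "\<dots> = exp (1 - z) * real_series k 1"
      unfolding real_series_def by (rule suminf_mult[OF summable_real_series]) simp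
    also have "exp (1 - z) \<le> 2 * exp 1 / z\<^sup>2"
    proof -
      have "z\<^sup>2 / 2 \<le> exp z" using exp_lower_Taylor_quadratic[of z] z by linarith
      then have "exp 1 * z\<^sup>2 \<le> exp 1 * (2 * exp z)" by (intro mult_left_mono) auto
      then show ?thesis using z by (simp add: exp_diff divide_simps mult_ac)
    qed
    finally have 1: "real_series k z \<le> 2 * exp 1 / z\<^sup>2 * real_series k 1"
      using nn1[of 1] by (simp add: mult_right_mono)
    have "z\<^sup>2 \<le> z ^ Suc k" using z k by (intro power_increasing) auto
    then have 2: "fact k / z ^ Suc k \<le> fact k / z\<^sup>2" using z by (intro divide_left_mono) auto
    have "real_series k z \<ge> 0" "fact k / z ^ Suc k \<ge> 0" using z nn1[of z] by auto
    then have "\<bar>real_series k z - fact k / z ^ Suc k\<bar> \<le> real_series k z + fact k / z ^ Suc k" by linarith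
    also have "\<dots> \<le> B2 / z\<^sup>2" unfolding B2_def add_divide_distrib using 1 2 by (intro add_mono) auto
    finally show ?thesis .
  qed
  show ?thesis
  proof (rule that[of "\<bar>B1\<bar> + B2 + 1"])
    show "\<bar>B1\<bar> + B2 + 1 > 0" using B2 by linarith
    show "\<bar>real_series k z - fact k / z ^ Suc k\<bar> \<le> (\<bar>B1\<bar> + B2 + 1) / z\<^sup>2" if "z \<ge> 1" for z
    proof -
      have "B2 / z\<^sup>2 \<le> (\<bar>B1\<bar> + B2 + 1) / z\<^sup>2" by (intro divide_right_mono) auto
      then show ?thesis using large[OF that] by linarith
    qed
    show "\<bar>real_series k z - fact k / z ^ Suc k\<bar> \<le> \<bar>B1\<bar> + B2 + 1" if "z > 0" for z
    proof (cases "z \<le> 1")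
      case True then show ?thesis using small[OF that True] B2 by linarith
    next
      case False
      then have "z\<^sup>2 \<ge> 1" by (simp add: one_le_power)
      then have "B2 / z\<^sup>2 \<le> B2" using B2 False by (simp add: divide_le_eq mult_left_mono[of 1 "z\<^sup>2" B2, simplified])
      then show ?thesis using large[of z] False by linarith
    qed
  qed
qed

abbreviation mellin :: "real \<Rightarrow> (real \<Rightarrow> real) \<Rightarrow> ennreal" where
  "mellin s f \<equiv> \<integral>\<^sup>+y. ennreal (indicator {0..} y * (y powr (s - 1) * f y)) \<partial>lborel"

lemma mellin_exp:
  assumes s: "s > 0" and c: "c > 0"
  shows "mellin s (\<lambda>y. exp (- c * y)) = ennreal (Gamma s * c powr (- s))"
proof -
  have "ennreal (Gamma s) = \<bar>c\<bar> * (\<integral>\<^sup>+y. ennreal (indicator {0..} (0 + c * y) * (0 + c * y) powr (s - 1) / exp (0 + c * y)) \<partial>lborel)"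
    unfolding Gamma_conv_nn_integral_real[OF s] by (rule nn_integral_real_affine) (use c in auto)
  also have "(\<integral>\<^sup>+y. ennreal (indicator {0..} (0 + c * y) * (0 + c * y) powr (s - 1) / exp (0 + c * y)) \<partial>lborel)
      = (\<integral>\<^sup>+y. ennreal (c powr (s - 1)) * ennreal (indicator {0..} y * (y powr (s - 1) * exp (- c * y))) \<partial>lborel)"
    using c by (intro nn_integral_cong)
      (auto simp: indicator_def powr_mult exp_minus divide_inverse zero_le_mult_iff ennreal_mult[symmetric])
  also have "\<dots> = ennreal (c powr (s - 1)) * mellin s (\<lambda>y. exp (- c * y))"
    by (rule nn_integral_cmult) simp
  finally have "ennreal (c powr (- s)) * ennreal (Gamma s) = ennreal (c powr (- s)) * (\<bar>c\<bar> * (ennreal (c powr (s - 1)) * mellin s (\<lambda>y. exp (- c * y))))"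
    by simp
  also have "\<dots> = ennreal (c powr (- s) * c * c powr (s - 1)) * mellin s (\<lambda>y. exp (- c * y))"
    using c by (simp add: ennreal_mult mult.assoc)
  also have "c powr (- s) * c * c powr (s - 1) = 1"
    using c by (simp add: powr_minus powr_diff field_simps)
  finally show ?thesis using c s by (simp add: ennreal_mult[symmetric] mult.commute)
qed

lemma mellin_error_bound:
  assumes s: "0 < s" "s \<le> 1"
  shows "mellin s (\<lambda>y. if y \<le> 1 then 1 else 1 / y\<^sup>2) \<le> ennreal (1 / s + 1)"
proof -
  have "mellin s (\<lambda>y. if y \<le> 1 then 1 else 1 / y\<^sup>2)
      \<le> (\<integral>\<^sup>+y. (ennreal (indicator {0..1} y * y powr (s - 1)) + ennreal (indicator {1..} y * y powr (- 2))) \<partial>lborel)"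
  proof (rule nn_integral_mono)
    fix y :: real
    have "y powr (s - 1) * (1 / y\<^sup>2) \<le> 1 * y powr (- 2)" if "y > 1"
    proof -
      have "y powr (s - 1) \<le> y powr 0" using that s by (intro powr_mono) auto
      then have "y powr (s - 1) * (1 / y\<^sup>2) \<le> 1 * (1 / y\<^sup>2)" using that by (intro mult_right_mono) auto
      then show ?thesis using that by (simp add: powr_minus divide_inverse powr_numeral)
    qed
    then show "ennreal (indicator {0..} y * (y powr (s - 1) * (if y \<le> 1 then 1 else 1 / y\<^sup>2)))
        \<le> ennreal (indicator {0..1} y * y powr (s - 1)) + ennreal (indicator {1..} y * y powr (- 2))"
      by (cases "y \<le> 1") (auto simp: indicator_def intro!: ennreal_leI)
  qed
  also have "\<dots> = (\<integral>\<^sup>+y. ennreal (indicator {0..1} y * y powr (s - 1)) \<partial>lborel) + (\<integral>\<^sup>+y. ennreal (indicator {1..} y * y powr (- 2)) \<partial>lborel)"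
    by (rule nn_integral_add) auto
  also have "(\<integral>\<^sup>+y. ennreal (indicator {0..1} y * y powr (s - 1)) \<partial>lborel) = ennreal (1 / s)"
    using nn_integral_has_integral_lebesgue[OF _ has_integral_powr_from_0[of "s - 1" 1]] s by simp
  also have "(\<integral>\<^sup>+y. ennreal (indicator {1..} y * y powr (- 2)) \<partial>lborel) = ennreal 1"
    using nn_integral_has_integral_lebesgue[OF _ has_integral_powr_to_inf[of "- 2" 1]] by simp
  also have "ennreal (1 / s) + ennreal 1 = ennreal (1 / s + 1)" using s by (subst ennreal_plus) auto
  finally show ?thesis .
qed

text \<open>
  Termwise, the Mellin integral of \<open>exp (- m * y)\<close> is \<open>Gamma s * m powr (- s)\<close>, which lowers the integer
  exponent \<open>k\<close> of the series to the real exponent \<open>k - s\<close>.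
\<close>

lemma mellin_sum:
  assumes s: "s > 0" and h: "h > 0" and k: "k \<ge> 1"
  shows "summable (\<lambda>m. real m powr (real k - s) * exp (- h * real m))"
    and "mellin s (\<lambda>y. real_series k (h + y))
      = ennreal (Gamma s * (\<Sum>m. real m powr (real k - s) * exp (- h * real m)))"
proof -
  have le: "real m powr (real k - s) \<le> real m ^ k" for m
  proof (cases "m = 0")
    case False
    then have "real m powr (real k - s) \<le> real m powr real k" using s by (intro powr_mono) auto
    then show ?thesis using False by (simp add: powr_realpow)
  qed simp
  have "norm (real m powr (real k - s) * exp (- h * real m)) \<le> real m ^ k * exp (- h * real m)" for m
    using le by (simp add: mult_right_mono)
  then show sm: "summable (\<lambda>m. real m powr (real k - s) * exp (- h * real m))"
    by (rule summable_comparison_test'[OF summable_real_series[OF h], rotated])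
  let ?f = "\<lambda>m y. indicator {0..} y * (y powr (s - 1) * (real m ^ k * exp (- (h + y) * real m)))"
  have "mellin s (\<lambda>y. real_series k (h + y))
      = (\<integral>\<^sup>+y. (\<Sum>m. ennreal (?f m y)) \<partial>lborel)"
  proof (rule nn_integral_cong)
    fix y :: real
    show "ennreal (indicator {0..} y * (y powr (s - 1) * real_series k (h + y))) = (\<Sum>m. ennreal (?f m y))"
    proof (cases "y \<ge> 0")
      case True
      have sy: "summable (\<lambda>m. real m ^ k * exp (- (h + y) * real m))"
        by (rule summable_real_series) (use h True in simp)
      have "(\<Sum>m. ennreal (?f m y)) = ennreal (\<Sum>m. ?f m y)"
      proof (rule suminf_ennreal2)
        show "0 \<le> ?f m y" for m by (intro mult_nonneg_nonneg) auto
        show "summable (\<lambda>m. ?f m y)" by (intro summable_mult sy)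
      qed
      also have "(\<Sum>m. ?f m y) = indicator {0..} y * (y powr (s - 1) * real_series k (h + y))"
      proof -
        have "(\<Sum>m. ?f m y) = indicator {0..} y * (\<Sum>m. y powr (s - 1) * (real m ^ k * exp (- (h + y) * real m)))"
          by (rule suminf_mult[OF summable_mult[OF sy]])
        also have "(\<Sum>m. y powr (s - 1) * (real m ^ k * exp (- (h + y) * real m))) = y powr (s - 1) * real_series k (h + y)"
          unfolding real_series_def by (rule suminf_mult[OF sy])
        finally show ?thesis .
      qed
      finally show ?thesis ..
    qed simp
  qed
  also have "\<dots> = (\<Sum>m. (\<integral>\<^sup>+y. ennreal (?f m y) \<partial>lborel))"
    by (rule nn_integral_suminf) auto
  also have "\<dots> = (\<Sum>m. ennreal (Gamma s * (real m powr (real k - s) * exp (- h * real m))))"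
  proof (intro suminf_cong)
    fix m :: nat
    show "(\<integral>\<^sup>+y. ennreal (?f m y) \<partial>lborel) = ennreal (Gamma s * (real m powr (real k - s) * exp (- h * real m)))"
    proof (cases "m = 0")
      case True
      then show ?thesis using k by (cases k) auto
    next
      case False
      have "(\<integral>\<^sup>+y. ennreal (?f m y) \<partial>lborel)
         = (\<integral>\<^sup>+y. ennreal (real m ^ k * exp (- h * real m)) * ennreal (indicator {0..} y * (y powr (s - 1) * exp (- real m * y))) \<partial>lborel)"
        by (intro nn_integral_cong) (auto simp: ennreal_mult[symmetric] indicator_def exp_add[symmetric] algebra_simps exp_diff exp_minus divide_inverse)
      also have "\<dots> = ennreal (real m ^ k * exp (- h * real m)) * ennreal (Gamma s * real m powr (- s))"
        by (subst nn_integral_cmult) (use False s in \<open>auto simp: mellin_exp[OF s, of "real m", simplified]\<close>)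
      also have "\<dots> = ennreal (Gamma s * (real m powr (real k - s) * exp (- h * real m)))"
        using False s by (simp add: ennreal_mult[symmetric] powr_diff powr_minus powr_realpow divide_inverse mult_ac)
      finally show ?thesis .
    qed
  qed
  also have "\<dots> = ennreal (\<Sum>m. Gamma s * (real m powr (real k - s) * exp (- h * real m)))"
  proof (rule suminf_ennreal2)
    show "0 \<le> Gamma s * (real m powr (real k - s) * exp (- h * real m))" for m
      using s by (intro mult_nonneg_nonneg less_imp_le[OF Gamma_real_pos]) auto
    show "summable (\<lambda>m. Gamma s * (real m powr (real k - s) * exp (- h * real m)))"
      by (rule summable_mult[OF sm])
  qed
  also have "(\<Sum>m. Gamma s * (real m powr (real k - s) * exp (- h * real m))) = Gamma s * (\<Sum>m. real m powr (real k - s) * exp (- h * real m))"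
    by (rule suminf_mult[OF sm])
  finally show "mellin s (\<lambda>y. real_series k (h + y))
      = ennreal (Gamma s * (\<Sum>m. real m powr (real k - s) * exp (- h * real m)))" .
qed

text \<open>
  The same computation as for the series, with the sum over \<open>m\<close> replaced by an integral over \<open>u\<close>.
\<close>

lemma mellin_integral:
  assumes s: "s > 0" "s < real k + 1" and h: "h > 0"
  shows "mellin s (\<lambda>y. fact k / (h + y) ^ Suc k)
      = ennreal (Gamma s * (Gamma (real k + 1 - s) * h powr (- (real k + 1 - s))))"
proof -
  let ?g = "\<lambda>y u. indicator {0..} y * indicator {0..} u * (y powr (s - 1) * (u powr (real k) * exp (- (h + y) * u)))"
  have "mellin s (\<lambda>y. fact k / (h + y) ^ Suc k)
      = (\<integral>\<^sup>+y. (\<integral>\<^sup>+u. ennreal (?g y u) \<partial>lborel) \<partial>lborel)"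
  proof (rule nn_integral_cong)
    fix y :: real
    show "ennreal (indicator {0..} y * (y powr (s - 1) * (fact k / (h + y) ^ Suc k))) = (\<integral>\<^sup>+u. ennreal (?g y u) \<partial>lborel)"
    proof (cases "y \<ge> 0")
      case True
      have "(\<integral>\<^sup>+u. ennreal (?g y u) \<partial>lborel)
          = (\<integral>\<^sup>+u. ennreal (y powr (s - 1)) * ennreal (indicator {0..} u * (u powr ((real k + 1) - 1) * exp (- (h + y) * u))) \<partial>lborel)"
        using True by (intro nn_integral_cong) (auto simp: indicator_def ennreal_mult[symmetric])
      also have "\<dots> = ennreal (y powr (s - 1)) * mellin (real k + 1) (\<lambda>u. exp (- (h + y) * u))"
        by (rule nn_integral_cmult) simp
      also have "mellin (real k + 1) (\<lambda>u. exp (- (h + y) * u))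
          = ennreal (Gamma (real k + 1) * (h + y) powr (- (real k + 1)))"
        by (rule mellin_exp) (use True h in auto)
      also have "Gamma (real k + 1) * (h + y) powr (- (real k + 1)) = fact k / (h + y) ^ Suc k"
      proof -
        have "(h + y) powr (real k + 1) = (h + y) ^ Suc k"
          using True h powr_realpow[of "h + y" "Suc k"] by (simp add: add.commute)
        then show ?thesis unfolding powr_minus using Gamma_fact[of k, where ?'a = real] by (simp add: divide_inverse add.commute)
      qed
      finally show ?thesis using True h by (simp add: ennreal_mult[symmetric])
    qed simp
  qed
  also have "\<dots> = (\<integral>\<^sup>+u. (\<integral>\<^sup>+y. ennreal (?g y u) \<partial>lborel) \<partial>lborel)"
    by (rule lborel_pair.Fubini') simp
  also have "\<dots> = (\<integral>\<^sup>+u. ennreal (Gamma s) * ennreal (indicator {0..} u * (u powr ((real k + 1 - s) - 1) * exp (- h * u))) \<partial>lborel)"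
  proof (rule nn_integral_cong_AE)
    have "AE u in lborel. u \<noteq> (0::real)" by (rule AE_lborel_singleton)
    then show "AE u in lborel. (\<integral>\<^sup>+y. ennreal (?g y u) \<partial>lborel)
        = ennreal (Gamma s) * ennreal (indicator {0..} u * (u powr ((real k + 1 - s) - 1) * exp (- h * u)))"
    proof eventually_elim
      fix u :: real assume "u \<noteq> 0"
      show "(\<integral>\<^sup>+y. ennreal (?g y u) \<partial>lborel)
        = ennreal (Gamma s) * ennreal (indicator {0..} u * (u powr ((real k + 1 - s) - 1) * exp (- h * u)))"
      proof (cases "u > 0")
        case True
        have "(\<integral>\<^sup>+y. ennreal (?g y u) \<partial>lborel)
            = (\<integral>\<^sup>+y. ennreal (u powr real k * exp (- h * u)) * ennreal (indicator {0..} y * (y powr (s - 1) * exp (- u * y))) \<partial>lborel)"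
          using True by (intro nn_integral_cong) (auto simp: indicator_def ennreal_mult[symmetric] algebra_simps exp_diff exp_minus divide_inverse exp_add)
        also have "\<dots> = ennreal (u powr real k * exp (- h * u)) * ennreal (Gamma s * u powr (- s))"
          by (subst nn_integral_cmult) (use True s in \<open>auto simp: mellin_exp[OF s(1) True, simplified]\<close>)
        also have "\<dots> = ennreal (Gamma s) * ennreal (indicator {0..} u * (u powr ((real k + 1 - s) - 1) * exp (- h * u)))"
          using True s by (simp add: ennreal_mult[symmetric] powr_diff powr_minus divide_inverse mult_ac)
        finally show ?thesis .
      next
        case False
        then show ?thesis using \<open>u \<noteq> 0\<close> by simp
      qed
    qed
  qed
  also have "\<dots> = ennreal (Gamma s) * mellin (real k + 1 - s) (\<lambda>u. exp (- h * u))"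
    by (rule nn_integral_cmult) simp
  also have "mellin (real k + 1 - s) (\<lambda>u. exp (- h * u))
      = ennreal (Gamma (real k + 1 - s) * h powr (- (real k + 1 - s)))"
    by (rule mellin_exp) (use s h in auto)
  finally show ?thesis using s by (simp add: ennreal_mult)
qed

text \<open>
  Writing \<open>\<gamma> = k - s\<close> with an integer \<open>k\<close> and \<open>0 < s \<le> 1\<close>, the series and its main term are the Mellin
  integrals of \<open>real_series k\<close> and \<open>fact k / z ^ Suc k\<close>, so their distance is the Mellin integral of
  the error in \<open>real_series_approx\<close>, which is bounded uniformly in \<open>h\<close>.
\<close>

theorem power_exp_series_approx:
  assumes g: "\<gamma> > 0"
  shows "\<exists>B. \<forall>h>0. summable (\<lambda>m. real m powr \<gamma> * exp (- h * real m)) \<and>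
    \<bar>(\<Sum>m. real m powr \<gamma> * exp (- h * real m)) - Gamma (1 + \<gamma>) * h powr (- (1 + \<gamma>))\<bar> \<le> B"
proof -
  \<comment> \<open>The smallest integer above \<open>\<gamma>\<close>; then \<open>k \<ge> 1\<close>, as \<open>real_series_approx\<close> requires.\<close>
  define k where "k = nat (\<lfloor>\<gamma>\<rfloor> + 1)"
  define s where "s = real k - \<gamma>"
  have kr: "real k = of_int (\<lfloor>\<gamma>\<rfloor> + 1)" unfolding k_def using g by (subst of_nat_nat) auto
  have "\<lfloor>\<gamma>\<rfloor> \<ge> 0" using g by simp
  then have k: "k \<ge> 1" unfolding k_def by linarith
  have s: "0 < s" "s \<le> 1" unfolding s_def kr by linarith+
  have ks: "real k - s = \<gamma>" "real k + 1 - s = 1 + \<gamma>" by (simp_all add: s_def)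
  have Gs: "Gamma s > 0" using s by simp
  obtain B where B: "B > 0" "\<And>z. z > 0 \<Longrightarrow> \<bar>real_series k z - fact k / z ^ Suc k\<bar> \<le> B"
    "\<And>z. z \<ge> 1 \<Longrightarrow> \<bar>real_series k z - fact k / z ^ Suc k\<bar> \<le> B / z\<^sup>2"
    using real_series_approx[OF k] by metis
  have "summable (\<lambda>m. real m powr \<gamma> * exp (- h * real m)) \<and>
    \<bar>(\<Sum>m. real m powr \<gamma> * exp (- h * real m)) - Gamma (1 + \<gamma>) * h powr (- (1 + \<gamma>))\<bar> \<le> B * (1 / s + 1) / Gamma s"
    if h: "h > 0" for h
  proof
    let ?S = "\<Sum>m. real m powr \<gamma> * exp (- h * real m)" and ?I = "Gamma (1 + \<gamma>) * h powr (- (1 + \<gamma>))"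
    let ?a = "\<lambda>y. indicator {0..} y * (y powr (s - 1) * real_series k (h + y))"
    let ?b = "\<lambda>y. indicator {0..} y * (y powr (s - 1) * (fact k / (h + y) ^ Suc k))"
    let ?e = "\<lambda>y::real. indicator {0..} y * (y powr (s - 1) * (if y \<le> 1 then 1 else 1 / y\<^sup>2))"
    show sm: "summable (\<lambda>m. real m powr \<gamma> * exp (- h * real m))"
      using mellin_sum(1)[OF s(1) h k] unfolding ks .
    have A: "(\<integral>\<^sup>+y. ennreal (?a y) \<partial>lborel) = ennreal (Gamma s * ?S)"
      using mellin_sum(2)[OF s(1) h k] unfolding ks .
    have Bq: "(\<integral>\<^sup>+y. ennreal (?b y) \<partial>lborel) = ennreal (Gamma s * ?I)"
    proof -
      have sk: "s < real k + 1" using s k by simp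
      show ?thesis using mellin_integral[OF s(1) sk h] unfolding ks .
    qed
    have S0: "?S \<ge> 0" by (rule suminf_nonneg[OF sm]) auto
    have I0: "?I \<ge> 0" using g by simp
    have E: "(\<integral>\<^sup>+y. ennreal (B * ?e y) \<partial>lborel) \<le> ennreal (B * (1 / s + 1))"
    proof -
      have "(\<integral>\<^sup>+y. ennreal (B * ?e y) \<partial>lborel) = (\<integral>\<^sup>+y. ennreal B * ennreal (?e y) \<partial>lborel)"
        using B(1) by (intro nn_integral_cong) (auto simp: ennreal_mult indicator_def)
      also have "\<dots> = ennreal B * (\<integral>\<^sup>+y. ennreal (?e y) \<partial>lborel)" by (rule nn_integral_cmult) simp
      also have "\<dots> \<le> ennreal B * ennreal (1 / s + 1)" by (rule mult_left_mono[OF mellin_error_bound[OF s]]) simp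
      also have "\<dots> = ennreal (B * (1 / s + 1))" using B(1) s by (subst ennreal_mult) auto
      finally show ?thesis .
    qed
    have ae: "\<bar>?a y - ?b y\<bar> \<le> B * ?e y" for y
    proof (cases "y \<ge> 0")
      case True
      have "\<bar>real_series k (h + y) - fact k / (h + y) ^ Suc k\<bar> \<le> B * (if y \<le> 1 then 1 else 1 / y\<^sup>2)"
      proof (cases "y \<le> 1")
        case True then show ?thesis using B(2)[of "h + y"] h \<open>y \<ge> 0\<close> by simp
      next
        case False
        have "B / (h + y)\<^sup>2 \<le> B / y\<^sup>2" using False h B(1) by (intro divide_left_mono power_mono) auto
        then show ?thesis using B(3)[of "h + y"] h False by simp
      qed
      then have "y powr (s - 1) * \<bar>real_series k (h + y) - fact k / (h + y) ^ Suc k\<bar> \<le> y powr (s - 1) * (B * (if y \<le> 1 then 1 else 1 / y\<^sup>2))"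
        by (intro mult_left_mono) auto
      moreover have "\<bar>?a y - ?b y\<bar> = y powr (s - 1) * \<bar>real_series k (h + y) - fact k / (h + y) ^ Suc k\<bar>"
      proof -
        have "?a y - ?b y = y powr (s - 1) * (real_series k (h + y) - fact k / (h + y) ^ Suc k)"
          using True by (simp add: right_diff_distrib)
        then show ?thesis by (simp only: abs_mult abs_of_nonneg powr_ge_zero)
      qed
      moreover have "y powr (s - 1) * (B * (if y \<le> 1 then 1 else 1 / y\<^sup>2)) = B * ?e y" using True by simp
      ultimately show ?thesis by simp
    qed simp
    have b0: "?b y \<ge> 0" and e0: "B * ?e y \<ge> 0" for y
      using h B(1) by (auto simp: indicator_def intro!: divide_nonneg_nonneg)
    have a0: "?a y \<ge> 0" for y
    proof (cases "y \<ge> 0")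
      case True
      then show ?thesis using h real_series_nonneg[of "h + y" k] by simp
    qed simp
    have bm: "(\<lambda>y. ennreal (?b y)) \<in> borel_measurable lborel" and em: "(\<lambda>y. ennreal (B * ?e y)) \<in> borel_measurable lborel"
      by measurable
    have am: "(\<lambda>y. ennreal (?a y)) \<in> borel_measurable lborel"
      unfolding real_series_def by measurable
    have "ennreal (Gamma s * ?S) \<le> (\<integral>\<^sup>+y. (ennreal (?b y) + ennreal (B * ?e y)) \<partial>lborel)"
      unfolding A[symmetric]
    proof (rule nn_integral_mono)
      show "ennreal (?a y) \<le> ennreal (?b y) + ennreal (B * ?e y)" for y
        unfolding ennreal_plus[OF b0 e0, symmetric] using ae[of y] by (intro ennreal_leI) linarith
    qed
    also have "\<dots> = ennreal (Gamma s * ?I) + (\<integral>\<^sup>+y. ennreal (B * ?e y) \<partial>lborel)"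
      unfolding Bq[symmetric] by (rule nn_integral_add[OF bm em])
    also have "\<dots> \<le> ennreal (Gamma s * ?I) + ennreal (B * (1 / s + 1))" by (intro add_left_mono E)
    also have "\<dots> = ennreal (Gamma s * ?I + B * (1 / s + 1))" using Gs I0 B(1) s by (subst ennreal_plus) auto
    finally have 1: "Gamma s * ?S \<le> Gamma s * ?I + B * (1 / s + 1)"
      using Gs I0 B(1) s by (subst (asm) ennreal_le_iff) (auto intro!: add_nonneg_nonneg mult_nonneg_nonneg)
    have "ennreal (Gamma s * ?I) + 0 \<le> (\<integral>\<^sup>+y. ennreal (?a y) \<partial>lborel) + (\<integral>\<^sup>+y. ennreal (B * ?e y) \<partial>lborel)"
      unfolding Bq[symmetric] add_0_right nn_integral_add[OF am em, symmetric]
    proof (rule nn_integral_mono)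
      show "ennreal (?b y) \<le> ennreal (?a y) + ennreal (B * ?e y)" for y
        unfolding ennreal_plus[OF a0 e0, symmetric] using ae[of y] by (intro ennreal_leI) linarith
    qed
    also have "\<dots> \<le> ennreal (Gamma s * ?S) + ennreal (B * (1 / s + 1))" unfolding A by (intro add_left_mono E)
    also have "\<dots> = ennreal (Gamma s * ?S + B * (1 / s + 1))" using Gs S0 B(1) s by (subst ennreal_plus) auto
    finally have "ennreal (Gamma s * ?I) \<le> ennreal (Gamma s * ?S + B * (1 / s + 1))" by simp
    then have 2: "Gamma s * ?I \<le> Gamma s * ?S + B * (1 / s + 1)"
      using Gs S0 B(1) s by (subst (asm) ennreal_le_iff) (auto intro!: add_nonneg_nonneg mult_nonneg_nonneg)
    have "\<bar>Gamma s * (?S - ?I)\<bar> \<le> B * (1 / s + 1)"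
      using 1 2 unfolding right_diff_distrib by linarith
    then show "\<bar>?S - ?I\<bar> \<le> B * (1 / s + 1) / Gamma s"
      using Gs by (simp add: abs_mult pos_le_divide_eq mult.commute)
  qed
  then show ?thesis by blast
qed

section \<open>Elementary estimates for sums and cosines\<close>

lemma powr_le_exp:
  fixes p t :: real
  assumes "p > 0" "t \<ge> 0"
  shows "t powr p \<le> p powr p * exp t"
proof (cases "t = 0")
  case False
  then have t: "t > 0" using assms by simp
  have "t / p \<le> exp (t / p)" using exp_ge_add_one_self[of "t / p"] by linarith
  then have "(t / p) powr p \<le> exp (t / p) powr p" using assms t by (intro powr_mono2) auto
  also have "\<dots> = exp t" using assms by (simp add: powr_def)
  finally show ?thesis using assms t by (simp add: powr_divide field_simps)
qed (use assms in simp)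

lemma sum_exp_le:
  assumes "c > 0"
  shows "(\<Sum>m=1..n. exp (- c * real m)) \<le> 1 / c"
proof -
  have "(\<Sum>m=1..n. exp (- c * real m)) \<le> (1 - exp (- c * real n)) / c"
  proof (induction n)
    case (Suc n)
    have "c * exp (- c * real (Suc n)) \<le> (exp c - 1) * exp (- c * real (Suc n))"
    proof (rule mult_right_mono)
      show "c \<le> exp c - 1" using exp_ge_add_one_self[of c] by linarith
    qed simp
    also have "\<dots> = exp (- c * real n) - exp (- c * real (Suc n))"
      by (simp add: left_diff_distrib exp_add[symmetric] algebra_simps)
    finally have "exp (- c * real (Suc n)) \<le> (exp (- c * real n) - exp (- c * real (Suc n))) / c"
      using assms by (simp add: pos_le_divide_eq mult.commute)
    then show ?case using Suc by (simp add: diff_divide_distrib)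
  qed simp
  also have "\<dots> \<le> 1 / c" using assms by (intro divide_right_mono) auto
  finally show ?thesis .
qed

text \<open>
  Half of the exponential absorbs the power, the other half is summed by comparison with a telescoping sum.
\<close>

lemma sum_powr_exp_le:
  assumes p: "p > 0" and x: "x > 0"
  shows "(\<Sum>m=1..n. real m powr p * exp (- real m / x)) \<le> 2 * (2 * p) powr p * x powr (p + 1)"
proof -
  have "(\<Sum>m=1..n. real m powr p * exp (- real m / x))
      \<le> (\<Sum>m=1..n. (2 * p) powr p * x powr p * exp (- (1 / (2 * x)) * real m))"
  proof (rule sum_mono)
    fix m :: nat
    let ?t = "real m / (2 * x)"
    have "?t powr p \<le> p powr p * exp ?t" by (rule powr_le_exp[OF p]) (use x in auto)
    then have "(2 * x) powr p * ?t powr p \<le> (2 * x) powr p * (p powr p * exp ?t)" by (rule mult_left_mono) simp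
    also have "(2 * x) powr p * ?t powr p = real m powr p"
      using x by (subst powr_mult[symmetric]) auto
    also have "(2 * x) powr p * (p powr p * exp ?t) = (2 * p) powr p * x powr p * exp ?t"
      using x p by (simp add: powr_mult)
    finally have "real m powr p * exp (- real m / x) \<le> (2 * p) powr p * x powr p * exp ?t * exp (- real m / x)"
      by (rule mult_right_mono) simp
    also have "\<dots> = (2 * p) powr p * x powr p * (exp ?t * exp (- real m / x))" by simp
    also have "exp ?t * exp (- real m / x) = exp (- (1 / (2 * x)) * real m)"
      unfolding exp_add[symmetric] using x by (intro arg_cong[where f = exp]) (simp add: field_simps)
    finally show "real m powr p * exp (- real m / x) \<le> (2 * p) powr p * x powr p * exp (- (1 / (2 * x)) * real m)" .
  qed
  also have "\<dots> = (2 * p) powr p * x powr p * (\<Sum>m=1..n. exp (- (1 / (2 * x)) * real m))"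
    by (rule sum_distrib_left[symmetric])
  also have "\<dots> \<le> (2 * p) powr p * x powr p * (1 / (1 / (2 * x)))"
    by (intro mult_left_mono sum_exp_le) (use x in auto)
  also have "\<dots> = 2 * (2 * p) powr p * x powr (p + 1)" using x by (simp add: powr_add)
  finally show ?thesis .
qed

text \<open>
  Since \<open>2 * (1 - cos a)\<close> is the squared distance of \<open>cis a\<close> from one, this is the triangle inequality
  for the points \<open>cis a\<close>, \<open>1\<close>, \<open>cis c\<close> together with \<open>(X + Y)\<^sup>2 \<le> 2 * (X\<^sup>2 + Y\<^sup>2)\<close>.
\<close>

lemma one_minus_cos_diff_le: "1 - cos (c - a) \<le> 2 * ((1 - cos a) + (1 - cos (c::real)))"
proof -
  let ?X = "1 - cos a" and ?Y = "1 - cos c"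
  have "0 \<le> (sin a + sin c)\<^sup>2 + (?X + ?Y)\<^sup>2" by simp
  also have "\<dots> = (sin a)\<^sup>2 + (cos a)\<^sup>2 + ((sin c)\<^sup>2 + (cos c)\<^sup>2) + 2 * (sin a * sin c) + 4 - 4 * cos a - 4 * cos c + 2 * (cos a * cos c)"
    by algebra
  also have "\<dots> = 2 * (2 * (?X + ?Y) - (1 - cos (c - a)))"
    using sin_cos_squared_add[of a] sin_cos_squared_add[of c] by (simp add: cos_diff)
  finally show ?thesis by simp
qed

lemma one_minus_cos_ge:
  fixes t :: real
  shows "\<bar>t\<bar> \<le> 1 \<Longrightarrow> t\<^sup>2 / 3 \<le> 1 - cos t" and "1 \<le> t \<Longrightarrow> t \<le> pi \<Longrightarrow> 1 / 3 \<le> 1 - cos t"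
proof -
  show *: "t\<^sup>2 / 3 \<le> 1 - cos t" if "\<bar>t\<bar> \<le> 1" for t :: real
  proof -
    have "Re (cis t - 1 - \<i> * t + of_real (t\<^sup>2 / 2)) \<le> \<bar>t\<bar> ^ 3 / 6"
      by (rule order.trans[OF complex_Re_le_cmod cis_taylor2])
    then have "cos t - 1 + t\<^sup>2 / 2 \<le> \<bar>t\<bar> ^ 3 / 6" by simp
    moreover have "\<bar>t\<bar> ^ 3 \<le> t\<^sup>2"
    proof -
      have "\<bar>t\<bar> * t\<^sup>2 \<le> 1 * t\<^sup>2" using that by (intro mult_right_mono) auto
      then show ?thesis by (simp add: power3_eq_cube power2_eq_square abs_mult[symmetric] mult.assoc)
    qed
    ultimately show ?thesis by linarith
  qed
  assume "1 \<le> t" "t \<le> pi"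
  then have "cos t \<le> cos 1" by (intro cos_monotone_0_pi_le) auto
  then show "1 / 3 \<le> 1 - cos t" using *[of 1] by simp
qed

text \<open>
  If \<open>1 - cos (v * m)\<close> were small for most \<open>m\<close> in the window, then by \<open>one_minus_cos_diff_le\<close>,
  applied to the pairs \<open>m\<close> and \<open>m + j\<close>, also \<open>1 - cos (v * j)\<close> would be small for every \<open>j \<le> M div 2\<close>. But
  one of these \<open>j\<close> puts \<open>\<bar>v\<bar> * j\<close> between \<open>1\<close> and \<open>pi\<close>, unless \<open>\<bar>v\<bar>\<close> is so small that
  the largest \<open>j\<close> gives the quadratic bound.
\<close>

lemma window_cos_sum_ge:
  assumes M: "M \<ge> 2" and v: "\<bar>v\<bar> \<le> pi"
  shows "real M / 24 * min 1 ((v * real (M div 2))\<^sup>2) \<le> (\<Sum>m\<in>{M<..2*M}. 1 - cos (v * real m))"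
proof -
  let ?S = "\<Sum>m\<in>{M<..2*M}. 1 - cos (v * real m)" and ?J = "M div 2"
  have shift: "real M / 8 * (1 - cos (v * real j)) \<le> ?S" if j: "1 \<le> j" "j \<le> ?J" for j
  proof -
    have "real M / 2 * (1 - cos (v * real j)) \<le> real (M - j) * (1 - cos (v * real j))"
      using j by (intro mult_right_mono) auto
    also have "\<dots> = (\<Sum>m\<in>{M<..2*M-j}. 1 - cos (v * real j))" using j by simp
    also have "\<dots> \<le> (\<Sum>m\<in>{M<..2*M-j}. 2 * ((1 - cos (v * real m)) + (1 - cos (v * real (m + j)))))"
    proof (rule sum_mono)
      fix m
      show "1 - cos (v * real j) \<le> 2 * ((1 - cos (v * real m)) + (1 - cos (v * real (m + j))))"
        using one_minus_cos_diff_le[of "v * real (m + j)" "v * real m"] by (simp add: algebra_simps)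
    qed
    also have "\<dots> = 2 * ((\<Sum>m\<in>{M<..2*M-j}. 1 - cos (v * real m)) + (\<Sum>m\<in>{M<..2*M-j}. 1 - cos (v * real (m + j))))"
      unfolding sum.distrib[symmetric] sum_distrib_left ..
    also have "(\<Sum>m\<in>{M<..2*M-j}. 1 - cos (v * real m)) \<le> ?S"
      by (rule sum_mono2) auto
    also have "(\<Sum>m\<in>{M<..2*M-j}. 1 - cos (v * real (m + j))) \<le> ?S"
    proof -
      have "(\<Sum>m\<in>{M<..2*M-j}. 1 - cos (v * real (m + j))) = (\<Sum>m\<in>(\<lambda>m. m + j) ` {M<..2*M-j}. 1 - cos (v * real m))"
        by (subst sum.reindex) (auto simp: inj_on_def)
      also have "\<dots> \<le> ?S" by (rule sum_mono2) (use j in auto)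
      finally show ?thesis .
    qed
    finally show ?thesis by simp
  qed
  have J1: "?J \<ge> 1" using M by simp
  show ?thesis
  proof (cases "\<bar>v * real ?J\<bar> \<le> 1")
    case True
    have "real M / 24 * min 1 ((v * real ?J)\<^sup>2) \<le> real M / 8 * ((v * real ?J)\<^sup>2 / 3)"
      by (simp add: mult_left_mono)
    also have "\<dots> \<le> real M / 8 * (1 - cos (v * real ?J))"
      by (intro mult_left_mono one_minus_cos_ge True) auto
    also have "\<dots> \<le> ?S" by (rule shift[OF J1]) simp
    finally show ?thesis .
  next
    case False
    \<comment> \<open>For \<open>\<bar>v\<bar> < 1\<close> the first multiple of \<open>\<bar>v\<bar>\<close> that reaches \<open>1\<close> is still below \<open>2\<close>.\<close>
    obtain j where j: "1 \<le> j" "j \<le> ?J" "1 \<le> \<bar>v\<bar> * real j" "\<bar>v\<bar> * real j \<le> pi"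
    proof (cases "\<bar>v\<bar> \<ge> 1")
      case True
      then show ?thesis using that[of 1] J1 v by simp
    next
      case v1: False
      have v0: "\<bar>v\<bar> > 0" using False by auto
      let ?j = "nat \<lceil>1 / \<bar>v\<bar>\<rceil>"
      have "0 \<le> \<lceil>1 / \<bar>v\<bar>\<rceil>" using v0 by (simp add: le_ceiling_iff) (smt (verit) divide_pos_pos)
      then have "real ?j = of_int \<lceil>1 / \<bar>v\<bar>\<rceil>" by simp
      then have c: "1 / \<bar>v\<bar> \<le> real ?j" "real ?j < 1 / \<bar>v\<bar> + 1" using ceiling_correct[of "1 / \<bar>v\<bar>"] by linarith+
      have "1 / \<bar>v\<bar> < real ?J" using False v0 by (simp add: abs_mult pos_divide_less_eq mult.commute)
      then have 2: "?j \<le> ?J" using v0 by (simp add: ceiling_le_iff nat_le_iff)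
      have 3: "1 \<le> \<bar>v\<bar> * real ?j"
      proof -
        have "\<bar>v\<bar> * (1 / \<bar>v\<bar>) \<le> \<bar>v\<bar> * real ?j" using c(1) by (rule mult_left_mono) simp
        moreover have "\<bar>v\<bar> * (1 / \<bar>v\<bar>) = 1" using v0 by simp
        ultimately show ?thesis by (simp only:)
      qed
      have "\<bar>v\<bar> * real ?j \<le> \<bar>v\<bar> * (1 / \<bar>v\<bar> + 1)" using c(2) v0 by (intro mult_left_mono) auto
      also have "\<dots> = 1 + \<bar>v\<bar>" using v0 by (simp add: distrib_left)
      also have "\<dots> \<le> pi" using v1 pi_gt3 by linarith
      finally have 4: "\<bar>v\<bar> * real ?j \<le> pi" .
      have 1: "1 \<le> ?j" using 3 by (cases "?j") auto
      show ?thesis by (rule that[OF 1 2 3 4])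
    qed
    have "cos (v * real j) = cos (\<bar>v\<bar> * real j)" by (metis abs_mult abs_of_nat cos_abs_real)
    then have "1 / 3 \<le> 1 - cos (v * real j)" using one_minus_cos_ge(2)[OF j(3,4)] by simp
    then have "real M / 8 * (1 / 3) \<le> real M / 8 * (1 - cos (v * real j))" by (intro mult_left_mono) auto
    also have "\<dots> \<le> ?S" by (rule shift[OF j(1,2)])
    finally have "real M / 24 \<le> ?S" by simp
    moreover have "real M / 24 * min 1 ((v * real ?J)\<^sup>2) \<le> real M / 24 * 1" by (intro mult_left_mono) auto
    ultimately show ?thesis by linarith
  qed
qed

lemma exp_neg_le_cubic:
  fixes c s :: real
  assumes c: "c > 0" and s: "s \<ge> 0"
  shows "exp (- c * s) \<le> (1 + 3 / c) ^ 3 / (1 + s) ^ 3"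
proof -
  let ?A = "1 + 3 / c"
  have "1 + s \<le> ?A * (1 + c * s / 3)" using c s by (simp add: field_simps)
  also have "\<dots> \<le> ?A * exp (c * s / 3)" using c by (intro mult_left_mono) (auto simp: exp_ge_add_one_self add.commute)
  finally have "(1 + s) ^ 3 \<le> (?A * exp (c * s / 3)) ^ 3" using s by (intro power_mono) auto
  also have "\<dots> = ?A ^ 3 * exp (c * s)" by (simp add: power_mult_distrib exp_of_nat_mult[symmetric])
  finally have "(1 + s) ^ 3 * exp (- c * s) \<le> ?A ^ 3 * exp (c * s) * exp (- c * s)" by (rule mult_right_mono) simp
  also have "\<dots> = ?A ^ 3" by (simp add: mult.assoc exp_add[symmetric])
  finally show ?thesis using s by (simp add: pos_le_divide_eq mult.commute)
qed

text \<open>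
  For \<open>\<bar>x * v\<bar> \<le> 1\<close> the left-hand side is a Gaussian in \<open>x powr (1 + \<gamma> / 2) * v\<close>. For larger \<open>v\<close> it is
  exponentially small in \<open>x powr \<gamma>\<close>, which beats the polynomial growth in \<open>x\<close> of the denominator.
\<close>

lemma decay_le_cubic:
  assumes g: "\<gamma> > 0" and c: "c > 0"
  shows "\<exists>K>0. \<forall>x v. x \<ge> 1 \<longrightarrow> \<bar>v\<bar> \<le> pi \<longrightarrow>
    exp (- c * (x powr \<gamma> * min 1 ((x * v)\<^sup>2))) \<le> K / (1 + (x powr (1 + \<gamma> / 2) * v)\<^sup>2) ^ 3"
proof -
  \<comment> \<open>The exponent for which \<open>(x powr \<gamma>) powr q\<close> equals \<open>(x powr (2 + \<gamma>)) ^ 3\<close>.\<close>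
  define q where "q = 3 * (2 + \<gamma>) / \<gamma>"
  have q: "q > 0" using g by (simp add: q_def)
  define K1 where "K1 = (1 + 3 / c) ^ 3"
  define K2 where "K2 = (1 + pi\<^sup>2) ^ 3 * ((q / c) powr q)"
  have K1: "K1 > 0" unfolding K1_def using c by (intro zero_less_power add_pos_pos) auto
  have K2: "K2 > 0" unfolding K2_def using q c by (intro mult_pos_pos zero_less_power) (auto intro: add_pos_nonneg)
  have lam2: "(x powr (1 + \<gamma> / 2))\<^sup>2 = x powr (2 + \<gamma>)" if "x \<ge> 1" for x :: real
    using that by (simp add: powr_power)
  show ?thesis
  proof (intro exI[of _ "K1 + K2"] conjI allI impI)
    show "K1 + K2 > 0" using K1 K2 by simp
    fix x v :: real assume x: "x \<ge> 1" and v: "\<bar>v\<bar> \<le> pi"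
    let ?y2 = "(x powr (1 + \<gamma> / 2) * v)\<^sup>2"
    have y2: "?y2 = x powr (2 + \<gamma>) * v\<^sup>2" using lam2[OF x] by (simp add: power_mult_distrib)
    have pos: "(1 + ?y2) ^ 3 > 0" by (intro zero_less_power add_pos_nonneg) auto
    show "exp (- c * (x powr \<gamma> * min 1 ((x * v)\<^sup>2))) \<le> (K1 + K2) / (1 + ?y2) ^ 3"
    proof (cases "(x * v)\<^sup>2 \<le> 1")
      case True
      have "x powr \<gamma> * min 1 ((x * v)\<^sup>2) = x powr \<gamma> * x powr 2 * v\<^sup>2"
        using True x by (simp add: min_absorb2 power_mult_distrib powr_numeral)
      also have "\<dots> = ?y2" unfolding y2 powr_add[symmetric] by (simp add: add.commute)
      finally have "exp (- c * (x powr \<gamma> * min 1 ((x * v)\<^sup>2))) \<le> K1 / (1 + ?y2) ^ 3"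
        unfolding K1_def using exp_neg_le_cubic[OF c, of ?y2] by simp
      also have "\<dots> \<le> (K1 + K2) / (1 + ?y2) ^ 3" using K2 pos by (intro divide_right_mono) auto
      finally show ?thesis .
    next
      case False
      let ?s = "x powr \<gamma>"
      have xg: "x powr (2 + \<gamma>) \<ge> 1" using x g by (intro ge_one_powr_ge_zero) auto
      have "v\<^sup>2 \<le> pi\<^sup>2" using v by (simp add: abs_le_square_iff[symmetric])
      then have "?y2 \<le> x powr (2 + \<gamma>) * pi\<^sup>2" unfolding y2 by (rule mult_left_mono) simp
      then have "1 + ?y2 \<le> x powr (2 + \<gamma>) * (1 + pi\<^sup>2)" using xg by (simp add: distrib_left)
      then have "(1 + ?y2) ^ 3 \<le> (x powr (2 + \<gamma>) * (1 + pi\<^sup>2)) ^ 3" by (intro power_mono) auto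
      also have "\<dots> = (1 + pi\<^sup>2) ^ 3 * ?s powr q"
      proof -
        have "(x powr (2 + \<gamma>)) ^ 3 = ?s powr q" using x g by (simp add: powr_power powr_powr q_def)
        then show ?thesis by (simp add: power_mult_distrib)
      qed
      also have "?s powr q \<le> (q / c) powr q * exp (c * ?s)"
      proof -
        have "(c * ?s) powr q \<le> q powr q * exp (c * ?s)" by (rule powr_le_exp[OF q]) (use c in auto)
        then show ?thesis using c q by (simp add: powr_mult powr_divide field_simps)
      qed
      finally have "(1 + ?y2) ^ 3 \<le> K2 * exp (c * ?s)" unfolding K2_def by (simp add: mult.assoc mult_left_mono)
      then have "(1 + ?y2) ^ 3 * exp (- c * ?s) \<le> K2 * exp (c * ?s) * exp (- c * ?s)" by (rule mult_right_mono) simp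
      also have "\<dots> = K2" by (simp add: mult.assoc exp_add[symmetric])
      finally have "exp (- c * ?s) \<le> K2 / (1 + ?y2) ^ 3" using pos by (simp add: pos_le_divide_eq mult.commute)
      also have "\<dots> \<le> (K1 + K2) / (1 + ?y2) ^ 3" using K1 pos by (intro divide_right_mono) auto
      finally show ?thesis using False by (simp add: min_absorb1)
    qed
  qed
qed

section \<open>The weights satisfy the saddle point conditions\<close>

text \<open>
  These are the Poisson means \<open>rate \<gamma> n\<close> with \<open>1 / eta \<gamma> n\<close> replaced by a free real parameter \<open>x\<close>,
  in which all estimates are uniform.
\<close>

definition weight :: "real \<Rightarrow> real \<Rightarrow> nat \<Rightarrow> real" where
  "weight \<gamma> x m = real m powr (\<gamma> - 1) * exp (- real m / x)"

lemma power_mult_weight: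
  "m \<ge> 1 \<Longrightarrow> real m ^ Suc j * weight \<gamma> x m = real m powr (\<gamma> + real j) * exp (- real m / x)"
  by (simp add: weight_def powr_diff powr_add powr_realpow field_simps)

lemma weight_pos: "m \<ge> 1 \<Longrightarrow> weight \<gamma> x m > 0"
  by (simp add: weight_def)

lemma sum_power_weight_le:
  assumes "\<gamma> > 0" "x > 0"
  shows "(\<Sum>m=1..n. real m ^ Suc j * weight \<gamma> x m) \<le> 2 * (2 * (\<gamma> + real j)) powr (\<gamma> + real j) * x powr (\<gamma> + real j + 1)"
proof -
  have "(\<Sum>m=1..n. real m ^ Suc j * weight \<gamma> x m) = (\<Sum>m=1..n. real m powr (\<gamma> + real j) * exp (- real m / x))"
    by (intro sum.cong refl power_mult_weight) auto
  then show ?thesis using sum_powr_exp_le[of "\<gamma> + real j" x n] assms by simp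
qed

text \<open>
  On the window \<open>(\<lceil>x\<rceil>, 2 * \<lceil>x\<rceil>]\<close> the index \<open>m\<close> lies between \<open>x\<close> and \<open>4 * x\<close>, which bounds both factors of
  the weight from below.
\<close>

lemma window_weight_ge:
  assumes x: "x \<ge> 2" and m: "m \<in> {nat \<lceil>x\<rceil><..2 * nat \<lceil>x\<rceil>}"
  shows "min 1 (4 powr (\<gamma> - 1)) * exp (- 4) * x powr (\<gamma> - 1) \<le> weight \<gamma> x m"
proof -
  have M: "x \<le> real (nat \<lceil>x\<rceil>)" "real (nat \<lceil>x\<rceil>) \<le> 2 * x"
    using x by linarith+
  have "nat \<lceil>x\<rceil> < m" "m \<le> 2 * nat \<lceil>x\<rceil>" using m by auto
  then have "real (nat \<lceil>x\<rceil>) \<le> real m" "real m \<le> real (2 * nat \<lceil>x\<rceil>)" by linarith+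
  then have mx: "x \<le> real m" "real m \<le> 4 * x" using M by linarith+
  have "min 1 (4 powr (\<gamma> - 1)) * x powr (\<gamma> - 1) \<le> real m powr (\<gamma> - 1)"
  proof (cases "\<gamma> \<ge> 1")
    case True
    have "min 1 (4 powr (\<gamma> - 1)) * x powr (\<gamma> - 1) \<le> 1 * x powr (\<gamma> - 1)" by (intro mult_right_mono) auto
    also have "\<dots> \<le> real m powr (\<gamma> - 1)" using True mx x by (simp add: powr_mono2)
    finally show ?thesis .
  next
    case False
    have "min 1 (4 powr (\<gamma> - 1)) * x powr (\<gamma> - 1) \<le> 4 powr (\<gamma> - 1) * x powr (\<gamma> - 1)" by (intro mult_right_mono) auto
    also have "\<dots> = (4 * x) powr (\<gamma> - 1)" using x by (simp add: powr_mult)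
    also have "\<dots> \<le> real m powr (\<gamma> - 1)" using False mx x by (intro powr_mono2') auto
    finally show ?thesis .
  qed
  moreover have "exp (- 4) \<le> exp (- real m / x)" using mx x by (simp add: pos_divide_le_eq)
  ultimately have "(min 1 (4 powr (\<gamma> - 1)) * x powr (\<gamma> - 1)) * exp (- 4) \<le> real m powr (\<gamma> - 1) * exp (- real m / x)"
    by (intro mult_mono) auto
  then show ?thesis unfolding weight_def by (simp only: mult_ac)
qed

text \<open>
  The full series is \<open>n + O(1)\<close> by \<open>power_exp_series_approx\<close>. The terms beyond \<open>n\<close> gain a factor
  \<open>exp (- n / (2 * x))\<close> over a series of size \<open>x powr (1 + \<gamma>)\<close>; as \<open>n / x\<close> is a multiple of
  \<open>x powr \<gamma>\<close>, they add up to \<open>O(x)\<close>.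
\<close>

lemma truncated_mean:
  assumes g: "\<gamma> > 0"
  shows "\<exists>A>0. \<forall>x n. x \<ge> 1 \<longrightarrow> real n = Gamma (1 + \<gamma>) * x powr (1 + \<gamma>) \<longrightarrow>
    \<bar>(\<Sum>m=1..n. real m * weight \<gamma> x m) - real n\<bar> \<le> A * x"
proof -
  from power_exp_series_approx[OF g] obtain B where
    B0: "\<forall>h>0. summable (\<lambda>m. real m powr \<gamma> * exp (- h * real m)) \<and>
      \<bar>(\<Sum>m. real m powr \<gamma> * exp (- h * real m)) - Gamma (1 + \<gamma>) * h powr (- (1 + \<gamma>))\<bar> \<le> B"
    by (elim exE)
  have B: "\<And>h. h > 0 \<Longrightarrow> summable (\<lambda>m. real m powr \<gamma> * exp (- h * real m))"
    "\<And>h. h > 0 \<Longrightarrow> \<bar>(\<Sum>m. real m powr \<gamma> * exp (- h * real m)) - Gamma (1 + \<gamma>) * h powr (- (1 + \<gamma>))\<bar> \<le> B"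
    using B0 by simp_all
  define G where "G = Gamma (1 + \<gamma>)"
  have G: "G > 0" unfolding G_def using g by (intro Gamma_real_pos) simp
  have B0: "B \<ge> 0" using B(2)[of 1] by linarith
  define A where "A = B + 2 / G * (G * 2 powr (1 + \<gamma>) + B) + 1"
  have A: "A > 0" unfolding A_def using B0 G by (intro add_nonneg_pos add_nonneg_nonneg mult_nonneg_nonneg) auto
  show ?thesis
  proof (intro exI[of _ A] conjI A allI impI)
    fix x :: real and n :: nat
    assume x: "x \<ge> 1" and n: "real n = Gamma (1 + \<gamma>) * x powr (1 + \<gamma>)"
    let ?f = "\<lambda>h m. real m powr \<gamma> * exp (- h * real m)"
    have hx: "1 / x > 0" "1 / (2 * x) > 0" using x by auto
    have sm: "summable (?f (1 / x))" and sm2: "summable (?f (1 / (2 * x)))" using B(1) hx by blast+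
    have inv0: "(1 / y) powr (- a) = y powr a" if "y > 0" for y a :: real
      using that by (simp add: powr_minus powr_divide)
    have inv: "(1 / x) powr (- (1 + \<gamma>)) = x powr (1 + \<gamma>)" "(1 / (2 * x)) powr (- (1 + \<gamma>)) = 2 powr (1 + \<gamma>) * x powr (1 + \<gamma>)"
      using x inv0[of x "1 + \<gamma>"] inv0[of "2 * x" "1 + \<gamma>"] by (simp_all only: powr_mult)
    have full: "\<bar>suminf (?f (1 / x)) - real n\<bar> \<le> B" using B(2)[OF hx(1)] unfolding inv n .
    have full2: "suminf (?f (1 / (2 * x))) \<le> G * (2 powr (1 + \<gamma>) * x powr (1 + \<gamma>)) + B"
      using B(2)[OF hx(2)] unfolding inv G_def by linarith
    have part: "(\<Sum>m=1..n. real m * weight \<gamma> x m) = (\<Sum>m<Suc n. ?f (1 / x) m)"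
    proof -
      have "(\<Sum>m=1..n. real m * weight \<gamma> x m) = (\<Sum>m=1..n. ?f (1 / x) m)"
        using power_mult_weight[of _ 0 \<gamma> x] by (intro sum.cong refl) simp
      also have "\<dots> = (\<Sum>m<Suc n. ?f (1 / x) m)"
        by (rule sum.mono_neutral_left) auto
      finally show ?thesis .
    qed
    have split: "suminf (?f (1 / x)) = (\<Sum>m. ?f (1 / x) (m + Suc n)) + (\<Sum>m<Suc n. ?f (1 / x) m)"
      by (rule suminf_split_initial_segment[OF sm])
    have smt: "summable (\<lambda>m. ?f (1 / x) (m + Suc n))" and smt2: "summable (\<lambda>m. ?f (1 / (2 * x)) (m + Suc n))"
      by (rule summable_ignore_initial_segment[OF sm], rule summable_ignore_initial_segment[OF sm2])
    have tail0: "(\<Sum>m. ?f (1 / x) (m + Suc n)) \<ge> 0" by (rule suminf_nonneg[OF smt]) auto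
    have "(\<Sum>m. ?f (1 / x) (m + Suc n)) \<le> (\<Sum>m. exp (- real n / (2 * x)) * ?f (1 / (2 * x)) (m + Suc n))"
    proof (rule suminf_le)
      fix m
      let ?k = "m + Suc n"
      have "- (1 / x) * real ?k = - real ?k / (2 * x) + - (1 / (2 * x)) * real ?k" using x by (simp add: field_simps)
      also have "\<dots> \<le> - real n / (2 * x) + - (1 / (2 * x)) * real ?k" using x by (intro add_right_mono divide_right_mono) auto
      finally have "exp (- (1 / x) * real ?k) \<le> exp (- real n / (2 * x)) * exp (- (1 / (2 * x)) * real ?k)"
        unfolding exp_add[symmetric] by simp
      then have "real ?k powr \<gamma> * exp (- (1 / x) * real ?k) \<le> real ?k powr \<gamma> * (exp (- real n / (2 * x)) * exp (- (1 / (2 * x)) * real ?k))"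
        by (rule mult_left_mono) simp
      then show "?f (1 / x) ?k \<le> exp (- real n / (2 * x)) * ?f (1 / (2 * x)) ?k" by (simp only: mult_ac)
    qed (intro smt summable_mult smt2)+
    also have "\<dots> = exp (- real n / (2 * x)) * (\<Sum>m. ?f (1 / (2 * x)) (m + Suc n))" by (rule suminf_mult[OF smt2])
    also have "(\<Sum>m. ?f (1 / (2 * x)) (m + Suc n)) \<le> suminf (?f (1 / (2 * x)))"
      unfolding suminf_split_initial_segment[OF sm2, of "Suc n"] by (simp add: sum_nonneg)
    also have "\<dots> \<le> (G * 2 powr (1 + \<gamma>) + B) * x powr (1 + \<gamma>)"
    proof -
      have "1 \<le> x powr (1 + \<gamma>)" using x g by (intro ge_one_powr_ge_zero) auto
      then have "B * 1 \<le> B * x powr (1 + \<gamma>)" using B0 by (intro mult_left_mono)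
      then show ?thesis using full2 by (simp add: algebra_simps)
    qed
    finally have tail: "(\<Sum>m. ?f (1 / x) (m + Suc n)) \<le> exp (- real n / (2 * x)) * ((G * 2 powr (1 + \<gamma>) + B) * x powr (1 + \<gamma>))"
      by simp
    also have "exp (- real n / (2 * x)) \<le> 2 / (G * x powr \<gamma>)"
    proof -
      have e: "real n / (2 * x) = G * x powr \<gamma> / 2" using x unfolding n G_def[symmetric] by (simp add: powr_add)
      have p: "G * x powr \<gamma> / 2 > 0" using G x by simp
      have "G * x powr \<gamma> / 2 \<le> exp (G * x powr \<gamma> / 2)" using exp_ge_add_one_self[of "G * x powr \<gamma> / 2"] by linarith
      then have "inverse (exp (G * x powr \<gamma> / 2)) \<le> inverse (G * x powr \<gamma> / 2)" by (rule le_imp_inverse_le[OF _ p])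
      moreover have "exp (- real n / (2 * x)) = inverse (exp (G * x powr \<gamma> / 2))"
        unfolding e[symmetric] by (simp add: exp_minus)
      ultimately show ?thesis by simp
    qed
    also have "2 / (G * x powr \<gamma>) * ((G * 2 powr (1 + \<gamma>) + B) * x powr (1 + \<gamma>)) = 2 / G * (G * 2 powr (1 + \<gamma>) + B) * x"
      using x G by (simp add: powr_add field_simps)
    finally have tail: "(\<Sum>m. ?f (1 / x) (m + Suc n)) \<le> 2 / G * (G * 2 powr (1 + \<gamma>) + B) * x"
      using B0 G by (simp add: mult_right_mono)
    have "B * 1 \<le> B * x" using B0 x by (intro mult_left_mono) auto
    moreover have "A * x = B * x + 2 / G * (G * 2 powr (1 + \<gamma>) + B) * x + x" unfolding A_def by (simp add: distrib_right)
    ultimately show "\<bar>(\<Sum>m=1..n. real m * weight \<gamma> x m) - real n\<bar> \<le> A * x"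
      using full split tail tail0 x unfolding part by linarith
  qed
qed

abbreviation saddle_constants :: "real \<Rightarrow> real \<Rightarrow> real \<Rightarrow> real \<Rightarrow> bool" where
  "saddle_constants \<gamma> K C x0 \<equiv> K > 0 \<and> C > 0 \<and> x0 \<ge> 2 \<and>
    (\<forall>x n b. x \<ge> x0 \<longrightarrow> real n = Gamma (1 + \<gamma>) * x powr (1 + \<gamma>) \<longrightarrow> real b \<le> x \<longrightarrow>
      saddle (weight \<gamma> x) n b (x powr (1 + \<gamma> / 2)) (x powr (- \<gamma> / 2)) K C)"

text \<open>
  The scales are \<open>lam = x powr (1 + \<gamma> / 2)\<close> and \<open>rho = x powr (- \<gamma> / 2)\<close>, so that \<open>rho * lam\<close> is \<open>x\<close> and
  \<open>rho * lam ^ 3\<close> is \<open>x powr (\<gamma> + 3)\<close>, the order of the third moment. Because \<open>b \<le> x\<close>, the whole window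
  \<open>(\<lceil>x\<rceil>, 2 * \<lceil>x\<rceil>]\<close> lies above \<open>b\<close>, and it alone yields the decay and the variance.
\<close>

theorem saddle_weight:
  assumes g: "\<gamma> > 0"
  shows "\<exists>K C x0. saddle_constants \<gamma> K C x0"
proof -
  define G where "G = Gamma (1 + \<gamma>)"
  have G: "G > 0" unfolding G_def using g by (intro Gamma_real_pos) simp
  define c0 where "c0 = min 1 (4 powr (\<gamma> - 1)) * exp (- 4 :: real)"
  have c0: "c0 > 0" unfolding c0_def by (intro mult_pos_pos) (auto simp: min_def)
  from decay_le_cubic[OF g, of "c0 / 216"] c0 obtain K1 where K1': "K1 > 0 \<and> (\<forall>x v. x \<ge> 1 \<longrightarrow> \<bar>v\<bar> \<le> pi \<longrightarrow>
    exp (- (c0 / 216) * (x powr \<gamma> * min 1 ((x * v)\<^sup>2))) \<le> K1 / (1 + (x powr (1 + \<gamma> / 2) * v)\<^sup>2) ^ 3)"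
    by auto
  have K1: "K1 > 0" "\<And>x v. x \<ge> 1 \<Longrightarrow> \<bar>v\<bar> \<le> pi \<Longrightarrow>
    exp (- (c0 / 216) * (x powr \<gamma> * min 1 ((x * v)\<^sup>2))) \<le> K1 / (1 + (x powr (1 + \<gamma> / 2) * v)\<^sup>2) ^ 3"
    using K1' by (blast, blast)
  define K2 where "K2 = (1 + 3 / (c0 / 2)) ^ 3"
  have K2: "K2 > 0" unfolding K2_def using c0 by (intro zero_less_power add_pos_pos) auto
  from truncated_mean[OF g] obtain A where A0: "A > 0 \<and> (\<forall>x n. x \<ge> 1 \<longrightarrow> real n = Gamma (1 + \<gamma>) * x powr (1 + \<gamma>) \<longrightarrow>
    \<bar>(\<Sum>m=1..n. real m * weight \<gamma> x m) - real n\<bar> \<le> A * x)" by (elim exE)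
  have A: "A > 0" "\<And>x n. x \<ge> 1 \<Longrightarrow> real n = Gamma (1 + \<gamma>) * x powr (1 + \<gamma>) \<Longrightarrow>
    \<bar>(\<Sum>m=1..n. real m * weight \<gamma> x m) - real n\<bar> \<le> A * x"
    using A0 by simp_all
  define A1 where "A1 = 2 * (2 * (\<gamma> + real 1)) powr (\<gamma> + real 1)"
  define A2 where "A2 = 2 * (2 * (\<gamma> + real 2)) powr (\<gamma> + real 2)"
  have A12: "A1 \<ge> 0" "A2 \<ge> 0" by (auto simp: A1_def A2_def)
  show ?thesis
  proof (rule exI[of _ "K1 + K2"], rule exI[of _ "A + A1 + A2"],
      rule exI[of _ "max 2 ((4 / G) powr (1 / \<gamma>))"], intro conjI allI impI)
    show "K1 + K2 > 0" "A + A1 + A2 > 0" using K1(1) K2 A(1) A12 by auto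
    show "max 2 ((4 / G) powr (1 / \<gamma>)) \<ge> 2" by simp
    fix x :: real and n b :: nat
    assume x0: "x \<ge> max 2 ((4 / G) powr (1 / \<gamma>))" and n: "real n = Gamma (1 + \<gamma>) * x powr (1 + \<gamma>)" and b: "real b \<le> x"
    have x: "x \<ge> 2" using x0 by simp
    define M where "M = nat \<lceil>x\<rceil>"
    have M: "x \<le> real M" "real M \<le> 2 * x" "M \<ge> 2" unfolding M_def using x by linarith+
    \<comment> \<open>The threshold for \<open>x\<close> ensures \<open>4 * x \<le> n\<close>, so that the window fits below \<open>n\<close>.\<close>
    have "((4 / G) powr (1 / \<gamma>)) powr \<gamma> \<le> x powr \<gamma>" using x0 g by (intro powr_mono2) auto
    then have "4 / G \<le> x powr \<gamma>" using g G by (simp add: powr_powr)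
    then have "4 \<le> G * x powr \<gamma>" using G by (simp add: pos_divide_le_eq mult.commute)
    then have "4 * x \<le> (G * x powr \<gamma>) * x" using x by (intro mult_right_mono) auto
    also have "\<dots> = real n" using x unfolding n G_def by (simp add: powr_add mult_ac)
    finally have n4: "4 * x \<le> real n" .
    have Mn: "2 * M \<le> n" using n4 M(2) by linarith
    have bM: "b \<le> M" using b M(1) by linarith
    have win: "{M<..2*M} \<subseteq> {b<..n}" using Mn bM by auto
    have ww: "c0 * x powr (\<gamma> - 1) \<le> weight \<gamma> x m" if "m \<in> {M<..2*M}" for m
      using window_weight_ge[OF x that[unfolded M_def], of \<gamma>] unfolding c0_def .
    have wp: "weight \<gamma> x m > 0" if "m \<in> {b<..n}" for m using that by (intro weight_pos) auto
    let ?lam = "x powr (1 + \<gamma> / 2)" and ?rho = "x powr (- \<gamma> / 2)"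
    have lam2: "?lam\<^sup>2 = x powr (2 + \<gamma>)" using x by (simp add: powr_power)
    have lr: "?rho * ?lam = x" using x by (simp add: powr_add[symmetric])
    have lr3: "?rho * ?lam ^ 3 = x powr (\<gamma> + real 2 + 1)"
      using x by (simp add: powr_power powr_add[symmetric]) (simp add: field_simps)
    show "saddle (weight \<gamma> x) n b ?lam ?rho (K1 + K2) (A + A1 + A2)"
    proof
      show "weight \<gamma> x m > 0" if "m \<in> {1..n}" for m using that by (intro weight_pos) auto
      show "b \<le> n" using b n4 x by linarith
      show "?lam > 0" using x by simp
      have l1: "1 \<le> ?lam" using x g by (intro ge_one_powr_ge_zero) auto
      have "1 / ?lam \<le> 1 / 1" by (rule divide_left_mono[OF l1]) (use l1 in auto)
      then show "1 / ?lam \<le> pi" using pi_gt3 by linarith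
      show "?rho \<ge> 0" "K1 + K2 \<ge> 0" "A + A1 + A2 \<ge> 0" using K1(1) K2 A(1) A12 by auto
      show "exp (Re (log_char (weight \<gamma> x) {b<..n} v)) \<le> (K1 + K2) / (1 + (?lam * v)\<^sup>2) ^ 3" if v: "\<bar>v\<bar> \<le> pi" for v
      proof -
        have pos: "(1 + (?lam * v)\<^sup>2) ^ 3 > 0" by (intro zero_less_power add_pos_nonneg) auto
        \<comment> \<open>The constant \<open>216\<close> is \<open>24 * 9\<close>: \<open>24\<close> from \<open>window_cos_sum_ge\<close>, and \<open>9\<close> because \<open>M div 2\<close> is at least \<open>x / 3\<close>.\<close>
        have "M \<le> 3 * (M div 2)" using M(3) by presburger
        then have "real M \<le> real (3 * (M div 2))" by (simp only: of_nat_le_iff)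
        then have J: "real M \<le> 3 * real (M div 2)" by simp
        have J2: "(x * v)\<^sup>2 / 9 \<le> (v * real (M div 2))\<^sup>2"
        proof -
          have "x / 3 \<le> real (M div 2)" using J M(1) by linarith
          then have "(x / 3)\<^sup>2 \<le> (real (M div 2))\<^sup>2" using x by (intro power_mono) auto
          then have "v\<^sup>2 * (x / 3)\<^sup>2 \<le> v\<^sup>2 * (real (M div 2))\<^sup>2" by (intro mult_left_mono) auto
          then show ?thesis by (simp add: power_mult_distrib power_divide mult_ac)
        qed
        have "c0 / 216 * (x powr \<gamma> * min 1 ((x * v)\<^sup>2)) = c0 * x powr (\<gamma> - 1) * (x / 24 * (min 1 ((x * v)\<^sup>2) / 9))"
          using x by (simp add: powr_diff)
        also have "\<dots> \<le> c0 * x powr (\<gamma> - 1) * (real M / 24 * min 1 ((v * real (M div 2))\<^sup>2))"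
          using c0 x M(1) J2 by (intro mult_left_mono mult_mono) (auto simp: min_def)
        also have "\<dots> \<le> c0 * x powr (\<gamma> - 1) * (\<Sum>m\<in>{M<..2*M}. 1 - cos (v * real m))"
          using c0 by (intro mult_left_mono window_cos_sum_ge M(3) v) auto
        also have "\<dots> = (\<Sum>m\<in>{M<..2*M}. c0 * x powr (\<gamma> - 1) * (1 - cos (v * real m)))" by (rule sum_distrib_left)
        also have "\<dots> \<le> (\<Sum>m\<in>{M<..2*M}. weight \<gamma> x m * (1 - cos (v * real m)))"
          by (intro sum_mono mult_right_mono ww) auto
        also have "\<dots> \<le> (\<Sum>m\<in>{b<..n}. weight \<gamma> x m * (1 - cos (v * real m)))"
          by (intro sum_mono2 win mult_nonneg_nonneg less_imp_le[OF wp]) auto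
        finally have "Re (log_char (weight \<gamma> x) {b<..n} v) \<le> - (c0 / 216) * (x powr \<gamma> * min 1 ((x * v)\<^sup>2))"
          unfolding Re_log_char by linarith
        then have "exp (Re (log_char (weight \<gamma> x) {b<..n} v)) \<le> exp (- (c0 / 216) * (x powr \<gamma> * min 1 ((x * v)\<^sup>2)))" by simp
        also have "\<dots> \<le> K1 / (1 + (?lam * v)\<^sup>2) ^ 3" by (rule K1(2)) (use x v in auto)
        also have "\<dots> \<le> (K1 + K2) / (1 + (?lam * v)\<^sup>2) ^ 3" using K2 pos by (intro divide_right_mono) auto
        finally show ?thesis .
      qed
      show "exp (- ((\<Sum>m\<in>{b<..n}. (real m)\<^sup>2 * weight \<gamma> x m) * v\<^sup>2 / 2)) \<le> (K1 + K2) / (1 + (?lam * v)\<^sup>2) ^ 3" for v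
      proof -
        have pos: "(1 + (?lam * v)\<^sup>2) ^ 3 > 0" by (intro zero_less_power add_pos_nonneg) auto
        have "c0 * ?lam\<^sup>2 = x * (x\<^sup>2 * (c0 * x powr (\<gamma> - 1)))"
          unfolding lam2 using x by (simp add: powr_add powr_diff powr_numeral)
        also have "\<dots> \<le> real M * (x\<^sup>2 * (c0 * x powr (\<gamma> - 1)))"
          using M(1) c0 by (intro mult_right_mono) auto
        also have "\<dots> = (\<Sum>m\<in>{M<..2*M}. x\<^sup>2 * (c0 * x powr (\<gamma> - 1)))" by simp
        also have "\<dots> \<le> (\<Sum>m\<in>{M<..2*M}. (real m)\<^sup>2 * weight \<gamma> x m)"
          using M(1) x c0 by (intro sum_mono mult_mono ww power_mono) auto
        also have "\<dots> \<le> (\<Sum>m\<in>{b<..n}. (real m)\<^sup>2 * weight \<gamma> x m)"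
          by (intro sum_mono2 win mult_nonneg_nonneg less_imp_le[OF wp]) auto
        finally have "c0 * ?lam\<^sup>2 * v\<^sup>2 \<le> (\<Sum>m\<in>{b<..n}. (real m)\<^sup>2 * weight \<gamma> x m) * v\<^sup>2" by (rule mult_right_mono) simp
        then have "exp (- ((\<Sum>m\<in>{b<..n}. (real m)\<^sup>2 * weight \<gamma> x m) * v\<^sup>2 / 2)) \<le> exp (- (c0 / 2) * (?lam * v)\<^sup>2)"
          by (simp add: power_mult_distrib mult_ac)
        also have "\<dots> \<le> K2 / (1 + (?lam * v)\<^sup>2) ^ 3" unfolding K2_def by (rule exp_neg_le_cubic) (use c0 in auto)
        also have "\<dots> \<le> (K1 + K2) / (1 + (?lam * v)\<^sup>2) ^ 3" using K1(1) pos by (intro divide_right_mono) auto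
        finally show ?thesis .
      qed
      have "\<bar>(\<Sum>m=1..n. real m * weight \<gamma> x m) - real n\<bar> \<le> A * x" by (rule A(2)[OF _ n]) (use x in simp)
      also have "\<dots> \<le> (A + A1 + A2) * (?rho * ?lam)" unfolding lr using A12 x by (intro mult_right_mono) auto
      finally show "\<bar>(\<Sum>m=1..n. real m * weight \<gamma> x m) - real n\<bar> \<le> (A + A1 + A2) * ?rho * ?lam" by (simp only: mult.assoc)
      have "(\<Sum>m=1..n. real m ^ Suc 2 * weight \<gamma> x m) \<le> A2 * x powr (\<gamma> + real 2 + 1)"
        unfolding A2_def by (rule sum_power_weight_le) (use g x in auto)
      also have "\<dots> \<le> (A + A1 + A2) * (?rho * ?lam ^ 3)" unfolding lr3 using A(1) A12 by (intro mult_right_mono) auto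
      finally show "(\<Sum>m=1..n. real m ^ 3 * weight \<gamma> x m) \<le> (A + A1 + A2) * ?rho * ?lam ^ 3"
        by (simp only: mult.assoc numeral_3_eq_3 numeral_2_eq_2)
      have "(\<Sum>m=1..n. real m ^ Suc 1 * weight \<gamma> x m) \<le> A1 * x powr (\<gamma> + real 1 + 1)"
        unfolding A1_def by (rule sum_power_weight_le) (use g x in auto)
      also have "\<dots> \<le> (A + A1 + A2) * ?lam\<^sup>2" unfolding lam2 using A(1) A12 x by (intro mult_mono) auto
      finally show "(\<Sum>m=1..n. (real m)\<^sup>2 * weight \<gamma> x m) \<le> (A + A1 + A2) * ?lam\<^sup>2"
        by (simp only: numeral_2_eq_2 One_nat_def)
    qed
  qed
qed

section \<open>Bounds for the total variation distance\<close>

text \<open>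
  The reciprocal of \<open>eta\<close>: cycles much longer than this are exponentially rare.
\<close>

definition cycle_scale :: "real \<Rightarrow> nat \<Rightarrow> real" where
  "cycle_scale \<gamma> n = (real n / Gamma (1 + \<gamma>)) powr (1 / (1 + \<gamma>))"

lemma Gamma_pos: "\<gamma> > 0 \<Longrightarrow> Gamma (1 + \<gamma> :: real) > 0"
  by (intro Gamma_real_pos) simp

lemma scale_pos: "\<gamma> > 0 \<Longrightarrow> n \<ge> 1 \<Longrightarrow> cycle_scale \<gamma> n > 0"
  using Gamma_pos[of \<gamma>] less_imp_neq[OF Gamma_pos[of \<gamma>]] by (auto simp: cycle_scale_def)

lemma real_eq_scale:
  assumes "\<gamma> > 0" "n \<ge> 1"
  shows "real n = Gamma (1 + \<gamma>) * cycle_scale \<gamma> n powr (1 + \<gamma>)"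
  using assms less_imp_neq[OF Gamma_pos[OF assms(1)]] by (auto simp: cycle_scale_def powr_powr)

lemma rate_eq_weight:
  assumes "\<gamma> > 0" "n \<ge> 1"
  shows "rate \<gamma> n = weight \<gamma> (cycle_scale \<gamma> n)"
proof
  fix m
  have "eta \<gamma> n = 1 / cycle_scale \<gamma> n"
    by (simp add: eta_def cycle_scale_def powr_minus_divide)
  then show "rate \<gamma> n m = weight \<gamma> (cycle_scale \<gamma> n) m"
    by (simp add: rate_def weight_def exp_of_nat_mult[symmetric])
qed

lemma scale_conv_powr:
  assumes "\<gamma> > 0"
  shows "cycle_scale \<gamma> n = real n powr (1 / (1 + \<gamma>)) / Gamma (1 + \<gamma>) powr (1 / (1 + \<gamma>))"
  using assms Gamma_pos[of \<gamma>] by (simp add: cycle_scale_def powr_divide)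

lemma filterlim_scale:
  assumes g: "\<gamma> > 0"
  shows "filterlim (cycle_scale \<gamma>) at_top sequentially"
proof -
  have G: "Gamma (1 + \<gamma>) powr (1 / (1 + \<gamma>)) > 0" using Gamma_pos[OF g] by simp
  have "filterlim (\<lambda>n. real n powr (1 / (1 + \<gamma>))) at_top sequentially"
    using g by real_asymp
  then have "filterlim (\<lambda>n. real n powr (1 / (1 + \<gamma>)) * (1 / Gamma (1 + \<gamma>) powr (1 / (1 + \<gamma>)))) at_top sequentially"
    by (rule filterlim_at_top_mult_tendsto_pos[OF tendsto_const, rotated]) (use G in simp)
  then show ?thesis unfolding scale_conv_powr[OF g, abs_def] by simp
qed

context saddle
begin

lemma count_density_eq: "count_density w b n k = tail_prob w b n k / total_prob"
  by (simp add: count_density_def tail_prob_def total_prob_def)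

lemma expectation_count_density_dev:
  assumes "total_prob > 0"
  shows "expect law (\<lambda>k. \<bar>count_density w b n k - 1\<bar>)
    = mean_dev / total_prob"
proof -
  have "\<bar>count_density w b n k - 1\<bar> = \<bar>tail_prob w b n k - total_prob\<bar> / total_prob" for k
  proof -
    have "count_density w b n k - 1 = (tail_prob w b n k - total_prob) / total_prob"
      using assms by (simp add: count_density_eq diff_divide_distrib)
    then show ?thesis using assms by (simp add: abs_divide)
  qed
  then show ?thesis by simp
qed

end

text \<open>
  This is \<open>expectation_tail_diff_le\<close> divided by \<open>total_ge\<close>, with the variance of the sum up to \<open>b\<close> estimated
  by \<open>b powr (2 + \<gamma>)\<close>. The threshold for \<open>x\<close> makes \<open>rho\<close> so small that the Gaussian part of
  \<open>total_ge\<close> dominates.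
\<close>

lemma d_b_upper:
  assumes g: "\<gamma> > 0"
  shows "\<exists>D x1. D > 0 \<and> x1 \<ge> 1 \<and> (\<forall>n b. n \<ge> 1 \<longrightarrow> cycle_scale \<gamma> n \<ge> x1 \<longrightarrow> real b \<le> cycle_scale \<gamma> n \<longrightarrow> b \<le> n \<longrightarrow>
    d_b \<gamma> b n \<le> D * ((real b / cycle_scale \<gamma> n) powr (2 + \<gamma>) + cycle_scale \<gamma> n powr (- \<gamma>)))"
proof -
  from saddle_weight[OF g] obtain K C x0 where KC: "saddle_constants \<gamma> K C x0" by (elim exE)
  \<comment> \<open>Half of the Gaussian part of \<open>total_ge\<close>; the other half absorbs the error of order \<open>rho\<close>.\<close>
  define c where "c = exp (- (C / 2)) / (2 * pi)"
  have c: "c > 0" by (simp add: c_def)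
  have "((\<lambda>x. x powr (- (\<gamma> / 2))) \<longlongrightarrow> 0) at_top" by (rule tendsto_neg_powr) (use g in \<open>auto simp: filterlim_ident\<close>)
  then have "\<forall>\<^sub>F x in at_top. x powr (- (\<gamma> / 2)) < c / (C * K)"
    using c KC by (intro order_tendstoD(2)) auto
  then obtain x2 where x2: "\<And>x. x \<ge> x2 \<Longrightarrow> x powr (- (\<gamma> / 2)) < c / (C * K)"
    unfolding eventually_at_top_linorder by auto
  show ?thesis
  proof (rule exI[of _ "K * (1 + C) / c"], rule exI[of _ "max x0 x2"], intro conjI allI impI)
    show "K * (1 + C) / c > 0" using KC c by (intro divide_pos_pos mult_pos_pos) auto
    show "max x0 x2 \<ge> 1" using KC by auto
    fix n b :: nat
    assume n: "n \<ge> 1" and xn: "cycle_scale \<gamma> n \<ge> max x0 x2" and bx: "real b \<le> cycle_scale \<gamma> n" and bn: "b \<le> n"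
    define x where "x = cycle_scale \<gamma> n"
    have x: "x \<ge> 2" "x \<ge> x0" "x \<ge> x2" using xn KC by (auto simp: x_def)
    let ?lam = "x powr (1 + \<gamma> / 2)" and ?rho = "x powr (- \<gamma> / 2)"
    have sad: "saddle (weight \<gamma> x) n b ?lam ?rho K C"
      using KC x real_eq_scale[OF g n] bx unfolding x_def by auto
    interpret saddle "weight \<gamma> x" n b ?lam ?rho K C by (rule sad)
    have rw: "rate \<gamma> n = weight \<gamma> x" unfolding x_def by (rule rate_eq_weight[OF g n])
    have "C * K > 0" using KC by simp
    then have "C * K * ?rho < c" using x2[OF x(3)] by (simp add: pos_less_divide_eq mult.commute)
    moreover have "exp (- (C / 2)) / pi = 2 * c" by (simp add: c_def)
    ultimately have "c / ?lam \<le> (exp (- (C / 2)) / pi - C * ?rho * K) / ?lam"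
      by (intro divide_right_mono) (auto simp: mult_ac)
    then have tot: "c / ?lam \<le> total_prob" using total_ge by linarith
    have lampos: "?lam > 0" using x by simp
    then have totpos: "total_prob > 0" using tot c by (smt (verit) divide_pos_pos)
    have s2_le: "s2 \<le> real b powr (2 + \<gamma>)"
    proof -
      have "s2 = (\<Sum>m=1..b. real m powr (\<gamma> + 1) * exp (- real m / x))"
        unfolding s2_def using power_mult_weight[of _ 1 \<gamma> x]
        by (intro sum.cong refl) (simp add: numeral_2_eq_2)
      also have "\<dots> \<le> (\<Sum>m=1..b. real b powr (\<gamma> + 1) * 1)"
        using x g by (intro sum_mono mult_mono powr_mono2) auto
      also have "\<dots> = real b powr (2 + \<gamma>)"
        by (cases "b = 0") (auto simp: powr_add mult_ac power2_eq_square powr_numeral)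
      finally show ?thesis .
    qed
    have lam2: "?lam\<^sup>2 = x powr (2 + \<gamma>)" using x by (simp add: powr_power)
    have rho2: "?rho\<^sup>2 = x powr (- \<gamma>)" using x by (simp add: powr_power)
    have "d_b \<gamma> b n \<le> expect law (\<lambda>k. \<bar>count_density (weight \<gamma> x) b n k - 1\<bar>)"
      using d_b_le[OF bn, of \<gamma>] unfolding rw .
    also have "\<dots> = mean_dev / total_prob"
      by (rule expectation_count_density_dev[OF totpos])
    also have "\<dots> \<le> (K * (1 + C) * (s2 / ?lam ^ 3 + ?rho\<^sup>2 / ?lam)) / (c / ?lam)"
      using tot totpos c lampos s2_nonneg KC
      by (intro frac_le expectation_tail_diff_le) (auto intro!: mult_nonneg_nonneg add_nonneg_nonneg)
    also have "\<dots> = K * (1 + C) / c * (s2 / ?lam\<^sup>2 + ?rho\<^sup>2)"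
      using lampos c by (simp add: field_simps power2_eq_square power3_eq_cube)
    also have "\<dots> \<le> K * (1 + C) / c * ((real b / x) powr (2 + \<gamma>) + x powr (- \<gamma>))"
    proof (intro mult_left_mono add_mono)
      have "s2 / ?lam\<^sup>2 \<le> real b powr (2 + \<gamma>) / ?lam\<^sup>2" using s2_le by (intro divide_right_mono) auto
      also have "\<dots> = (real b / x) powr (2 + \<gamma>)" unfolding lam2 using x by (simp add: powr_divide)
      finally show "s2 / ?lam\<^sup>2 \<le> (real b / x) powr (2 + \<gamma>)" .
      show "?rho\<^sup>2 \<le> x powr (- \<gamma>)" unfolding rho2 ..
      show "K * (1 + C) / c \<ge> 0" using KC c by auto
    qed
    finally show "d_b \<gamma> b n \<le> K * (1 + C) / c * ((real b / cycle_scale \<gamma> n) powr (2 + \<gamma>) + cycle_scale \<gamma> n powr (- \<gamma>))"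
      unfolding x_def .
  qed
qed

text \<open>
  This is \<open>expectation_tail_diff_ge\<close> divided by \<open>total_le\<close>. For this \<open>b\<close> the variance of the
  sum up to \<open>b\<close> is at least a fixed fraction of \<open>lam\<^sup>2\<close>, and for large \<open>x\<close> the error of order \<open>rho\<close> is negligible.
\<close>

lemma d_b_lower:
  assumes g: "\<gamma> > 0" and e: "0 < e" "e \<le> 1"
  shows "\<exists>dl x1. dl > 0 \<and> (\<forall>n. n \<ge> 1 \<longrightarrow> cycle_scale \<gamma> n \<ge> x1 \<longrightarrow> d_b \<gamma> (nat \<lfloor>e * cycle_scale \<gamma> n\<rfloor>) n \<ge> dl)"
proof -
  from saddle_weight[OF g] obtain K C x0 where KC: "saddle_constants \<gamma> K C x0" by (elim exE)
  \<comment> \<open>A lower bound for \<open>s2 / lam\<^sup>2\<close>, obtained from the indices between \<open>b div 2\<close> and \<open>b\<close>.\<close>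
  define a where "a = exp (- 1) * (e / 4) powr (2 + \<gamma>)"
  have a: "a > 0" using e by (simp add: a_def)
  \<comment> \<open>The main term of \<open>expectation_tail_diff_ge\<close>; half of it remains when \<open>rho\<close> is small.\<close>
  define q where "q = exp (- C) * a\<^sup>2 / (12 * pi)"
  have q: "q > 0" using a by (simp add: q_def)
  have "((\<lambda>x. x powr (- (\<gamma> / 2))) \<longlongrightarrow> 0) at_top" by (rule tendsto_neg_powr) (use g in \<open>auto simp: filterlim_ident\<close>)
  then have "\<forall>\<^sub>F x in at_top. x powr (- (\<gamma> / 2)) < q / 8 / (C * K)"
    using q KC by (intro order_tendstoD(2)) auto
  then obtain x2 where x2: "\<And>x. x \<ge> x2 \<Longrightarrow> x powr (- (\<gamma> / 2)) < q / 8 / (C * K)"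
    unfolding eventually_at_top_linorder by auto
  show ?thesis
  proof (rule exI[of _ "q / 2 / K"], rule exI[of _ "max (max x0 x2) (4 / e)"], intro conjI allI impI)
    show "q / 2 / K > 0" using q KC by simp
    fix n :: nat
    assume n: "n \<ge> 1" and xn: "cycle_scale \<gamma> n \<ge> max (max x0 x2) (4 / e)"
    define x where "x = cycle_scale \<gamma> n"
    define b where "b = nat \<lfloor>e * x\<rfloor>"
    have x: "x \<ge> 2" "x \<ge> x0" "x \<ge> x2" "x \<ge> 4 / e" using xn KC by (auto simp: x_def)
    have ex: "e * x \<ge> 4" using x(4) e by (simp add: pos_divide_le_eq mult.commute)
    have b1: "real b \<le> e * x" "e * x < real b + 1" unfolding b_def using ex by linarith+
    have "e * x \<le> 1 * x" using e x by (intro mult_right_mono) auto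
    then have bx: "real b \<le> x" using b1 by linarith
    let ?lam = "x powr (1 + \<gamma> / 2)" and ?rho = "x powr (- \<gamma> / 2)"
    have sad: "saddle (weight \<gamma> x) n b ?lam ?rho K C"
      using KC x real_eq_scale[OF g n] bx unfolding x_def by auto
    interpret saddle "weight \<gamma> x" n b ?lam ?rho K C by (rule sad)
    have rw: "rate \<gamma> n = weight \<gamma> x" unfolding x_def by (rule rate_eq_weight[OF g n])
    have lampos: "?lam > 0" using x by simp
    have lam2: "?lam\<^sup>2 = x powr (2 + \<gamma>)" using x by (simp add: powr_power)
    have totpos: "total_prob > 0" using pmf_total_pos[of \<gamma> n] unfolding rw total_prob_def .
    have s2_ge: "a \<le> s2 / ?lam\<^sup>2"
    proof -
      define J where "J = b div 2"
      have "b \<le> 2 * J + 1" unfolding J_def by presburger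
      then have "real b \<le> real (2 * J + 1)" by (simp only: of_nat_le_iff)
      then have J: "e * x / 4 \<le> real J" using b1 ex by simp
      have J2: "2 * J \<le> b" unfolding J_def by simp
      have "a * ?lam\<^sup>2 = exp (- 1) * (e * x / 4) powr (2 + \<gamma>)"
        unfolding lam2 a_def using e x powr_mult[of "e / 4" x "2 + \<gamma>"] by simp
      also have "\<dots> \<le> exp (- 1) * real J powr (2 + \<gamma>)"
        using J e x g by (intro mult_left_mono powr_mono2) auto
      also have "real J powr (2 + \<gamma>) = real J * real J powr (\<gamma> + 1)"
        by (cases "J = 0") (auto simp: powr_add mult_ac power2_eq_square powr_numeral)
      also have "exp (- 1) * (real J * real J powr (\<gamma> + 1)) = (\<Sum>m\<in>{J<..2*J}. real J powr (\<gamma> + 1) * exp (- 1))"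
        by simp
      also have "\<dots> \<le> (\<Sum>m\<in>{J<..2*J}. real m powr (\<gamma> + 1) * exp (- real m / x))"
      proof (intro sum_mono mult_mono powr_mono2)
        fix m assume m: "m \<in> {J<..2*J}"
        then have "real m \<le> real (2 * J)" by (simp only: of_nat_le_iff) simp
        then have "real m \<le> x" using J2 bx by linarith
        then show "exp (- 1) \<le> exp (- real m / x)" using x by (simp add: pos_divide_le_eq)
      qed (use g in auto)
      also have "\<dots> \<le> (\<Sum>m=1..b. real m powr (\<gamma> + 1) * exp (- real m / x))"
        using J2 by (intro sum_mono2) auto
      also have "\<dots> = s2"
        unfolding s2_def using power_mult_weight[of _ 1 \<gamma> x]
        by (intro sum.cong refl) (simp add: numeral_2_eq_2)
      finally show ?thesis using lampos by (simp add: pos_le_divide_eq)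
    qed
    have "C * K > 0" using KC by simp
    then have "C * K * ?rho < q / 8" using x2[OF x(3)] by (simp add: pos_less_divide_eq mult_ac)
    moreover have "q \<le> exp (- C) * (s2 / ?lam\<^sup>2)\<^sup>2 / (12 * pi)"
      unfolding q_def using s2_ge a by (intro divide_right_mono mult_left_mono power_mono) auto
    ultimately have "q / 2 \<le> exp (- C) * (s2 / ?lam\<^sup>2)\<^sup>2 / (12 * pi) - 4 * (C * ?rho * K)"
      by (simp add: mult_ac)
    then have "q / 2 / ?lam \<le> (exp (- C) * (s2 / ?lam\<^sup>2)\<^sup>2 / (12 * pi) - 4 * (C * ?rho * K)) / ?lam"
      using lampos by (intro divide_right_mono) auto
    also have "\<dots> \<le> mean_dev"
      by (rule expectation_tail_diff_ge)
    finally have low: "q / 2 / ?lam \<le> mean_dev" .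
    have bn: "b \<le> n" using \<open>saddle (weight \<gamma> x) n b ?lam ?rho K C\<close> by (rule saddle.b)
    have "q / K = (q / 2 / ?lam) / (K / (2 * ?lam))" using lampos KC by (simp add: field_simps)
    also have "\<dots> \<le> mean_dev / total_prob"
      using low total_le totpos q lampos by (intro frac_le) auto
    also have "\<dots> = expect law (\<lambda>k. \<bar>count_density (weight \<gamma> x) b n k - 1\<bar>)"
      by (rule expectation_count_density_dev[OF totpos, symmetric])
    also have "\<dots> \<le> 2 * d_b \<gamma> b n"
      using d_b_ge[OF bn, of \<gamma>] unfolding rw .
    finally show "q / 2 / K \<le> d_b \<gamma> (nat \<lfloor>e * cycle_scale \<gamma> n\<rfloor>) n"
      unfolding b_def x_def by simp
  qed
qed

text \<open>
  Since \<open>cycle_scale \<gamma> n\<close> is a constant multiple of \<open>n powr (1 / (1 + \<gamma>))\<close>, the condition \<open>b = o(\<dots>)\<close> says that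
  \<open>b n / cycle_scale \<gamma> n\<close> tends to zero, and \<open>d_b_upper\<close> applies. If the condition fails, then
  \<open>b n\<close> is at least \<open>\<lfloor>e * cycle_scale \<gamma> n\<rfloor>\<close> infinitely often for some \<open>e\<close>, and \<open>d_b_lower\<close> applies by
  monotonicity.
\<close>

theorem theorem1p2:
  fixes \<gamma> :: real and b :: "nat \<Rightarrow> nat"
  assumes "\<gamma> > 0"
    and "\<And>n. n \<ge> 1 \<Longrightarrow> 1 \<le> b n \<and> b n \<le> n"
  shows "((\<lambda>n. d_b \<gamma> (b n) n) \<longlonglongrightarrow> 0
           \<longleftrightarrow> (\<lambda>n. real (b n)) \<in> o(\<lambda>n. real n powr (1 / (1 + \<gamma>))))
       \<and> ((\<lambda>n. real (b n)) \<in> o(\<lambda>n. real n powr (1 / (1 + \<gamma>)))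
           \<longrightarrow> (\<lambda>n. d_b \<gamma> (b n) n) \<in>
                 O(\<lambda>n. real (b n) powr (2 + \<gamma>) * real n powr (- (2 + \<gamma>) / (1 + \<gamma>))
                       + real (b n) powr (- \<gamma> / 6)
                       + real n powr (- \<gamma> / (1 + \<gamma>))))"
proof -
  note g = \<open>\<gamma> > 0\<close> and bn = assms(2)
  let ?N = "\<lambda>n. real n powr (1 / (1 + \<gamma>))" and ?x = "cycle_scale \<gamma>"
  define G where "G = Gamma (1 + \<gamma>) powr (1 / (1 + \<gamma>))"
  have G: "G > 0" unfolding G_def using Gamma_pos[OF g] by simp
  have N: "?N n = G * ?x n" for n
    unfolding scale_conv_powr[OF g] G_def[symmetric] using G by simp
  have ev_x: "\<forall>\<^sub>F n in sequentially. ?x n \<ge> X" for X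
    using filterlim_scale[OF g] unfolding filterlim_at_top by blast
  have necessary: "(\<lambda>n. real (b n)) \<in> o(?N)" if lim: "(\<lambda>n. d_b \<gamma> (b n) n) \<longlonglongrightarrow> 0"
  proof (rule landau_o.smallI)
    fix c :: real assume c: "c > 0"
    define e where "e = min (c * G) 1"
    have e: "0 < e" "e \<le> 1" "e \<le> c * G" using c G by (auto simp: e_def)
    from d_b_lower[OF g e(1,2)] obtain dl x1 where
      dl: "dl > 0 \<and> (\<forall>n. n \<ge> 1 \<longrightarrow> cycle_scale \<gamma> n \<ge> x1 \<longrightarrow> d_b \<gamma> (nat \<lfloor>e * cycle_scale \<gamma> n\<rfloor>) n \<ge> dl)"
      by (elim exE)
    have "\<forall>\<^sub>F n in sequentially. d_b \<gamma> (b n) n < dl" using lim dl by (intro order_tendstoD(2)) auto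
    then show "\<forall>\<^sub>F n in sequentially. norm (real (b n)) \<le> c * norm (?N n)"
      using ev_x[of x1] eventually_ge_at_top[of 1]
    proof eventually_elim
      case (elim n)
      have x: "?x n > 0" by (rule scale_pos[OF g elim(3)])
      show ?case
      proof (rule ccontr)
        assume "\<not> ?case"
        then have "c * G * ?x n < real (b n)" unfolding N using G x by (simp add: abs_mult mult_ac)
        moreover have "e * ?x n \<le> c * G * ?x n" using e x by (intro mult_right_mono) auto
        ultimately have "e * ?x n < real (b n)" by linarith
        then have "nat \<lfloor>e * ?x n\<rfloor> \<le> b n" by linarith
        then have "d_b \<gamma> (nat \<lfloor>e * ?x n\<rfloor>) n \<le> d_b \<gamma> (b n) n" by (rule d_b_mono)
        moreover have "dl \<le> d_b \<gamma> (nat \<lfloor>e * ?x n\<rfloor>) n" using dl elim by blast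
        ultimately show False using elim(1) by linarith
      qed
    qed
  qed
  from d_b_upper[OF g] obtain D x1 where
    D: "D > 0 \<and> x1 \<ge> 1 \<and> (\<forall>n b. n \<ge> 1 \<longrightarrow> cycle_scale \<gamma> n \<ge> x1 \<longrightarrow> real b \<le> cycle_scale \<gamma> n \<longrightarrow> b \<le> n \<longrightarrow>
    d_b \<gamma> b n \<le> D * ((real b / cycle_scale \<gamma> n) powr (2 + \<gamma>) + cycle_scale \<gamma> n powr (- \<gamma>)))"
    by (elim exE)
  have upper: "\<forall>\<^sub>F n in sequentially. d_b \<gamma> (b n) n \<le> D * ((real (b n) / ?x n) powr (2 + \<gamma>) + ?x n powr (- \<gamma>))"
    if o: "(\<lambda>n. real (b n)) \<in> o(?N)"
  proof -
    have "\<forall>\<^sub>F n in sequentially. norm (real (b n)) \<le> 1 / G * norm (?N n)"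
      by (rule landau_o.smallD[OF o]) (use G in simp)
    then show ?thesis
      using ev_x[of x1] eventually_ge_at_top[of 1]
    proof eventually_elim
      case (elim n)
      have x: "?x n > 0" by (rule scale_pos[OF g elim(3)])
      have "real (b n) \<le> ?x n" using elim(1) G x unfolding N by simp
      then show ?case using D elim bn[of n] by blast
    qed
  qed
  have sufficient: "(\<lambda>n. d_b \<gamma> (b n) n) \<longlonglongrightarrow> 0" if o: "(\<lambda>n. real (b n)) \<in> o(?N)"
  proof (rule tendsto_sandwich[OF _ upper[OF o] tendsto_const])
    show "\<forall>\<^sub>F n in sequentially. 0 \<le> d_b \<gamma> (b n) n" by (simp add: d_b_nonneg)
    have "((\<lambda>n. G * (real (b n) / ?N n)) \<longlongrightarrow> G * 0) sequentially"
      by (intro tendsto_mult tendsto_const smalloD_tendsto[OF o])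
    then have "((\<lambda>n. real (b n) / ?x n) \<longlongrightarrow> 0) sequentially" unfolding N using G by simp
    then have "((\<lambda>n. (real (b n) / ?x n) powr (2 + \<gamma>)) \<longlongrightarrow> 0 powr (2 + \<gamma>)) sequentially"
      by (rule tendsto_powr2[OF _ tendsto_const]) (use g in \<open>auto simp: cycle_scale_def\<close>)
    moreover have "((\<lambda>n. ?x n powr (- \<gamma>)) \<longlongrightarrow> 0) sequentially"
      by (rule tendsto_neg_powr[OF _ filterlim_scale[OF g]]) (use g in simp)
    ultimately have "((\<lambda>n. D * ((real (b n) / ?x n) powr (2 + \<gamma>) + ?x n powr (- \<gamma>))) \<longlongrightarrow> D * (0 powr (2 + \<gamma>) + 0)) sequentially"
      by (intro tendsto_mult tendsto_add tendsto_const)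
    then show "((\<lambda>n. D * ((real (b n) / ?x n) powr (2 + \<gamma>) + ?x n powr (- \<gamma>))) \<longlongrightarrow> 0) sequentially" by simp
  qed
  have bound: "(\<lambda>n. d_b \<gamma> (b n) n) \<in> O(\<lambda>n. real (b n) powr (2 + \<gamma>) * real n powr (- (2 + \<gamma>) / (1 + \<gamma>))
      + real (b n) powr (- \<gamma> / 6) + real n powr (- \<gamma> / (1 + \<gamma>)))"
    if o: "(\<lambda>n. real (b n)) \<in> o(?N)"
  proof (rule bigoI)
    let ?c = "G powr (2 + \<gamma>) + G powr \<gamma>"
    show "\<forall>\<^sub>F n in sequentially. norm (d_b \<gamma> (b n) n) \<le> D * ?c *
      norm (real (b n) powr (2 + \<gamma>) * real n powr (- (2 + \<gamma>) / (1 + \<gamma>))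
      + real (b n) powr (- \<gamma> / 6) + real n powr (- \<gamma> / (1 + \<gamma>)))"
      using upper[OF o] eventually_ge_at_top[of 1]
    proof eventually_elim
      case (elim n)
      have x: "?x n > 0" by (rule scale_pos[OF g elim(2)])
      have xN: "?x n = ?N n / G" using N[of n] G by simp
      have p1: "(real (b n) / ?x n) powr (2 + \<gamma>) = G powr (2 + \<gamma>) * (real (b n) powr (2 + \<gamma>) * real n powr (- (2 + \<gamma>) / (1 + \<gamma>)))"
      proof -
        have "?x n powr (2 + \<gamma>) = real n powr ((2 + \<gamma>) / (1 + \<gamma>)) / G powr (2 + \<gamma>)"
          unfolding xN using G by (simp add: powr_divide powr_powr)
        moreover have "(real (b n) / ?x n) powr (2 + \<gamma>) = real (b n) powr (2 + \<gamma>) / ?x n powr (2 + \<gamma>)"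
          by (rule powr_divide)
        moreover have "real n powr (- (2 + \<gamma>) / (1 + \<gamma>)) = 1 / real n powr ((2 + \<gamma>) / (1 + \<gamma>))"
          unfolding minus_divide_left[symmetric] by (rule powr_minus_divide)
        ultimately show ?thesis by simp
      qed
      have p2: "?x n powr (- \<gamma>) = G powr \<gamma> * real n powr (- \<gamma> / (1 + \<gamma>))"
        unfolding xN using G by (simp add: powr_divide powr_powr powr_minus_divide)
      let ?t1 = "real (b n) powr (2 + \<gamma>) * real n powr (- (2 + \<gamma>) / (1 + \<gamma>))"
      let ?t2 = "real (b n) powr (- \<gamma> / 6)" and ?t3 = "real n powr (- \<gamma> / (1 + \<gamma>))"
      have "norm (d_b \<gamma> (b n) n) = d_b \<gamma> (b n) n" by (simp add: d_b_nonneg)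
      also have "\<dots> \<le> D * (G powr (2 + \<gamma>) * ?t1 + G powr \<gamma> * ?t3)" using elim(1) unfolding p1 p2 .
      also have "\<dots> \<le> D * (?c * (?t1 + ?t2 + ?t3))"
      proof (rule mult_left_mono)
        have "?c * (?t1 + ?t2 + ?t3) = G powr (2 + \<gamma>) * ?t1 + G powr \<gamma> * ?t3 + (G powr \<gamma> * ?t1 + G powr (2 + \<gamma>) * ?t3 + ?c * ?t2)"
          by (simp add: algebra_simps)
        moreover have "G powr \<gamma> * ?t1 + G powr (2 + \<gamma>) * ?t3 + ?c * ?t2 \<ge> 0" by (intro add_nonneg_nonneg mult_nonneg_nonneg) auto
        ultimately show "G powr (2 + \<gamma>) * ?t1 + G powr \<gamma> * ?t3 \<le> ?c * (?t1 + ?t2 + ?t3)" by linarith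
      qed (use D in auto)
      also have "\<dots> = D * ?c * norm (?t1 + ?t2 + ?t3)"
      proof -
        have "?t1 + ?t2 + ?t3 \<ge> 0" by (intro add_nonneg_nonneg mult_nonneg_nonneg) auto
        then show ?thesis by (simp only: real_norm_def abs_of_nonneg mult.assoc)
      qed
      finally show ?case .
    qed
  qed
  show ?thesis using necessary sufficient bound by blast
qed

end
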